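(* Let $A,B$ be antisymmetric real $(3\times3)$-matrices with $[A,B]=AB-BA=0$ and $B\neq0$, let $W$ be a standard one-dimensional Wiener process, let $K\in\{\mathbb S^2,SO_3\}$, and consider the Stratonovich SDE $$dZ=AZ\,dt+BZ\circ dW$$ on $K$. With the orbit space $H$ and the measures $\mu_X$, $X\in H$, defined in the context, for each Borel probability measure $\theta$ on $H$ put $$\nu_\theta(J)=\int_H\mu_X(J)\,d\theta(X),\qquad J\in\mathscr B(K).$$ Then the mapping $\theta\mapsto\nu_\theta$ is a bijection between the set of Borel probability measures on $H$ and the set of invariant probability measures on $K$ for this SDE.
   Context: $SO_3$ is the group of orthogonal real $(3\times 3)$-matrices with determinant $1$; $\mathbb S^2\subset\mathbb R^3$ is the unit sphere, and matrices act on $K$ by left multiplication. Let $\rho=(\frac12\|B\|^2)^{1/2}$, where $\|B\|$ is the Euclidean (Frobenius) norm of $B$ in $\mathbb R^{3\times3}$. For $(x,y)\in\mathbb S^1\subset\mathbb R^2\cong\mathbb C$ put $$\mathbf s(x,y)=\frac{1-x}{\rho^2}B^2+\frac{y}{\rho}B+I,$$ and define $S:\mathbb S^1\times K\to K$, $S(p,Z)=\mathbf s(p)Z$. This is an action of the circle group $\mathbb S^1$ (complex multiplication) on $K$. For $Z\in K$ let $S^Z:\mathbb S^1\to K$, $S^Z(p)=S(p,Z)$. The orbit space is $H=\{S^Z[\mathbb S^1]:Z\in K\}$ with the quotient topology of the projection $\pi:K\to H$, $\pi(Z)=S^Z[\mathbb S^1]$ (it is compact and metrizable by the Hausdorff metric).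 For $X\in H$, $\mu_X$ is the image under $S^U$ of the normalized Haar measure on $\mathbb S^1$, where $U$ is any point of $X$ (the result does not depend on the choice of $U\in X$); $X\mapsto\mu_X(J)$ is Borel measurable for each $J\in\mathscr B(K)$. A Borel probability measure $\nu$ on $K$ is invariant if $\int_K \mathbb P(Z^z(t)\in J)\,d\nu(z)=\nu(J)$ for all $t\ge0$, $J\in\mathscr B(K)$, where $Z^z$ is the solution started at $z\in K$. *)

theory Defs
  imports "HOL-Probability.Probability"
begin

section \<open>Wiener processes\<close>

text \<open>Time is the half-line \<open>{0..}\<close>; processes and filtrations are indexed by \<^typ>\<open>real\<close>
  and only their restriction to nonnegative times carries information (a filtration on \<open>{0..}\<close>
  is extended by its value at 0).\<close>

definition wiener_process ::
    "'w measure \<Rightarrow> (real \<Rightarrow> 'w measure) \<Rightarrow> (real \<Rightarrow> 'w \<Rightarrow> real) \<Rightarrow> bool" where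
  "wiener_process M F W \<longleftrightarrow>
     prob_space M \<and> filtration (space M) F \<and> (\<forall>t. sets (F t) \<subseteq> sets M) \<and>
     (\<forall>t\<ge>0. W t \<in> borel_measurable (F t)) \<and>
     (AE \<omega> in M. W 0 \<omega> = 0) \<and>
     (AE \<omega> in M. continuous_on {0..} (\<lambda>t. W t \<omega>)) \<and>
     (\<forall>s t. 0 \<le> s \<and> s < t \<longrightarrow>
        distributed M lborel (\<lambda>\<omega>. W t \<omega> - W s \<omega>) (normal_density 0 (sqrt (t - s))) \<and>
        prob_space.indep_set M (sets (F s))
          {(\<lambda>\<omega>. W t \<omega> - W s \<omega>) -` E \<inter> space M | E. E \<in> sets borel})"


section \<open>The Stratonovich integral\<close>

definition time_partition :: "real \<Rightarrow> nat \<Rightarrow> (nat \<Rightarrow> real) \<Rightarrow> bool" where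
  "time_partition t n p \<longleftrightarrow> p 0 = 0 \<and> p n = t \<and> (\<forall>i<n. p i \<le> p (Suc i))"

text \<open>The sums \<open>S n p\<close> converge to \<open>I\<close> in probability as the mesh of the partition \<open>p\<close>
  of \<open>{0..t}\<close> tends to 0.\<close>

definition mesh_limit ::
    "'w measure \<Rightarrow> real \<Rightarrow> (nat \<Rightarrow> (nat \<Rightarrow> real) \<Rightarrow> 'w \<Rightarrow> 'a::euclidean_space) \<Rightarrow> ('w \<Rightarrow> 'a) \<Rightarrow> bool"
where
  "mesh_limit M t S I \<longleftrightarrow>
     I \<in> borel_measurable M \<and>
     (\<forall>\<epsilon>>0. \<exists>\<delta>>0. \<forall>n p. time_partition t n p \<and> (\<forall>i<n. p (Suc i) - p i < \<delta>) \<longrightarrow>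
        measure M {\<omega> \<in> space M. \<epsilon> < dist (S n p \<omega>) (I \<omega>)} < \<epsilon>)"

text \<open>The integrands below are continuous adapted processes, for which the Ito integral is the
  limit in probability of the left-point sums.\<close>

definition has_ito_integral ::
    "'w measure \<Rightarrow> (real \<Rightarrow> 'w \<Rightarrow> real) \<Rightarrow> (real \<Rightarrow> 'w \<Rightarrow> 'a::euclidean_space) \<Rightarrow> real \<Rightarrow> ('w \<Rightarrow> 'a) \<Rightarrow> bool"
where
  "has_ito_integral M W Y t I \<longleftrightarrow>
     mesh_limit M t (\<lambda>n p \<omega>. \<Sum>i<n. (W (p (Suc i)) \<omega> - W (p i) \<omega>) *\<^sub>R Y (p i) \<omega>) I"

definition finite_variation :: "(real \<Rightarrow> 'a::euclidean_space) \<Rightarrow> bool" where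
  "finite_variation c \<longleftrightarrow>
     (\<forall>t\<ge>0. \<exists>V. \<forall>n p. time_partition t n p \<longrightarrow> (\<Sum>i<n. norm (c (p (Suc i)) - c (p i))) \<le> V)"

text \<open>The bracket \<open>C = [Y, W]\<close>, a continuous process of finite variation.\<close>

definition has_bracket ::
    "'w measure \<Rightarrow> (real \<Rightarrow> 'w \<Rightarrow> real) \<Rightarrow> (real \<Rightarrow> 'w \<Rightarrow> 'a::euclidean_space) \<Rightarrow>
     (real \<Rightarrow> 'w \<Rightarrow> 'a) \<Rightarrow> bool"
where
  "has_bracket M W Y C \<longleftrightarrow>
     (\<forall>t\<ge>0. mesh_limit M t
        (\<lambda>n p \<omega>. \<Sum>i<n. (W (p (Suc i)) \<omega> - W (p i) \<omega>) *\<^sub>R (Y (p (Suc i)) \<omega> - Y (p i) \<omega>)) (C t)) \<and>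
     (AE \<omega> in M. continuous_on {0..} (\<lambda>t. C t \<omega>) \<and> finite_variation (\<lambda>t. C t \<omega>))"

text \<open>\<open>\<integral> Y \<circ> dW = \<integral> Y dW + [Y, W] / 2\<close>. Adding the left-point sums and half of the bracket sums
  gives the sums \<open>\<Sum> (Y (p i) + Y (p (i + 1))) / 2 * (W (p (i + 1)) - W (p i))\<close>. For every continuous
  semimartingale \<open>Y\<close> the bracket exists in the sense above.\<close>

definition has_stratonovich_integral ::
    "'w measure \<Rightarrow> (real \<Rightarrow> 'w \<Rightarrow> real) \<Rightarrow> (real \<Rightarrow> 'w \<Rightarrow> 'a::euclidean_space) \<Rightarrow>
     (real \<Rightarrow> 'w \<Rightarrow> 'a) \<Rightarrow> bool"
where
  "has_stratonovich_integral M W Y I \<longleftrightarrow>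
     (\<exists>J C. (\<forall>t\<ge>0. has_ito_integral M W Y t (J t)) \<and> has_bracket M W Y C \<and>
        (\<forall>t\<ge>0. AE \<omega> in M. I t \<omega> = J t \<omega> + (1/2) *\<^sub>R C t \<omega>))"


section \<open>The equation \<open>dZ = A Z dt + B Z \<circ> dW\<close>\<close>

text \<open>From here on \<open>act\<close> is the left multiplication by a matrix: \<^const>\<open>matrix_vector_mult\<close> on vectors,
  \<^const>\<open>matrix_matrix_mult\<close> on matrices.\<close>

definition borel_on :: "'a::topological_space set \<Rightarrow> 'a measure" where
  "borel_on K = restrict_space borel K"

definition stratonovich_solution ::
    "'w measure \<Rightarrow> (real \<Rightarrow> 'w measure) \<Rightarrow> (real \<Rightarrow> 'w \<Rightarrow> real) \<Rightarrow>
     (real^3^3 \<Rightarrow> 'a \<Rightarrow> 'a::euclidean_space) \<Rightarrow> real^3^3 \<Rightarrow> real^3^3 \<Rightarrow> 'a set \<Rightarrow>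
     'a \<Rightarrow> (real \<Rightarrow> 'w \<Rightarrow> 'a) \<Rightarrow> bool"
where
  "stratonovich_solution M F W act A B K z Z \<longleftrightarrow>
     (\<forall>t\<ge>0. Z t \<in> F t \<rightarrow>\<^sub>M borel_on K) \<and>
     (AE \<omega> in M. continuous_on {0..} (\<lambda>t. Z t \<omega>)) \<and>
     (\<exists>I. has_stratonovich_integral M W (\<lambda>t \<omega>. act B (Z t \<omega>)) I \<and>
        (\<forall>t\<ge>0. AE \<omega> in M. Z t \<omega> = z + integral {0..t} (\<lambda>s. act A (Z s \<omega>)) + I t \<omega>))"

definition borel_probabilities :: "'a measure \<Rightarrow> 'a measure set" where
  "borel_probabilities N = space (prob_algebra N)"

text \<open>\<open>Z z\<close> is the solution started at \<open>z\<close>.\<close>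

definition invariant_measures ::
    "'w measure \<Rightarrow> 'a::euclidean_space set \<Rightarrow> ('a \<Rightarrow> real \<Rightarrow> 'w \<Rightarrow> 'a) \<Rightarrow> 'a measure set"
where
  "invariant_measures M K Z =
     {\<nu> \<in> borel_probabilities (borel_on K).
        \<forall>t\<ge>0. \<forall>J\<in>sets (borel_on K).
          (\<integral>\<^sup>+ z. emeasure M {\<omega> \<in> space M. Z z t \<omega> \<in> J} \<partial>\<nu>) = emeasure \<nu> J}"


section \<open>The circle action, its orbits and the orbital measures\<close>

abbreviation circle :: "complex set" where
  "circle \<equiv> sphere 0 1"

definition rho :: "real^3^3 \<Rightarrow> real" where
  "rho B = sqrt ((1/2) * (norm B)\<^sup>2)"

definition circle_matrix :: "real^3^3 \<Rightarrow> complex \<Rightarrow> real^3^3" where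
  "circle_matrix B p =
     ((1 - Re p) / (rho B)\<^sup>2) *\<^sub>R (B ** B) + (Im p / rho B) *\<^sub>R B + mat 1"

definition orbit_of ::
    "(real^3^3 \<Rightarrow> 'a \<Rightarrow> 'a) \<Rightarrow> real^3^3 \<Rightarrow> 'a \<Rightarrow> 'a set" where
  "orbit_of act B z = (\<lambda>p. act (circle_matrix B p) z) ` circle"

definition orbit_space ::
    "(real^3^3 \<Rightarrow> 'a \<Rightarrow> 'a) \<Rightarrow> real^3^3 \<Rightarrow> 'a set \<Rightarrow> 'a set set" where
  "orbit_space act B K = orbit_of act B ` K"

definition orbit_topology ::
    "(real^3^3 \<Rightarrow> 'a \<Rightarrow> 'a) \<Rightarrow> real^3^3 \<Rightarrow> 'a::topological_space set \<Rightarrow> 'a set topology" where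
  "orbit_topology act B K =
     topology (\<lambda>U. U \<subseteq> orbit_space act B K \<and>
                   openin (top_of_set K) {z \<in> K. orbit_of act B z \<in> U})"

lemma openin_orbit_topology:
  "openin (orbit_topology act B K) U \<longleftrightarrow>
     U \<subseteq> orbit_space act B K \<and> openin (top_of_set K) {z \<in> K. orbit_of act B z \<in> U}"
proof -
  define P where "P U \<longleftrightarrow> U \<subseteq> orbit_space act B K \<and>
      openin (top_of_set K) {z \<in> K. orbit_of act B z \<in> U}" for U
  have "P (S \<inter> T)" if "P S" "P T" for S T
  proof -
    have "{z \<in> K. orbit_of act B z \<in> S \<inter> T} =
        {z \<in> K. orbit_of act B z \<in> S} \<inter> {z \<in> K. orbit_of act B z \<in> T}"
      by auto
    then show ?thesis using that unfolding P_def by auto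
  qed
  moreover have "P (\<Union>\<U>)" if "\<forall>S\<in>\<U>. P S" for \<U>
  proof -
    have "{z \<in> K. orbit_of act B z \<in> \<Union>\<U>} = (\<Union>S\<in>\<U>. {z \<in> K. orbit_of act B z \<in> S})"
      by auto
    then show ?thesis using that unfolding P_def by (auto intro!: openin_Union)
  qed
  ultimately have "istopology P"
    unfolding istopology_def by blast
  then have "openin (topology P) U \<longleftrightarrow> P U"
    by (simp add: topology_inverse')
  then show ?thesis
    unfolding P_def orbit_topology_def .
qed

lemma quotient_map_orbit_of:
  "quotient_map (top_of_set K) (orbit_topology act B K) (orbit_of act B)"
proof -
  have "{z \<in> K. orbit_of act B z \<in> orbit_space act B K} = K"
    by (auto simp: orbit_space_def)
  then have "openin (orbit_topology act B K) (orbit_space act B K)"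
    unfolding openin_orbit_topology by auto
  then have "topspace (orbit_topology act B K) = orbit_space act B K"
    unfolding topspace_def by (auto simp: openin_orbit_topology)
  then show ?thesis
    by (auto simp: quotient_map_def openin_orbit_topology orbit_space_def)
qed

definition orbit_borel ::
    "(real^3^3 \<Rightarrow> 'a \<Rightarrow> 'a) \<Rightarrow> real^3^3 \<Rightarrow> 'a::topological_space set \<Rightarrow> 'a set measure" where
  "orbit_borel act B K =
     sigma (orbit_space act B K) {U. openin (orbit_topology act B K) U}"

definition circle_haar :: "complex measure" where
  "circle_haar = (THE m. m \<in> borel_probabilities (borel_on circle) \<and>
     (\<forall>p\<in>circle. distr m (borel_on circle) (\<lambda>q. p * q) = m))"

definition orbit_measure ::
    "(real^3^3 \<Rightarrow> 'a \<Rightarrow> 'a) \<Rightarrow> real^3^3 \<Rightarrow> 'a::topological_space set \<Rightarrow> 'a set \<Rightarrow> 'a measure" where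
  "orbit_measure act B K X =
     distr circle_haar (borel_on K) (\<lambda>p. act (circle_matrix B p) (SOME U. U \<in> X))"

definition orbit_mixture ::
    "(real^3^3 \<Rightarrow> 'a \<Rightarrow> 'a) \<Rightarrow> real^3^3 \<Rightarrow> 'a::topological_space set \<Rightarrow>
     'a set measure \<Rightarrow> 'a measure" where
  "orbit_mixture act B K \<theta> =
     measure_of K (sets (borel_on K)) (\<lambda>J. \<integral>\<^sup>+ X. emeasure (orbit_measure act B K X) J \<partial>\<theta>)"

end

(*
Commuting antisymmetric 3x3 matrices are proportional, A = alpha B, so the solution started at z is
Z(t) = exp ((alpha t + W(t)) B) z, a point of the circle orbit of z. To derive this from the definition
of a solution, the bracket C = [B Z, W] is identified with the integral of B B Z, and the
mean of the inner product of Z(t) with the explicit flow is shown to have increments o(h) over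
intervals of length h. It is therefore constant, and as both vectors have the same fixed norm they
agree almost surely.

Circle-invariant measures are thus invariant. Conversely, at a large time t the law of W(t) changes
little in total variation under a fixed shift, so an invariant measure is invariant under the circle.
Finally a circle-invariant nu is the mixture of the orbital measures over its own image on H, and
the image of nu_theta on H is theta because mu_X is carried by X.
*)

theory Submission
  imports Defs
begin

section \<open>Second-moment bounds and expectations under limits in probability\<close>

section \<open>Convergence in probability\<close>

text \<open>A solution is given through limits in probability and an equation that holds almost
  surely at each fixed time, so every stochastic estimate below is made on finite sums over
  partitions and then carried to the limit. The bracket C is itself part of the drift from which it
  has to be computed; its finite variation is what removes this circularity.

  The inner product is chosen for an exact cancellation. Let x be the solution, y the explicit flow
  and w the Wiener increment over a step of length h. The coefficient of the inner product of b x
  and b y is -w^2/2 from the expansion of y, -h/2 from the drift of x and w^2 from the product of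
  increments, together (w^2 - h)/2, which has mean zero given the past. The terms with \<alpha>
  cancel because b is skew. What is left is at most a constant times h (\<epsilon> + sqrt h), where
  \<epsilon> measures mean-square continuity of the solution, and the sum over T/h steps is a
  multiple of T \<epsilon>.

  The sphere and SO_3 are treated together: both are acted on by a skew operator b with b^3 = - r^2
  b, and this identity makes the group generated by b a polynomial in b.\<close>

definition tendsto_prob :: "'w measure \<Rightarrow> (nat \<Rightarrow> 'w \<Rightarrow> 'a::euclidean_space) \<Rightarrow> ('w \<Rightarrow> 'a) \<Rightarrow> bool" where
  "tendsto_prob M X L \<longleftrightarrow>
     (\<forall>\<epsilon>>0. \<forall>\<^sub>F n in sequentially. measure M {\<omega> \<in> space M. \<epsilon> < dist (X n \<omega>) (L \<omega>)} < \<epsilon>)"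

context prob_space
begin

text \<open>Borel-Cantelli: the index \<open>r k\<close> is chosen so that a distance above (1/2)^k
  has probability at most (1/2)^k. The recursion for \<open>r\<close> picks each new index beyond
  the previous one, which makes it strictly increasing.\<close>

lemma tendsto_prob_AE_subseq:
  fixes X :: "nat \<Rightarrow> 'a \<Rightarrow> 'b::euclidean_space"
  assumes [measurable]: "\<And>n. X n \<in> borel_measurable M" "L \<in> borel_measurable M"
    and X: "tendsto_prob M X L"
  obtains r :: "nat \<Rightarrow> nat" where "strict_mono r" "AE \<omega> in M. (\<lambda>n. X (r n) \<omega>) \<longlonglongrightarrow> L \<omega>"
proof -
  define A where "A n k = {\<omega> \<in> space M. (1/2)^k < dist (X n \<omega>) (L \<omega>)}" for n k
  have [measurable]: "A n k \<in> sets M" for n k unfolding A_def by measurable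
  have "\<exists>n>m. prob (A n k) < (1/2)^k" for m k
  proof -
    have "\<forall>\<^sub>F n in sequentially. prob (A n k) < (1/2)^k"
      using X[unfolded tendsto_prob_def, rule_format, of "(1/2)^k"] by (simp add: A_def)
    then have "\<forall>\<^sub>F n in sequentially. prob (A n k) < (1/2)^k \<and> n > m"
      using eventually_gt_at_top eventually_conj by blast
    then obtain N where "\<And>n. n \<ge> N \<Longrightarrow> prob (A n k) < (1/2)^k \<and> n > m"
      unfolding eventually_sequentially by blast
    then show ?thesis by blast
  qed
  then obtain g where g: "\<And>m k. g m k > m" "\<And>m k. prob (A (g m k) k) < (1/2)^k"
    by metis
  define r where "r = rec_nat (g 0 0) (\<lambda>k m. g m (Suc k))"
  have r0: "r 0 = g 0 0" "\<And>k. r (Suc k) = g (r k) (Suc k)" by (simp_all add: r_def)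
  have mono: "strict_mono r" by (simp add: strict_mono_Suc_iff r0 g)
  have p: "prob (A (r k) k) \<le> (1/2)^k" for k
    using g(2) by (cases k) (auto simp: r0 less_imp_le simp del: power_Suc)
  have "summable (\<lambda>k. prob (A (r k) k))"
    by (rule summable_comparison_test_ev[where g="\<lambda>k. (1/2)^k"]) (auto simp: p)
  then have "AE \<omega> in M. \<forall>\<^sub>F k in sequentially. \<omega> \<in> space M - A (r k) k"
    by (intro borel_cantelli_AE1) (auto simp: less_top[symmetric])
  moreover have "(\<lambda>n. X (r n) \<omega>) \<longlonglongrightarrow> L \<omega>" if "\<forall>\<^sub>F k in sequentially. \<omega> \<in> space M - A (r k) k" for \<omega>
  proof -
    have "(\<lambda>k. dist (X (r k) \<omega>) (L \<omega>)) \<longlonglongrightarrow> 0"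
    proof (rule tendsto_sandwich[where f="\<lambda>_. 0" and h="\<lambda>k. (1/2)^k"])
      show "\<forall>\<^sub>F k in sequentially. dist (X (r k) \<omega>) (L \<omega>) \<le> (1/2)^k"
        using that by eventually_elim (auto simp: A_def not_less)
      show "(\<lambda>k. (1/2)^k) \<longlonglongrightarrow> (0::real)" by (rule LIMSEQ_power_zero) simp
    qed auto
    then show ?thesis using tendsto_dist_iff by blast
  qed
  ultimately have "AE \<omega> in M. (\<lambda>n. X (r n) \<omega>) \<longlonglongrightarrow> L \<omega>" by auto
  with mono show thesis by (rule that)
qed

text \<open>Fatou's lemma for the squared norms. It yields square integrability of the limit
  together with the bound, so stochastic integrals inherit both from their approximating
  sums.\<close>

lemma AE_limit_square_bound:
  fixes X :: "nat \<Rightarrow> 'a \<Rightarrow> 'b::euclidean_space"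
  assumes [measurable]: "\<And>n. X n \<in> borel_measurable M" "L \<in> borel_measurable M"
    and X: "AE \<omega> in M. (\<lambda>n. X n \<omega>) \<longlonglongrightarrow> L \<omega>"
    and int: "\<And>n. integrable M (\<lambda>\<omega>. (norm (X n \<omega>))\<^sup>2)"
    and bound: "\<And>n. expectation (\<lambda>\<omega>. (norm (X n \<omega>))\<^sup>2) \<le> k"
  shows "integrable M (\<lambda>\<omega>. (norm (L \<omega>))\<^sup>2)" "expectation (\<lambda>\<omega>. (norm (L \<omega>))\<^sup>2) \<le> k"
proof -
  have k: "0 \<le> k"
    using bound[of 0] by (rule order_trans[rotated]) (simp add: integral_nonneg_AE)
  have "(\<integral>\<^sup>+\<omega>. ennreal ((norm (L \<omega>))\<^sup>2) \<partial>M) = (\<integral>\<^sup>+\<omega>. liminf (\<lambda>n. ennreal ((norm (X n \<omega>))\<^sup>2)) \<partial>M)"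
  proof (rule nn_integral_cong_AE, use X in eventually_elim)
    case (elim \<omega>)
    have "(\<lambda>n. ennreal ((norm (X n \<omega>))\<^sup>2)) \<longlonglongrightarrow> ennreal ((norm (L \<omega>))\<^sup>2)"
      using elim by (intro tendsto_ennrealI tendsto_intros)
    from lim_imp_Liminf[OF trivial_limit_sequentially this] show ?case by (rule sym)
  qed
  also have "\<dots> \<le> liminf (\<lambda>n. (\<integral>\<^sup>+\<omega>. ennreal ((norm (X n \<omega>))\<^sup>2) \<partial>M))"
    by (rule nn_integral_liminf) simp
  also have "\<dots> \<le> ennreal k"
    using bound by (intro Liminf_le always_eventually) (simp_all add: nn_integral_eq_integral int ennreal_leI)
  finally have *: "(\<integral>\<^sup>+\<omega>. ennreal ((norm (L \<omega>))\<^sup>2) \<partial>M) \<le> ennreal k" .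
  show "integrable M (\<lambda>\<omega>. (norm (L \<omega>))\<^sup>2)"
    using le_less_trans[OF * ennreal_less_top] by (intro integrableI_bounded) simp_all
  then show "expectation (\<lambda>\<omega>. (norm (L \<omega>))\<^sup>2) \<le> k"
    using * k by (simp add: nn_integral_eq_integral)
qed

lemma tendsto_prob_square_bound:
  fixes X :: "nat \<Rightarrow> 'a \<Rightarrow> 'b::euclidean_space"
  assumes meas [measurable]: "\<And>n. X n \<in> borel_measurable M" "L \<in> borel_measurable M"
    and X: "tendsto_prob M X L"
    and int: "\<And>n. integrable M (\<lambda>\<omega>. (norm (X n \<omega>))\<^sup>2)"
    and bound: "\<And>n. expectation (\<lambda>\<omega>. (norm (X n \<omega>))\<^sup>2) \<le> k"
  shows "integrable M (\<lambda>\<omega>. (norm (L \<omega>))\<^sup>2)" "expectation (\<lambda>\<omega>. (norm (L \<omega>))\<^sup>2) \<le> k"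
proof -
  obtain r :: "nat \<Rightarrow> nat" where "AE \<omega> in M. (\<lambda>n. X (r n) \<omega>) \<longlonglongrightarrow> L \<omega>"
    using tendsto_prob_AE_subseq[OF meas X] by blast
  then show "integrable M (\<lambda>\<omega>. (norm (L \<omega>))\<^sup>2)" "expectation (\<lambda>\<omega>. (norm (L \<omega>))\<^sup>2) \<le> k"
    using AE_limit_square_bound[of "\<lambda>n. X (r n)" L k] int bound by auto
qed

lemma square_integrable_diff:
  fixes X Y :: "'a \<Rightarrow> 'b::euclidean_space"
  assumes [measurable]: "X \<in> borel_measurable M" "Y \<in> borel_measurable M"
    and "integrable M (\<lambda>\<omega>. (norm (X \<omega>))\<^sup>2)" "integrable M (\<lambda>\<omega>. (norm (Y \<omega>))\<^sup>2)"
  shows "integrable M (\<lambda>\<omega>. (norm (X \<omega> - Y \<omega>))\<^sup>2)"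
    and "expectation (\<lambda>\<omega>. (norm (X \<omega> - Y \<omega>))\<^sup>2)
      \<le> 2 * expectation (\<lambda>\<omega>. (norm (X \<omega>))\<^sup>2) + 2 * expectation (\<lambda>\<omega>. (norm (Y \<omega>))\<^sup>2)"
proof -
  have *: "(norm (x - y))\<^sup>2 \<le> 2 * (norm x)\<^sup>2 + 2 * (norm y)\<^sup>2" for x y :: 'b
    using inner_ge_zero[of "x + y"] by (simp add: power2_norm_eq_inner inner_diff inner_add inner_commute)
  have i: "integrable M (\<lambda>\<omega>. 2 * (norm (X \<omega>))\<^sup>2 + 2 * (norm (Y \<omega>))\<^sup>2)"
    using assms by auto
  show 1: "integrable M (\<lambda>\<omega>. (norm (X \<omega> - Y \<omega>))\<^sup>2)"
    by (rule Bochner_Integration.integrable_bound[OF i]) (use * in auto)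
  have "expectation (\<lambda>\<omega>. (norm (X \<omega> - Y \<omega>))\<^sup>2) \<le> expectation (\<lambda>\<omega>. 2 * (norm (X \<omega>))\<^sup>2 + 2 * (norm (Y \<omega>))\<^sup>2)"
    by (rule integral_mono[OF 1 i *])
  then show "expectation (\<lambda>\<omega>. (norm (X \<omega> - Y \<omega>))\<^sup>2)
      \<le> 2 * expectation (\<lambda>\<omega>. (norm (X \<omega>))\<^sup>2) + 2 * expectation (\<lambda>\<omega>. (norm (Y \<omega>))\<^sup>2)"
    using assms by simp
qed

lemma integrable_of_square:
  fixes X :: "'a \<Rightarrow> 'b::euclidean_space"
  assumes [measurable]: "X \<in> borel_measurable M" and "integrable M (\<lambda>\<omega>. (norm (X \<omega>))\<^sup>2)"
  shows "integrable M X"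
proof (rule Bochner_Integration.integrable_bound[where f="\<lambda>\<omega>. 1 + (norm (X \<omega>))\<^sup>2"])
  have "x \<le> 1 + x\<^sup>2" for x :: real
    using zero_le_power2[of "x - 1/2"] unfolding power2_diff by (simp add: power_divide)
  then show "AE \<omega> in M. norm (X \<omega>) \<le> norm (1 + (norm (X \<omega>))\<^sup>2)"
    by (auto intro!: AE_I2 order_trans[OF _ abs_ge_self])
qed (use assms in auto)

text \<open>A common bound on the second moments makes the sequence uniformly integrable, which
  upgrades convergence in probability to convergence in mean.\<close>

lemma tendsto_prob_L1:
  fixes X :: "nat \<Rightarrow> 'a \<Rightarrow> 'b::euclidean_space"
  assumes meas [measurable]: "\<And>n. X n \<in> borel_measurable M" "L \<in> borel_measurable M"
    and X: "tendsto_prob M X L"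
    and int: "\<And>n. integrable M (\<lambda>\<omega>. (norm (X n \<omega>))\<^sup>2)"
    and bound: "\<And>n. expectation (\<lambda>\<omega>. (norm (X n \<omega>))\<^sup>2) \<le> k"
  shows "(\<lambda>n. expectation (\<lambda>\<omega>. norm (X n \<omega> - L \<omega>))) \<longlonglongrightarrow> 0"
proof -
  note L = tendsto_prob_square_bound[OF meas X int bound]
  have k: "0 \<le> k"
    using bound[of 0] by (rule order_trans[rotated]) (simp add: integral_nonneg_AE)
  have D: "integrable M (\<lambda>\<omega>. (norm (X n \<omega> - L \<omega>))\<^sup>2)" "expectation (\<lambda>\<omega>. (norm (X n \<omega> - L \<omega>))\<^sup>2) \<le> 4 * k" for n
    using square_integrable_diff[OF meas(1,2) int L(1), of n] bound[of n] L(2) by (blast, linarith)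
  have D1: "integrable M (\<lambda>\<omega>. X n \<omega> - L \<omega>)" for n
    by (rule integrable_of_square[OF _ D(1)]) simp
  \<comment> \<open>With d the distance, the majorant is
    \<open>\<eta> + \<eta> * d\<^sup>2 + indicator S / \<eta>\<close>. If d exceeds \<eta>, then
    \<omega> lies in S because \<eta>^2 is at most \<eta>, and completing the square gives d at most
    \<eta> d^2 + 1/\<eta>. The probability of S is below \<eta>^2, so its weight 1/\<eta> costs at
    most \<eta> in mean; the total is (4k + 2) \<eta>.\<close>
  have key: "\<forall>\<^sub>F n in sequentially. expectation (\<lambda>\<omega>. norm (X n \<omega> - L \<omega>)) \<le> (4*k+2)*\<eta>" if \<eta>: "0 < \<eta>" "\<eta> \<le> 1" for \<eta>
  proof -
    have "\<forall>\<^sub>F n in sequentially. prob {\<omega> \<in> space M. \<eta>\<^sup>2 < dist (X n \<omega>) (L \<omega>)} < \<eta>\<^sup>2"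
      using X[unfolded tendsto_prob_def, rule_format, of "\<eta>\<^sup>2"] \<eta> by simp
    then show ?thesis
    proof eventually_elim
      case (elim n)
      define S where "S = {\<omega> \<in> space M. \<eta>\<^sup>2 < dist (X n \<omega>) (L \<omega>)}"
      have [measurable]: "S \<in> sets M" unfolding S_def by measurable
      have i: "integrable M (\<lambda>\<omega>. \<eta> + \<eta> * (norm (X n \<omega> - L \<omega>))\<^sup>2 + indicator S \<omega> / \<eta>)"
        using D by (auto simp: less_top[symmetric])
      have "expectation (\<lambda>\<omega>. norm (X n \<omega> - L \<omega>))
          \<le> expectation (\<lambda>\<omega>. \<eta> + \<eta> * (norm (X n \<omega> - L \<omega>))\<^sup>2 + indicator S \<omega> / \<eta>)"
      proof (rule integral_mono[OF integrable_norm[OF D1] i])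
        fix \<omega> assume \<omega>: "\<omega> \<in> space M"
        define d where "d = norm (X n \<omega> - L \<omega>)"
        show "norm (X n \<omega> - L \<omega>) \<le> \<eta> + \<eta> * (norm (X n \<omega> - L \<omega>))\<^sup>2 + indicator S \<omega> / \<eta>"
        proof (cases "d \<le> \<eta>")
          case True
          moreover have "0 \<le> \<eta> * d\<^sup>2" "0 \<le> indicator S \<omega> / \<eta>" using \<eta> by simp_all
          ultimately show ?thesis unfolding d_def by linarith
        next
          case False
          moreover have "\<eta>\<^sup>2 \<le> \<eta>" unfolding power2_eq_square using \<eta> by (intro mult_left_le) auto
          ultimately have "\<eta>\<^sup>2 < d" by linarith
          then have "\<omega> \<in> S" using \<omega> by (simp add: S_def d_def dist_norm)
          moreover have "0 \<le> (\<eta> * d - 1/2)\<^sup>2" by simp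
          then have "d * \<eta> \<le> (\<eta>\<^sup>2 * d\<^sup>2 + 1)"
            unfolding power2_diff by (simp add: power_mult_distrib power_divide mult.commute)
          then have "d \<le> (\<eta>\<^sup>2 * d\<^sup>2 + 1) / \<eta>" using \<eta> by (simp add: pos_le_divide_eq)
          then have "d \<le> \<eta> * d\<^sup>2 + 1/\<eta>"
            using \<eta> by (simp add: add_divide_distrib power2_eq_square)
          ultimately show ?thesis using \<eta> by (simp add: d_def)
        qed
      qed
      also have "\<dots> = \<eta> + \<eta> * expectation (\<lambda>\<omega>. (norm (X n \<omega> - L \<omega>))\<^sup>2) + prob S / \<eta>"
        using D by (simp add: less_top[symmetric] prob_space)
      also have "\<dots> \<le> \<eta> + \<eta> * (4 * k) + \<eta>\<^sup>2 / \<eta>"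
        using D(2)[of n] elim \<eta> unfolding S_def[symmetric]
        by (intro add_mono mult_left_mono divide_right_mono) auto
      also have "\<dots> = (4*k+2)*\<eta>" using \<eta> by (simp add: power2_eq_square algebra_simps)
      finally show ?case .
    qed
  qed
  show ?thesis
  proof (rule tendstoI)
    fix e :: real assume e: "e > 0"
    define \<eta> where "\<eta> = min 1 (e / (2 * (4*k+2)))"
    have \<eta>: "0 < \<eta>" "\<eta> \<le> 1" using e k by (auto simp: \<eta>_def)
    have "\<eta> \<le> e / (2 * (4*k+2))" by (simp add: \<eta>_def)
    then have "\<eta> * (2 * (4*k+2)) \<le> e" using k by (simp add: pos_le_divide_eq del: distrib_left_numeral)
    then have "(4*k+2)*\<eta> < e" using e by (simp add: algebra_simps)
    with key[OF \<eta>] show "\<forall>\<^sub>F n in sequentially. dist (expectation (\<lambda>\<omega>. norm (X n \<omega> - L \<omega>))) 0 < e"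
      by (auto elim!: eventually_mono simp: integral_nonneg_AE)
  qed
qed

text \<open>Mean-square bounded sums converge in L1, and pairing with a bounded \<xi> is continuous
  in L1. This is how the martingale property passes from left-point sums to the Ito
  integral.\<close>

lemma tendsto_prob_inner_zero:
  fixes X :: "nat \<Rightarrow> 'a \<Rightarrow> 'b::euclidean_space"
  assumes meas [measurable]: "\<And>n. X n \<in> borel_measurable M" "L \<in> borel_measurable M" "\<xi> \<in> borel_measurable M"
    and X: "tendsto_prob M X L"
    and int: "\<And>n. integrable M (\<lambda>\<omega>. (norm (X n \<omega>))\<^sup>2)"
    and bound: "\<And>n. expectation (\<lambda>\<omega>. (norm (X n \<omega>))\<^sup>2) \<le> k"
    and \<xi>: "\<And>\<omega>. \<omega> \<in> space M \<Longrightarrow> norm (\<xi> \<omega>) \<le> c"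
    and zero: "\<And>n. expectation (\<lambda>\<omega>. X n \<omega> \<bullet> \<xi> \<omega>) = 0"
  shows "expectation (\<lambda>\<omega>. L \<omega> \<bullet> \<xi> \<omega>) = 0"
proof -
  have iX: "integrable M (X n)" for n by (rule integrable_of_square[OF _ int]) simp
  have iL: "integrable M L"
    by (rule integrable_of_square[OF _ tendsto_prob_square_bound(1)[OF meas(1,2) X int bound]]) simp
  have i: "integrable M (\<lambda>\<omega>. Y \<omega> \<bullet> \<xi> \<omega>)" if [measurable]: "integrable M Y" for Y :: "'a \<Rightarrow> 'b"
  proof (rule Bochner_Integration.integrable_bound[where f="\<lambda>\<omega>. c * norm (Y \<omega>)"])
    show "AE \<omega> in M. norm (Y \<omega> \<bullet> \<xi> \<omega>) \<le> norm (c * norm (Y \<omega>))"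
    proof (rule AE_I2)
      fix \<omega> assume "\<omega> \<in> space M"
      then have "norm (Y \<omega>) * norm (\<xi> \<omega>) \<le> norm (Y \<omega>) * c" using \<xi> by (intro mult_left_mono) auto
      then show "norm (Y \<omega> \<bullet> \<xi> \<omega>) \<le> norm (c * norm (Y \<omega>))"
        using Cauchy_Schwarz_ineq2[of "Y \<omega>" "\<xi> \<omega>"] abs_ge_self[of "c * norm (Y \<omega>)"]
        by (simp add: mult.commute)
    qed
  qed (use that in auto)
  have "norm (expectation (\<lambda>\<omega>. L \<omega> \<bullet> \<xi> \<omega>)) \<le> c * expectation (\<lambda>\<omega>. norm (X n \<omega> - L \<omega>))" for n
  proof -
    have "expectation (\<lambda>\<omega>. L \<omega> \<bullet> \<xi> \<omega>) = - expectation (\<lambda>\<omega>. (X n \<omega> - L \<omega>) \<bullet> \<xi> \<omega>)"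
      using zero[of n] i[OF iX[of n]] i[OF iL] by (simp add: inner_diff_left)
    also have "norm \<dots> \<le> expectation (\<lambda>\<omega>. norm ((X n \<omega> - L \<omega>) \<bullet> \<xi> \<omega>))"
      by (simp only: norm_minus_cancel) (rule integral_norm_bound)
    also have "\<dots> \<le> expectation (\<lambda>\<omega>. c * norm (X n \<omega> - L \<omega>))"
    proof (rule integral_mono)
      show "integrable M (\<lambda>\<omega>. norm ((X n \<omega> - L \<omega>) \<bullet> \<xi> \<omega>))" using i[of "\<lambda>\<omega>. X n \<omega> - L \<omega>"] iX iL by simp
      show "integrable M (\<lambda>\<omega>. c * norm (X n \<omega> - L \<omega>))" using iX iL by simp
      fix \<omega> assume "\<omega> \<in> space M"
      then have "norm (X n \<omega> - L \<omega>) * norm (\<xi> \<omega>) \<le> norm (X n \<omega> - L \<omega>) * c" using \<xi> by (intro mult_left_mono) auto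
      then show "norm ((X n \<omega> - L \<omega>) \<bullet> \<xi> \<omega>) \<le> c * norm (X n \<omega> - L \<omega>)"
        using Cauchy_Schwarz_ineq2[of "X n \<omega> - L \<omega>" "\<xi> \<omega>"] by (simp add: mult.commute)
    qed
    finally show ?thesis by simp
  qed
  moreover have "(\<lambda>n. c * expectation (\<lambda>\<omega>. norm (X n \<omega> - L \<omega>))) \<longlonglongrightarrow> c * 0"
    by (intro tendsto_intros tendsto_prob_L1[OF meas(1,2) X int bound])
  ultimately have "norm (expectation (\<lambda>\<omega>. L \<omega> \<bullet> \<xi> \<omega>)) \<le> c * 0"
    by (intro LIMSEQ_le_const) auto
  then show ?thesis by simp
qed

end

section \<open>Moments of Wiener increments and orthogonality of adapted sums\<close>

section \<open>Increments of a Wiener process\<close>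

locale wiener =
  fixes M :: "'w measure" and F :: "real \<Rightarrow> 'w measure" and W :: "real \<Rightarrow> 'w \<Rightarrow> real"
  assumes wiener: "wiener_process M F W"
begin

sublocale prob_space M
  using wiener by (simp add: wiener_process_def)

lemma space_F [simp]: "space (F t) = space M"
  using wiener by (simp add: wiener_process_def filtration_def)

lemma sets_F_mono: "s \<le> t \<Longrightarrow> sets (F s) \<subseteq> sets (F t)"
  using wiener by (simp add: wiener_process_def filtration_def)

lemma sets_F_subset: "sets (F t) \<subseteq> sets M"
  using wiener by (simp add: wiener_process_def)

lemma measurable_F_mono: "f \<in> F s \<rightarrow>\<^sub>M N \<Longrightarrow> s \<le> t \<Longrightarrow> f \<in> F t \<rightarrow>\<^sub>M N"
  using measurable_mono[OF order_refl refl sets_F_mono, of s t N] by auto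

lemma measurable_F_M: "f \<in> F s \<rightarrow>\<^sub>M N \<Longrightarrow> f \<in> M \<rightarrow>\<^sub>M N"
  using measurable_mono[OF order_refl refl sets_F_subset, of s N] by auto

lemma W_measurable_F: "0 \<le> s \<Longrightarrow> s \<le> t \<Longrightarrow> W s \<in> borel_measurable (F t)"
  by (rule measurable_F_mono[of "W s" s]) (use wiener in \<open>simp_all add: wiener_process_def\<close>)

lemma W_measurable: "0 \<le> t \<Longrightarrow> W t \<in> borel_measurable M"
  by (rule measurable_F_M[OF W_measurable_F[of t t]]) simp_all

lemma W_0: "AE \<omega> in M. W 0 \<omega> = 0"
  using wiener by (simp add: wiener_process_def)

lemma W_continuous: "AE \<omega> in M. continuous_on {0..} (\<lambda>t. W t \<omega>)"
  using wiener by (simp add: wiener_process_def)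

lemma increment_distributed:
  "0 \<le> s \<Longrightarrow> s < t \<Longrightarrow>
    distributed M lborel (\<lambda>\<omega>. W t \<omega> - W s \<omega>) (normal_density 0 (sqrt (t - s)))"
  using wiener by (simp add: wiener_process_def)

text \<open>The past is independent of the events of the increment. Both \<xi> and the function
  \<open>f\<close> of the increment generate sigma-algebras inside these two independent families,
  so the mean of the product factors.\<close>

lemma increment_indep:
  fixes \<xi> f :: "_ \<Rightarrow> real"
  assumes st: "0 \<le> s" "s \<le> t" and \<xi>: "\<xi> \<in> borel_measurable (F s)" and f: "f \<in> borel_measurable borel"
    and int: "integrable M \<xi>" "integrable M (\<lambda>\<omega>. f (W t \<omega> - W s \<omega>))"
  shows "integrable M (\<lambda>\<omega>. \<xi> \<omega> * f (W t \<omega> - W s \<omega>))"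
    and "expectation (\<lambda>\<omega>. \<xi> \<omega> * f (W t \<omega> - W s \<omega>)) = expectation \<xi> * expectation (\<lambda>\<omega>. f (W t \<omega> - W s \<omega>))"
proof -
  have "integrable M (\<lambda>\<omega>. \<xi> \<omega> * f (W t \<omega> - W s \<omega>)) \<and>
    expectation (\<lambda>\<omega>. \<xi> \<omega> * f (W t \<omega> - W s \<omega>)) = expectation \<xi> * expectation (\<lambda>\<omega>. f (W t \<omega> - W s \<omega>))"
  \<comment> \<open>Independence is part of the definition only for \<open>s < t\<close>; for equal
    times the increment is 0 and \<open>f\<close> contributes a constant.\<close>
  proof (cases "s = t")
    case True
    then show ?thesis using int by (simp add: prob_space)
  next
    case False
    define D where "D \<omega> = W t \<omega> - W s \<omega>" for \<omega>
    have "indep_set (sets (F s)) {D -` E \<inter> space M | E. E \<in> sets borel}"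
      using wiener st False unfolding D_def by (auto simp: wiener_process_def)
    then have *: "indep_set (sigma_sets (space M) {\<xi> -` A \<inter> space M | A. A \<in> sets borel})
        (sigma_sets (space M) {(\<lambda>\<omega>. f (D \<omega>)) -` A \<inter> space M | A. A \<in> sets borel})"
    proof -
      assume i: "indep_set (sets (F s)) {D -` E \<inter> space M | E. E \<in> sets borel}"
      have 1: "sigma_sets (space M) {\<xi> -` A \<inter> space M | A. A \<in> sets borel} \<subseteq> sets (F s)"
        using measurable_sets[OF \<xi>] by (subst space_F[of s, symmetric]) (intro sets.sigma_sets_subset, auto)
      have "{(\<lambda>\<omega>. f (D \<omega>)) -` A \<inter> space M | A. A \<in> sets borel} \<subseteq> {D -` E \<inter> space M | E. E \<in> sets borel}"
      proof safe
        fix A :: "real set" assume "A \<in> sets borel"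
        then have "f -` A \<in> sets borel" using measurable_sets_borel[OF f] by simp
        then show "\<exists>E. (\<lambda>\<omega>. f (D \<omega>)) -` A \<inter> space M = D -` E \<inter> space M \<and> E \<in> sets borel"
          by (intro exI[of _ "f -` A"]) auto
      qed
      \<comment> \<open>The preimages under \<open>D\<close> already form a sigma-algebra, hence the
        sigma-algebra generated by the coarser family stays inside them.\<close>
      moreover have "{D -` E \<inter> space M | E. E \<in> sets borel} = sets (vimage_algebra (space M) D borel)"
        by (simp add: sets_vimage_algebra2)
      ultimately have 2: "sigma_sets (space M) {(\<lambda>\<omega>. f (D \<omega>)) -` A \<inter> space M | A. A \<in> sets borel}
          \<subseteq> {D -` E \<inter> space M | E. E \<in> sets borel}"
        using sets.sigma_sets_subset[of _ "vimage_algebra (space M) D borel"] by simp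
      show ?thesis
        using indep_setD[OF i subsetD[OF 1] subsetD[OF 2]] subset_trans[OF 1] subset_trans[OF 2] i
        unfolding indep_sets2_eq by (simp only: conj_assoc simp_thms) blast
    qed
    have "indep_var borel \<xi> borel (\<lambda>\<omega>. f (D \<omega>))"
      unfolding indep_var_eq using * int by (auto simp: D_def)
    from indep_var_lebesgue_integral[OF this] indep_var_integrable[OF this] int show ?thesis
      by (simp add: D_def)
  qed
  then show "integrable M (\<lambda>\<omega>. \<xi> \<omega> * f (W t \<omega> - W s \<omega>))"
    "expectation (\<lambda>\<omega>. \<xi> \<omega> * f (W t \<omega> - W s \<omega>)) = expectation \<xi> * expectation (\<lambda>\<omega>. f (W t \<omega> - W s \<omega>))"
    by auto
qed

lemma increment_integrable:
  assumes st: "0 \<le> s" "s \<le> t"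
  shows "integrable M (\<lambda>\<omega>. (W t \<omega> - W s \<omega>) ^ k)"
proof (cases "s = t")
  case False
  have "integrable lborel (\<lambda>x. normal_density 0 (sqrt (t - s)) x * x ^ k)"
    using integrable_normal_moment[of "sqrt (t - s)" 0 k] st False by simp
  with distributed_integrable[OF increment_distributed, of s t "\<lambda>x. x ^ k"] st False
  show ?thesis by simp
next
  case True
  then show ?thesis by simp
qed

text \<open>The fourth moment enters through the variance of the squared increment, 3h^2 - h^2 =
  2h^2, which is what makes the quadratic variation sums concentrate.\<close>

lemma increment_moments:
  assumes st: "0 \<le> s" "s \<le> t"
  shows "expectation (\<lambda>\<omega>. W t \<omega> - W s \<omega>) = 0"
    and "expectation (\<lambda>\<omega>. (W t \<omega> - W s \<omega>)\<^sup>2) = t - s"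
    and "expectation (\<lambda>\<omega>. (W t \<omega> - W s \<omega>) ^ 4) = 3 * (t - s)\<^sup>2"
proof -
  have *: "expectation (\<lambda>\<omega>. (W t \<omega> - W s \<omega>) ^ k) = (\<integral>x. normal_density 0 (sqrt (t - s)) x * x ^ k \<partial>lborel)"
    if "s \<noteq> t" for k
    using distributed_integral[OF increment_distributed, of s t "\<lambda>x. x ^ k"] st that by simp
  show "expectation (\<lambda>\<omega>. W t \<omega> - W s \<omega>) = 0"
    using *[of 1] integral_normal_moment_odd[of "sqrt (t - s)" 0 0] st by (cases "s = t") auto
  show "expectation (\<lambda>\<omega>. (W t \<omega> - W s \<omega>)\<^sup>2) = t - s"
    using *[of 2] integral_normal_moment_even[of "sqrt (t - s)" 0 1] st by (cases "s = t") (auto simp: fact_numeral)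
  show "expectation (\<lambda>\<omega>. (W t \<omega> - W s \<omega>) ^ 4) = 3 * (t - s)\<^sup>2"
    using *[of 4] integral_normal_moment_even[of "sqrt (t - s)" 0 2] st
    by (cases "s = t") (auto simp: fact_numeral power2_eq_square field_simps)
qed

text \<open>The functions \<open>g i\<close> are kept general so that one orthogonality argument
  covers both Ito sums, with \<open>g i x = x\<close>, and sums of centred squares, with
  \<open>g i x = x\<^sup>2 - h\<close>.\<close>

definition increment_sum ::
    "nat \<Rightarrow> (nat \<Rightarrow> real) \<Rightarrow> (nat \<Rightarrow> real \<Rightarrow> real) \<Rightarrow> (nat \<Rightarrow> 'w \<Rightarrow> 'b::euclidean_space) \<Rightarrow> 'w \<Rightarrow> 'b"
where
  "increment_sum n p g a \<omega> = (\<Sum>i<n. g i (W (p (Suc i)) \<omega> - W (p i) \<omega>) *\<^sub>R a i \<omega>)"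

text \<open>Orthogonality of martingale differences: the square of the sum has only its diagonal
  terms left in mean. The claims are proved jointly because each step uses measurability of the
  partial sum at the current time, for independence from the next increment, and its square
  integrability, for the cross term. The bound \<open>c\<close> secures integrability, while the
  estimate is in terms of \<open>k\<close>, which may be much smaller.\<close>

lemma increment_sum_properties:
  fixes a :: "nat \<Rightarrow> 'w \<Rightarrow> 'b::euclidean_space"
  assumes p: "0 \<le> p 0" "\<And>i. i < n \<Longrightarrow> p i \<le> p (Suc i)"
    and a: "\<And>i. i < n \<Longrightarrow> a i \<in> borel_measurable (F (p i))"
    and bound: "\<And>i \<omega>. i < n \<Longrightarrow> \<omega> \<in> space M \<Longrightarrow> norm (a i \<omega>) \<le> c"
    and k: "\<And>i. i < n \<Longrightarrow> expectation (\<lambda>\<omega>. (norm (a i \<omega>))\<^sup>2) \<le> k"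
    and g: "\<And>i. i < n \<Longrightarrow> g i \<in> borel_measurable borel"
      "\<And>i. i < n \<Longrightarrow> integrable M (\<lambda>\<omega>. g i (W (p (Suc i)) \<omega> - W (p i) \<omega>))"
      "\<And>i. i < n \<Longrightarrow> expectation (\<lambda>\<omega>. g i (W (p (Suc i)) \<omega> - W (p i) \<omega>)) = 0"
      "\<And>i. i < n \<Longrightarrow> integrable M (\<lambda>\<omega>. (g i (W (p (Suc i)) \<omega> - W (p i) \<omega>))\<^sup>2)"
      "\<And>i. i < n \<Longrightarrow> expectation (\<lambda>\<omega>. (g i (W (p (Suc i)) \<omega> - W (p i) \<omega>))\<^sup>2) = v i"
  shows "p 0 \<le> p n \<and> increment_sum n p g a \<in> borel_measurable (F (p n)) \<and>
    integrable M (\<lambda>\<omega>. (norm (increment_sum n p g a \<omega>))\<^sup>2) \<and>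
    expectation (\<lambda>\<omega>. (norm (increment_sum n p g a \<omega>))\<^sup>2) \<le> k * (\<Sum>i<n. v i)"
  using p a bound k g
proof (induction n)
  case 0
  show ?case by (auto simp: increment_sum_def[abs_def])
next
  case (Suc n)
  define S where "S = increment_sum n p g a"
  define D where "D \<omega> = g n (W (p (Suc n)) \<omega> - W (p n) \<omega>)" for \<omega>
  from Suc.IH Suc.prems have p0: "p 0 \<le> p n" and S: "S \<in> borel_measurable (F (p n))"
    and Si: "integrable M (\<lambda>\<omega>. (norm (S \<omega>))\<^sup>2)" and Se: "expectation (\<lambda>\<omega>. (norm (S \<omega>))\<^sup>2) \<le> k * (\<Sum>i<n. v i)"
    by (auto simp: S_def)
  have pn: "0 \<le> p n" "p n \<le> p (Suc n)" using p0 Suc.prems(1) Suc.prems(2)[of n] by simp_all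
  have a: "a n \<in> borel_measurable (F (p n))" using Suc.prems(3)[of n] by simp
  have aM[measurable]: "a n \<in> borel_measurable M" and SM[measurable]: "S \<in> borel_measurable M"
    by (rule measurable_F_M[OF a], rule measurable_F_M[OF S])
  have ac: "norm (a n \<omega>) \<le> c" if "\<omega> \<in> space M" for \<omega>
    using Suc.prems(4)[of n] that by simp
  have ai: "integrable M (\<lambda>\<omega>. (norm (a n \<omega>))\<^sup>2)"
    by (rule integrable_const_bound[where B="c\<^sup>2"]) (use ac in \<open>auto intro!: power_mono\<close>)
  have i1: "integrable M (\<lambda>\<omega>. S \<omega> \<bullet> a n \<omega>)"
  proof (rule Bochner_Integration.integrable_bound[where f="\<lambda>\<omega>. (norm (S \<omega>))\<^sup>2 + (norm (a n \<omega>))\<^sup>2"])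
    have "\<bar>x \<bullet> y\<bar> \<le> (norm x)\<^sup>2 + (norm y)\<^sup>2" for x y :: 'b
      using Cauchy_Schwarz_ineq2[of x y] sum_squares_bound[of "norm x" "norm y"]
        mult_nonneg_nonneg[OF norm_ge_zero[of x] norm_ge_zero[of y]] by linarith
    then show "AE \<omega> in M. norm (S \<omega> \<bullet> a n \<omega>) \<le> norm ((norm (S \<omega>))\<^sup>2 + (norm (a n \<omega>))\<^sup>2)" by auto
  next
    show "integrable M (\<lambda>\<omega>. (norm (S \<omega>))\<^sup>2 + (norm (a n \<omega>))\<^sup>2)"
      using Si ai by (rule Bochner_Integration.integrable_add)
    show "(\<lambda>\<omega>. S \<omega> \<bullet> a n \<omega>) \<in> borel_measurable M" by measurable
  qed
  have sum: "increment_sum (Suc n) p g a \<omega> = S \<omega> + D \<omega> *\<^sub>R a n \<omega>" for \<omega>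
    by (simp add: S_def D_def increment_sum_def)
  have gF: "g n \<in> borel_measurable borel" using Suc.prems(6)[of n] by simp
  have [measurable]: "S \<in> borel_measurable (F (p (Suc n)))" "a n \<in> borel_measurable (F (p (Suc n)))"
    using pn by (rule_tac measurable_F_mono[OF S], simp, rule_tac measurable_F_mono[OF a], simp)
  have "(\<lambda>\<omega>. W (p (Suc n)) \<omega> - W (p n) \<omega>) \<in> borel_measurable (F (p (Suc n)))"
    using pn by (intro W_measurable_F borel_measurable_diff) simp_all
  from measurable_compose[OF this gF] have [measurable]: "D \<in> borel_measurable (F (p (Suc n)))"
    by (simp add: D_def[abs_def])
  have 1: "increment_sum (Suc n) p g a \<in> borel_measurable (F (p (Suc n)))"
    unfolding sum by measurable
  \<comment> \<open>The middle term is a factor from the past times a centred factor independent of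
    it, so it has mean zero; the last one factors into the mean of
    \<open>(norm (a n \<omega>))\<^sup>2\<close> and \<open>v n\<close>.\<close>
  have eq: "(norm (increment_sum (Suc n) p g a \<omega>))\<^sup>2 = (norm (S \<omega>))\<^sup>2 + 2 * ((S \<omega> \<bullet> a n \<omega>) * D \<omega>) + (norm (a n \<omega>))\<^sup>2 * (D \<omega>)\<^sup>2" for \<omega>
    unfolding sum power2_norm_eq_inner
    by (simp add: inner_add_left inner_add_right inner_commute[of "a n \<omega>" "S \<omega>"] power2_eq_square algebra_simps)
  have Di: "integrable M (\<lambda>\<omega>. g n (W (p (Suc n)) \<omega> - W (p n) \<omega>))"
    "integrable M (\<lambda>\<omega>. (g n (W (p (Suc n)) \<omega> - W (p n) \<omega>))\<^sup>2)"
    using Suc.prems(7)[of n] Suc.prems(9)[of n] by simp_all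
  have gm[measurable]: "g n \<in> borel_measurable borel" using Suc.prems(6)[of n] by simp
  have m: "(\<lambda>\<omega>. S \<omega> \<bullet> a n \<omega>) \<in> borel_measurable (F (p n))" "(\<lambda>\<omega>. (norm (a n \<omega>))\<^sup>2) \<in> borel_measurable (F (p n))"
    by (rule borel_measurable_inner[OF S a], use a in measurable)
  note prod1 = increment_indep[where f="g n" and \<xi>="\<lambda>\<omega>. S \<omega> \<bullet> a n \<omega>", OF pn m(1) _ i1 Di(1)]
  note prod2 = increment_indep[where f="\<lambda>x. (g n x)\<^sup>2" and \<xi>="\<lambda>\<omega>. (norm (a n \<omega>))\<^sup>2", OF pn m(2) _ ai Di(2)]
  have y1: "integrable M (\<lambda>\<omega>. (S \<omega> \<bullet> a n \<omega>) * D \<omega>)"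
    unfolding D_def by (rule prod1(1)) simp
  have y1': "expectation (\<lambda>\<omega>. (S \<omega> \<bullet> a n \<omega>) * D \<omega>) = 0"
    unfolding D_def using Suc.prems(8)[of n] by (subst prod1(2)) simp_all
  have y2: "integrable M (\<lambda>\<omega>. (norm (a n \<omega>))\<^sup>2 * (D \<omega>)\<^sup>2)"
    unfolding D_def by (rule prod2(1)) simp
  have y2': "expectation (\<lambda>\<omega>. (norm (a n \<omega>))\<^sup>2 * (D \<omega>)\<^sup>2) = expectation (\<lambda>\<omega>. (norm (a n \<omega>))\<^sup>2) * v n"
    unfolding D_def using Suc.prems(10)[of n] by (subst prod2(2)) simp_all
  have 2: "integrable M (\<lambda>\<omega>. (norm (increment_sum (Suc n) p g a \<omega>))\<^sup>2)"
    unfolding eq by (intro Bochner_Integration.integrable_add integrable_mult_right Si y1 y2)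
  have vn: "0 \<le> v n"
    unfolding Suc.prems(10)[of n, symmetric, simplified] by (simp add: integral_nonneg_AE)
  have "expectation (\<lambda>\<omega>. (norm (increment_sum (Suc n) p g a \<omega>))\<^sup>2)
      = expectation (\<lambda>\<omega>. (norm (S \<omega>))\<^sup>2) + expectation (\<lambda>\<omega>. (norm (a n \<omega>))\<^sup>2) * v n"
    unfolding eq using y1 y2 Si by (simp add: y1' y2')
  also have "\<dots> \<le> k * (\<Sum>i<n. v i) + k * v n"
    using Se Suc.prems(5)[of n] vn by (intro add_mono mult_right_mono) auto
  also have "\<dots> = k * (\<Sum>i<Suc n. v i)" by (simp add: algebra_simps)
  finally show ?case using 1 2 p0 pn by auto
qed

definition left_sum :: "nat \<Rightarrow> (nat \<Rightarrow> real) \<Rightarrow> (nat \<Rightarrow> 'w \<Rightarrow> 'b::euclidean_space) \<Rightarrow> 'w \<Rightarrow> 'b" where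
  "left_sum n p a \<omega> = (\<Sum>i<n. (W (p (Suc i)) \<omega> - W (p i) \<omega>) *\<^sub>R a i \<omega>)"

lemma left_sum_properties:
  fixes a :: "nat \<Rightarrow> 'w \<Rightarrow> 'b::euclidean_space"
  assumes p: "0 \<le> p 0" "\<And>i. i < n \<Longrightarrow> p i \<le> p (Suc i)"
    and a: "\<And>i. i < n \<Longrightarrow> a i \<in> borel_measurable (F (p i))"
    and bound: "\<And>i \<omega>. i < n \<Longrightarrow> \<omega> \<in> space M \<Longrightarrow> norm (a i \<omega>) \<le> c"
    and k: "\<And>i. i < n \<Longrightarrow> expectation (\<lambda>\<omega>. (norm (a i \<omega>))\<^sup>2) \<le> k"
  shows "left_sum n p a \<in> borel_measurable (F (p n))"
    and "integrable M (\<lambda>\<omega>. (norm (left_sum n p a \<omega>))\<^sup>2)"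
    and "expectation (\<lambda>\<omega>. (norm (left_sum n p a \<omega>))\<^sup>2) \<le> k * (p n - p 0)"
proof -
  have p0: "i \<le> n \<Longrightarrow> 0 \<le> p i" for i
    using p by (induction i) (auto intro: order_trans simp: Suc_le_eq)
  have eq: "increment_sum n p (\<lambda>_ x. x) a = left_sum n p a"
    by (simp add: increment_sum_def left_sum_def fun_eq_iff)
  have *: "p 0 \<le> p n \<and> increment_sum n p (\<lambda>_ x. x) a \<in> borel_measurable (F (p n)) \<and>
    integrable M (\<lambda>\<omega>. (norm (increment_sum n p (\<lambda>_ x. x) a \<omega>))\<^sup>2) \<and>
    expectation (\<lambda>\<omega>. (norm (increment_sum n p (\<lambda>_ x. x) a \<omega>))\<^sup>2) \<le> k * (\<Sum>i<n. p (Suc i) - p i)"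
  proof (rule increment_sum_properties[OF p a bound k])
    fix i assume i: "i < n"
    note pi = p0[OF less_imp_le[OF i]] p(2)[OF i]
    show "integrable M (\<lambda>\<omega>. W (p (Suc i)) \<omega> - W (p i) \<omega>)"
      using increment_integrable[OF pi, of 1] by simp
    show "integrable M (\<lambda>\<omega>. (W (p (Suc i)) \<omega> - W (p i) \<omega>)\<^sup>2)"
      by (rule increment_integrable[OF pi])
    show "expectation (\<lambda>\<omega>. W (p (Suc i)) \<omega> - W (p i) \<omega>) = 0"
      "expectation (\<lambda>\<omega>. (W (p (Suc i)) \<omega> - W (p i) \<omega>)\<^sup>2) = p (Suc i) - p i"
      by (rule increment_moments[OF pi])+
  qed simp_all
  have "(\<Sum>i<n. p (Suc i) - p i) = p n - p 0"
    by (induction n) simp_all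
  with * show "left_sum n p a \<in> borel_measurable (F (p n))"
    and "integrable M (\<lambda>\<omega>. (norm (left_sum n p a \<omega>))\<^sup>2)"
    and "expectation (\<lambda>\<omega>. (norm (left_sum n p a \<omega>))\<^sup>2) \<le> k * (p n - p 0)"
    unfolding eq by simp_all
qed

text \<open>As \<xi> is known at the initial time \<open>p 0\<close>, it is known at every
  \<open>p i\<close>; each summand is then a past factor times a centred independent
  increment.\<close>

lemma left_sum_inner_zero:
  fixes a :: "nat \<Rightarrow> 'w \<Rightarrow> 'b::euclidean_space"
  assumes p: "0 \<le> p 0" "\<And>i. i < n \<Longrightarrow> p i \<le> p (Suc i)"
    and a: "\<And>i. i < n \<Longrightarrow> a i \<in> borel_measurable (F (p i))"
    and bound: "\<And>i \<omega>. i < n \<Longrightarrow> \<omega> \<in> space M \<Longrightarrow> norm (a i \<omega>) \<le> c"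
    and \<xi>: "\<xi> \<in> borel_measurable (F (p 0))" "\<And>\<omega>. \<omega> \<in> space M \<Longrightarrow> norm (\<xi> \<omega>) \<le> d"
  shows "expectation (\<lambda>\<omega>. left_sum n p a \<omega> \<bullet> \<xi> \<omega>) = 0"
proof -
  have p0: "i \<le> n \<Longrightarrow> p 0 \<le> p i" for i
    using p(2) by (induction i) (auto intro: order_trans simp: Suc_le_eq)
  have *: "integrable M (\<lambda>\<omega>. (a i \<omega> \<bullet> \<xi> \<omega>) * (W (p (Suc i)) \<omega> - W (p i) \<omega>)) \<and>
      expectation (\<lambda>\<omega>. (a i \<omega> \<bullet> \<xi> \<omega>) * (W (p (Suc i)) \<omega> - W (p i) \<omega>)) = 0" if i: "i < n" for i
  proof -
    have pi: "0 \<le> p i" "p i \<le> p (Suc i)" using p p0[of i] i by auto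
    have "\<xi> \<in> borel_measurable (F (p i))" using measurable_F_mono[OF \<xi>(1)] p0[of i] i by auto
    then have m: "(\<lambda>\<omega>. a i \<omega> \<bullet> \<xi> \<omega>) \<in> borel_measurable (F (p i))" using a[OF i] by measurable
    have "integrable M (\<lambda>\<omega>. a i \<omega> \<bullet> \<xi> \<omega>)"
    proof (rule integrable_const_bound[where B="c * d"])
      have "norm (a i \<omega> \<bullet> \<xi> \<omega>) \<le> c * d" if "\<omega> \<in> space M" for \<omega>
        using Cauchy_Schwarz_ineq2[of "a i \<omega>" "\<xi> \<omega>"] mult_mono[OF bound[OF i that] \<xi>(2)[OF that]]
          order_trans[OF norm_ge_zero bound[OF i that]] by simp
      then show "AE \<omega> in M. norm (a i \<omega> \<bullet> \<xi> \<omega>) \<le> c * d" by auto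
    qed (rule measurable_F_M[OF m])
    moreover have "integrable M (\<lambda>\<omega>. W (p (Suc i)) \<omega> - W (p i) \<omega>)"
      using increment_integrable[OF pi, of 1] by simp
    ultimately show ?thesis
      using increment_indep[OF pi m, of "\<lambda>x. x"] increment_moments(1)[OF pi] by simp
  qed
  have "left_sum n p a \<omega> \<bullet> \<xi> \<omega> = (\<Sum>i<n. (a i \<omega> \<bullet> \<xi> \<omega>) * (W (p (Suc i)) \<omega> - W (p i) \<omega>))" for \<omega>
    by (simp add: left_sum_def inner_sum_left mult.commute)
  then show ?thesis using * by simp
qed

end

section \<open>Rodrigues' formula and its Taylor expansions\<close>

section \<open>Rotations generated by a skew operator\<close>

text \<open>Models left multiplication by B on vectors and on matrices at once. The axiom
  \<open>cube\<close> is what Cayley-Hamilton gives for an antisymmetric 3x3 matrix, with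
  \<open>r\<close> in the role of \<open>rho B\<close>.\<close>

locale skew_operator =
  fixes b :: "'b::euclidean_space \<Rightarrow> 'b" and r :: real
  assumes lin: "linear b" and skew: "b x \<bullet> y = - (x \<bullet> b y)"
    and cube: "b (b (b x)) = - (r\<^sup>2 *\<^sub>R b x)" and r_pos: "0 < r"
begin

text \<open>Rodrigues' formula: for \<open>p = cis (r * \<theta>)\<close> this is the exponential of
  \<theta> b.\<close>

definition rot :: "complex \<Rightarrow> 'b \<Rightarrow> 'b" where
  "rot p x = x + (Im p / r) *\<^sub>R b x + ((1 - Re p) / r\<^sup>2) *\<^sub>R b (b x)"

definition \<beta> :: real where "\<beta> = onorm b"

lemma b_bound: "norm (b x) \<le> \<beta> * norm x"
  unfolding \<beta>_def by (rule onorm) (simp add: lin linear_conv_bounded_linear[symmetric])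

lemma \<beta>_nonneg: "0 \<le> \<beta>"
  unfolding \<beta>_def by (rule onorm_pos_le) (simp add: lin linear_conv_bounded_linear[symmetric])

lemma b_measurable [measurable]: "b \<in> borel_measurable borel"
  by (intro borel_measurable_continuous_onI linear_continuous_on)
    (simp add: lin linear_conv_bounded_linear[symmetric])

lemmas b_simps = linear_add[OF lin] linear_diff[OF lin] linear_scale[OF lin] linear_0[OF lin]

lemma rot_linear: "linear (rot p)"
  by (rule linearI) (simp_all add: rot_def b_simps algebra_simps)

lemma rot_one [simp]: "rot 1 x = x"
  by (simp add: rot_def)

text \<open>The identity \<open>cube\<close> reduces every product to the span of the identity, b
  and b^2. Comparing coefficients leaves the formulas for real and imaginary part of a product of
  complex numbers, so the modulus of \<open>p\<close> and \<open>q\<close> does not enter.\<close>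

lemma rot_rot: "rot p (rot q x) = rot (p * q) x"
proof -
  define u v where "u p = Im p / r" and "v p = (1 - Re p) / r\<^sup>2" for p
  have "rot p (rot q x) = x + (u q + u p - r\<^sup>2 * (v p * u q + u p * v q)) *\<^sub>R b x
      + (v q + v p + u p * u q - r\<^sup>2 * (v p * v q)) *\<^sub>R b (b x)"
    unfolding rot_def u_def[symmetric] v_def[symmetric]
    by (simp add: b_simps cube algebra_simps)
  also have "u q + u p - r\<^sup>2 * (v p * u q + u p * v q) = u (p * q)"
    using r_pos by (simp add: u_def v_def field_simps power2_eq_square)
  also have "v q + v p + u p * u q - r\<^sup>2 * (v p * v q) = v (p * q)"
    using r_pos by (simp add: u_def v_def field_simps power2_eq_square)
  finally show ?thesis by (simp add: rot_def u_def v_def)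
qed

lemma inner_rot: "rot p x \<bullet> y = x \<bullet> rot (cnj p) y"
  by (simp add: rot_def inner_add_left inner_add_right inner_diff_right skew[of x y] skew[of "b x" y] skew[of x "b y"])

lemma norm_rot: "cmod p = 1 \<Longrightarrow> norm (rot p x) = norm x"
proof -
  assume "cmod p = 1"
  then have "p * cnj p = 1" by (simp add: complex_norm_square[symmetric])
  then have "rot p x \<bullet> rot p x = x \<bullet> x"
    by (simp add: inner_rot rot_rot mult.commute)
  then show ?thesis by (simp add: norm_eq_sqrt_inner)
qed

text \<open>The estimates |sin y - y| \<le> y^2 and 1 - cos y \<le> y^2 at y = r \<theta>, divided
  by r and r^2, produce the coefficients r \<beta> and \<beta>^2.\<close>

lemma rot_taylor1: "norm (rot (cis (r * \<theta>)) x - x - \<theta> *\<^sub>R b x) \<le> (r * \<beta> + \<beta>\<^sup>2) * \<theta>\<^sup>2 * norm x"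
proof -
  have s: "\<bar>sin (r * \<theta>) / r - \<theta>\<bar> \<le> r * \<theta>\<^sup>2"
  proof -
    have "\<bar>sin y - y\<bar> \<le> y\<^sup>2" for y :: real
    proof -
      have "\<bar>sin y - y\<bar> * 2 \<le> y * y"
        using Maclaurin_sin_bound[of y 2] by (simp add: eval_nat_numeral sin_coeff_def)
      moreover have "u * 2 \<le> v \<Longrightarrow> 0 \<le> v \<Longrightarrow> u \<le> v" for u v :: real by linarith
      ultimately show ?thesis unfolding power2_eq_square using zero_le_square by blast
    qed
    then have "\<bar>sin (r * \<theta>) - r * \<theta>\<bar> / r \<le> (r * \<theta>)\<^sup>2 / r" using r_pos by (intro divide_right_mono) auto
    moreover have "\<bar>sin (r * \<theta>) / r - \<theta>\<bar> = \<bar>sin (r * \<theta>) - r * \<theta>\<bar> / r"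
      using r_pos by (simp add: diff_divide_distrib abs_div_pos)
    moreover have "(r * \<theta>)\<^sup>2 / r = r * \<theta>\<^sup>2" using r_pos by (simp add: power2_eq_square)
    ultimately show ?thesis by simp
  qed
  have c: "\<bar>(1 - cos (r * \<theta>)) / r\<^sup>2\<bar> \<le> \<theta>\<^sup>2"
  proof -
    have "1 - cos (r * \<theta>) = 2 * (sin (r * \<theta> / 2))\<^sup>2"
      using cos_double_sin[of "r * \<theta> / 2"] by simp
    also have "\<dots> \<le> 2 * (r * \<theta> / 2)\<^sup>2"
      using abs_sin_x_le_abs_x[of "r * \<theta> / 2"] by (intro mult_left_mono iffD1[OF abs_le_square_iff]) simp_all
    also have "\<dots> = (r\<^sup>2 * \<theta>\<^sup>2) / 2" by (simp add: power_mult_distrib power_divide)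
    also have "\<dots> \<le> r\<^sup>2 * \<theta>\<^sup>2" using zero_le_power2[of "r * \<theta>"] unfolding power_mult_distrib by linarith
    finally have "1 - cos (r * \<theta>) \<le> \<theta>\<^sup>2 * r\<^sup>2" by (simp add: mult.commute)
    then show ?thesis using r_pos by (simp add: pos_divide_le_eq)
  qed
  have "rot (cis (r * \<theta>)) x - x - \<theta> *\<^sub>R b x = (sin (r * \<theta>) / r - \<theta>) *\<^sub>R b x + ((1 - cos (r * \<theta>)) / r\<^sup>2) *\<^sub>R b (b x)"
    by (simp add: rot_def algebra_simps)
  also have "norm \<dots> \<le> \<bar>sin (r * \<theta>) / r - \<theta>\<bar> * norm (b x) + \<bar>(1 - cos (r * \<theta>)) / r\<^sup>2\<bar> * norm (b (b x))"
    by (rule order_trans[OF norm_triangle_ineq]) simp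
  also have "\<dots> \<le> (r * \<theta>\<^sup>2) * (\<beta> * norm x) + \<theta>\<^sup>2 * (\<beta> * (\<beta> * norm x))"
    using r_pos \<beta>_nonneg b_bound[of x] order_trans[OF b_bound[of "b x"] mult_left_mono[OF b_bound[of x] \<beta>_nonneg]]
    by (intro add_mono mult_mono s c) auto
  also have "\<dots> = (r * \<beta> + \<beta>\<^sup>2) * \<theta>\<^sup>2 * norm x" by (simp add: algebra_simps power2_eq_square)
  finally show ?thesis .
qed

text \<open>The coefficient of b is accurate to third order and that of b^2 to fourth order in
  \<theta>. The second-order term must be kept because a squared Wiener increment is of the order of
  the time step.\<close>

lemma rot_taylor2:
  "norm (rot (cis (r * \<theta>)) x - x - \<theta> *\<^sub>R b x - (\<theta>\<^sup>2 / 2) *\<^sub>R b (b x)) \<le> (r\<^sup>2 * \<beta> * \<bar>\<theta>\<bar> ^ 3 + r\<^sup>2 * \<beta>\<^sup>2 * \<theta> ^ 4) * norm x"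
proof -
  have s0: "\<bar>sin y - y\<bar> \<le> \<bar>y\<bar> ^ 3" for y :: real
  proof -
    have "(\<Sum>m<3. sin_coeff m * y ^ m) = y"
      by (simp add: sin_coeff_def numeral_3_eq_3)
    moreover have "fact 3 = (6::real)" by (simp add: fact_numeral)
    moreover have "inverse 6 * \<bar>y\<bar> ^ 3 = \<bar>y\<bar> ^ 3 / 6" by (simp only: divide_inverse mult.commute)
    ultimately have "\<bar>sin y - y\<bar> \<le> \<bar>y\<bar> ^ 3 / 6"
      using Maclaurin_sin_bound[of y 3] by simp
    also have "\<dots> \<le> \<bar>y\<bar> ^ 3" using zero_le_power[OF abs_ge_zero[of y], of 3] by linarith
    finally show ?thesis .
  qed
  have s: "\<bar>sin (r * \<theta>) / r - \<theta>\<bar> \<le> r\<^sup>2 * \<bar>\<theta>\<bar> ^ 3"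
  proof -
    have "\<bar>sin (r * \<theta>) - r * \<theta>\<bar> / r \<le> \<bar>r * \<theta>\<bar> ^ 3 / r" using s0[of "r * \<theta>"] r_pos by (intro divide_right_mono) auto
    moreover have "\<bar>sin (r * \<theta>) / r - \<theta>\<bar> = \<bar>sin (r * \<theta>) - r * \<theta>\<bar> / r"
      using r_pos by (simp add: diff_divide_distrib abs_div_pos)
    moreover have "\<bar>r * \<theta>\<bar> ^ 3 / r = r\<^sup>2 * \<bar>\<theta>\<bar> ^ 3"
      using r_pos by (simp add: abs_mult power_mult_distrib power2_eq_square power3_eq_cube)
    ultimately show ?thesis by simp
  qed
  \<comment> \<open>The half angle turns 1 - cos into 2 sin^2, and sin^2 y - y^2 factors, so the
    cubic sine bound can be used again.\<close>
  have c: "\<bar>(1 - cos (r * \<theta>)) / r\<^sup>2 - \<theta>\<^sup>2 / 2\<bar> \<le> r\<^sup>2 * \<theta> ^ 4"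
  proof -
    define y where "y = r * \<theta> / 2"
    have y: "r * \<theta> = 2 * y" by (simp add: y_def)
    have "(1 - cos (r * \<theta>)) - (r * \<theta>)\<^sup>2 / 2 = 2 * ((sin y)\<^sup>2 - y\<^sup>2)"
      using cos_double_sin[of y] by (simp add: y power2_eq_square)
    also have "(sin y)\<^sup>2 - y\<^sup>2 = (sin y - y) * (sin y + y)"
      by (simp add: power2_eq_square algebra_simps)
    also have "\<bar>2 * \<dots>\<bar> \<le> 2 * (\<bar>y\<bar> ^ 3 * (2 * \<bar>y\<bar>))"
    proof -
      have "\<bar>sin y + y\<bar> \<le> 2 * \<bar>y\<bar>"
        using abs_sin_x_le_abs_x[of y] abs_triangle_ineq[of "sin y" y] by linarith
      with s0[of y] have "\<bar>sin y - y\<bar> * \<bar>sin y + y\<bar> \<le> \<bar>y\<bar> ^ 3 * (2 * \<bar>y\<bar>)"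
        by (intro mult_mono) simp_all
      then show ?thesis unfolding abs_mult abs_numeral by (intro mult_left_mono) simp_all
    qed
    also have "\<bar>y\<bar> ^ 3 * (2 * \<bar>y\<bar>) = 2 * y ^ 4"
      using power_add[of "\<bar>y\<bar>" 3 1] by simp
    also have "2 * (2 * y ^ 4) \<le> r\<^sup>2 * \<theta> ^ 4 * r\<^sup>2"
    proof -
      have "y ^ 4 = (r\<^sup>2 * \<theta> ^ 4 * r\<^sup>2) / 16"
        by (simp add: y_def power_divide power_mult_distrib flip: power_add)
      moreover have "0 \<le> r\<^sup>2 * \<theta> ^ 4 * r\<^sup>2" by simp
      ultimately show ?thesis by linarith
    qed
    finally have "\<bar>(1 - cos (r * \<theta>)) - (r * \<theta>)\<^sup>2 / 2\<bar> \<le> r\<^sup>2 * \<theta> ^ 4 * r\<^sup>2" .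
    then have "\<bar>(1 - cos (r * \<theta>)) - (r * \<theta>)\<^sup>2 / 2\<bar> / r\<^sup>2 \<le> r\<^sup>2 * \<theta> ^ 4"
      using r_pos by (simp add: pos_divide_le_eq)
    moreover have "(1 - cos (r * \<theta>)) / r\<^sup>2 - \<theta>\<^sup>2 / 2 = ((1 - cos (r * \<theta>)) - (r * \<theta>)\<^sup>2 / 2) / r\<^sup>2"
      using r_pos by (simp add: diff_divide_distrib power_mult_distrib)
    ultimately show ?thesis by (simp add: abs_div_pos)
  qed
  have "rot (cis (r * \<theta>)) x - x - \<theta> *\<^sub>R b x - (\<theta>\<^sup>2 / 2) *\<^sub>R b (b x)
      = (sin (r * \<theta>) / r - \<theta>) *\<^sub>R b x + ((1 - cos (r * \<theta>)) / r\<^sup>2 - \<theta>\<^sup>2 / 2) *\<^sub>R b (b x)"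
    by (simp add: rot_def algebra_simps)
  also have "norm \<dots> \<le> \<bar>sin (r * \<theta>) / r - \<theta>\<bar> * norm (b x) + \<bar>(1 - cos (r * \<theta>)) / r\<^sup>2 - \<theta>\<^sup>2 / 2\<bar> * norm (b (b x))"
    by (rule order_trans[OF norm_triangle_ineq]) simp
  also have "\<dots> \<le> (r\<^sup>2 * \<bar>\<theta>\<bar> ^ 3) * (\<beta> * norm x) + (r\<^sup>2 * \<theta> ^ 4) * (\<beta> * (\<beta> * norm x))"
    using r_pos \<beta>_nonneg b_bound[of x] order_trans[OF b_bound[of "b x"] mult_left_mono[OF b_bound[of x] \<beta>_nonneg]]
    by (intro add_mono mult_mono s c) auto
  also have "\<dots> = (r\<^sup>2 * \<beta> * \<bar>\<theta>\<bar> ^ 3 + r\<^sup>2 * \<beta>\<^sup>2 * \<theta> ^ 4) * norm x" by (simp add: algebra_simps power2_eq_square)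
  finally show ?thesis .
qed

end

section \<open>Left-point Riemann sums on equidistant grids\<close>

lemma riemann_sum_limit:
  fixes f :: "real \<Rightarrow> 'b::euclidean_space" and s t :: real
  assumes st: "s \<le> t" and f: "continuous_on {s..t} f"
  shows "(\<lambda>n. \<Sum>i<Suc n. ((t - s) / Suc n) *\<^sub>R f (s + (t - s) * i / Suc n)) \<longlonglongrightarrow> integral {s..t} f"
proof (rule tendstoI)
  fix e :: real assume e: "e > 0"
  have uc: "uniformly_continuous_on {s..t} f"
    by (rule compact_uniformly_continuous[OF f]) simp
  \<comment> \<open>The added 1 keeps the quotient meaningful for \<open>s = t\<close>; the factor 2
    leaves e/2 at the end, so that the final inequality is strict.\<close>
  define \<epsilon> where "\<epsilon> = e / (2 * (t - s + 1))"
  have \<epsilon>: "\<epsilon> > 0" using e st by (simp add: \<epsilon>_def)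
  obtain d where d: "d > 0" "\<And>x y. x \<in> {s..t} \<Longrightarrow> y \<in> {s..t} \<Longrightarrow> dist y x < d \<Longrightarrow> dist (f y) (f x) < \<epsilon>"
    using uc \<epsilon> unfolding uniformly_continuous_on_def by metis
  have "(\<lambda>n. (t - s) / real (Suc n)) \<longlonglongrightarrow> 0"
    using tendsto_mult[OF tendsto_const[of "t - s"] LIMSEQ_inverse_real_of_nat] by (simp add: divide_inverse)
  then have "\<forall>\<^sub>F n in sequentially. (t - s) / real (Suc n) < d"
    using d(1) by (rule order_tendstoD(2))
  then show "\<forall>\<^sub>F n in sequentially. dist (\<Sum>i<Suc n. ((t - s) / Suc n) *\<^sub>R f (s + (t - s) * i / Suc n)) (integral {s..t} f) < e"
  proof eventually_elim
    case (elim n)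
    define h where "h = (t - s) / real (Suc n)"
    define p where "p i = s + (t - s) * real i / real (Suc n)" for i
    have h: "0 \<le> h" "h < d" using st elim by (auto simp: h_def)
    have ps: "p (Suc i) = p i + h" for i by (simp add: p_def h_def distrib_left add_divide_distrib)
    have pmono: "p i \<le> p j" if "i \<le> j" for i j
      unfolding p_def using st that by (intro add_mono divide_right_mono mult_left_mono) auto
    have p0: "p 0 = s" and pN: "p (Suc n) = t" by (simp_all add: p_def)
    have sub: "{p i..p j} \<subseteq> {s..t}" if "j \<le> Suc n" for i j
      using pmono[of 0 i] pmono[of j "Suc n"] that p0 pN by auto
    have int: "f integrable_on {p i..p j}" if "j \<le> Suc n" for i j
      using continuous_on_subset[OF f sub[OF that]] by (rule integrable_continuous_real)
    have split: "integral {p 0..p m} f = (\<Sum>i<m. integral {p i..p (Suc i)} f)" if "m \<le> Suc n" for m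
      using that
    proof (induction m)
      case (Suc m)
      have "integral {p 0..p m} f + integral {p m..p (Suc m)} f = integral {p 0..p (Suc m)} f"
        using Suc.prems by (intro Henstock_Kurzweil_Integration.integral_combine pmono int) auto
      then show ?case using Suc by simp
    qed simp
    have loc: "norm (h *\<^sub>R f (p i) - integral {p i..p (Suc i)} f) \<le> \<epsilon> * h" if i: "i < Suc n" for i
    proof -
      have "(f has_integral integral {p i..p (Suc i)} f) {p i..p (Suc i)}"
        using int[of "Suc i" i] i by (simp add: integrable_integral)
      moreover have "((\<lambda>_. f (p i)) has_integral (h *\<^sub>R f (p i))) {p i..p (Suc i)}"
        using has_integral_const_real[of "f (p i)" "p i" "p (Suc i)"] h by (simp add: ps)
      ultimately have "((\<lambda>x. f (p i) - f x) has_integral (h *\<^sub>R f (p i) - integral {p i..p (Suc i)} f)) {p i..p (Suc i)}"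
        by (intro has_integral_diff)
      then have "norm (h *\<^sub>R f (p i) - integral {p i..p (Suc i)} f) \<le> \<epsilon> * measure lborel (cbox (p i) (p (Suc i)))"
      proof (intro has_integral_bound[of \<epsilon>])
        fix x assume x: "x \<in> cbox (p i) (p (Suc i))"
        then have "x \<in> {s..t}" "p i \<in> {s..t}" using sub[of "Suc i" i] i h ps[of i] by auto
        moreover have "dist (p i) x < d" using x h ps[of i] by (auto simp: dist_real_def)
        ultimately show "norm (f (p i) - f x) \<le> \<epsilon>" using d(2)[of x "p i"] by (simp add: dist_norm)
      qed (use \<epsilon> in auto)
      then show ?thesis using h by (simp add: ps)
    qed
    have "(\<Sum>i<Suc n. h *\<^sub>R f (p i)) - integral {s..t} f = (\<Sum>i<Suc n. h *\<^sub>R f (p i) - integral {p i..p (Suc i)} f)"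
      using split[of "Suc n"] p0 pN by (simp add: sum_subtractf)
    also have "norm \<dots> \<le> (\<Sum>i<Suc n. \<epsilon> * h)"
      by (rule sum_norm_le) (rule loc, simp)
    also have "\<dots> = \<epsilon> * (t - s)" by (simp add: h_def)
    also have "\<dots> < e"
    proof -
      have "\<epsilon> * (t - s) \<le> \<epsilon> * (t - s + 1)" using \<epsilon> by simp
      also have "\<dots> = e / 2" using st by (simp add: \<epsilon>_def divide_simps del: distrib_left_numeral)
      finally show ?thesis using e by simp
    qed
    finally show ?case by (simp only: h_def p_def dist_norm)
  qed
qed

section \<open>L1 criteria, equidistant partitions and mean-square estimates for the
  solution\<close>

section \<open>Partitions and the linear equation\<close>

context prob_space
begin

text \<open>Nonnegativity of the variance of the norm, expanded.\<close>

lemma expectation_norm_le: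
  fixes X :: "'a \<Rightarrow> 'b::euclidean_space"
  assumes [measurable]: "X \<in> borel_measurable M" and int: "integrable M (\<lambda>\<omega>. (norm (X \<omega>))\<^sup>2)"
    and le: "expectation (\<lambda>\<omega>. (norm (X \<omega>))\<^sup>2) \<le> k\<^sup>2" and k: "0 \<le> k"
  shows "expectation (\<lambda>\<omega>. norm (X \<omega>)) \<le> k"
proof -
  define m where "m = expectation (\<lambda>\<omega>. norm (X \<omega>))"
  have i: "integrable M (\<lambda>\<omega>. norm (X \<omega>))"
    using integrable_norm[OF integrable_of_square[OF assms(1) int]] .
  have m: "0 \<le> m" unfolding m_def by (simp add: integral_nonneg_AE)
  have "0 \<le> expectation (\<lambda>\<omega>. (norm (X \<omega>) - m)\<^sup>2)" by (simp add: integral_nonneg_AE)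
  also have "(\<lambda>\<omega>. (norm (X \<omega>) - m)\<^sup>2) = (\<lambda>\<omega>. (norm (X \<omega>))\<^sup>2 + m\<^sup>2 - 2 * m * norm (X \<omega>))"
    by (simp add: power2_diff mult.commute mult.left_commute)
  also have "expectation \<dots> = expectation (\<lambda>\<omega>. (norm (X \<omega>))\<^sup>2) + m\<^sup>2 - 2 * m * m"
    using int i by (simp add: prob_space m_def)
  finally have "m\<^sup>2 \<le> k\<^sup>2" using le by (simp add: power2_eq_square)
  then show ?thesis using k m unfolding m_def[symmetric] by (simp add: power2_le_iff_abs_le)
qed

lemma tendsto_prob_diff:
  fixes X Y :: "nat \<Rightarrow> 'a \<Rightarrow> 'b::euclidean_space"
  assumes [measurable]: "\<And>n. X n \<in> borel_measurable M" "\<And>n. Y n \<in> borel_measurable M"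
      "L \<in> borel_measurable M" "K \<in> borel_measurable M"
    and X: "tendsto_prob M X L" and Y: "tendsto_prob M Y K"
  shows "tendsto_prob M (\<lambda>n \<omega>. X n \<omega> - Y n \<omega>) (\<lambda>\<omega>. L \<omega> - K \<omega>)"
  unfolding tendsto_prob_def
proof (intro allI impI)
  fix \<epsilon> :: real assume \<epsilon>: "\<epsilon> > 0"
  have "\<forall>\<^sub>F n in sequentially. prob {\<omega> \<in> space M. \<epsilon>/2 < dist (X n \<omega>) (L \<omega>)} < \<epsilon>/2"
    "\<forall>\<^sub>F n in sequentially. prob {\<omega> \<in> space M. \<epsilon>/2 < dist (Y n \<omega>) (K \<omega>)} < \<epsilon>/2"
    using X[unfolded tendsto_prob_def, rule_format, of "\<epsilon>/2"] Y[unfolded tendsto_prob_def, rule_format, of "\<epsilon>/2"] \<epsilon>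
    by simp_all
  then show "\<forall>\<^sub>F n in sequentially. prob {\<omega> \<in> space M. \<epsilon> < dist (X n \<omega> - Y n \<omega>) (L \<omega> - K \<omega>)} < \<epsilon>"
  proof eventually_elim
    case (elim n)
    have d: "dist (x - y) (l - k) \<le> dist x l + dist y k" for x y l k :: 'b
      using norm_triangle_ineq4[of "x - l" "y - k"] by (simp add: dist_norm algebra_simps)
    have "{\<omega> \<in> space M. \<epsilon> < dist (X n \<omega> - Y n \<omega>) (L \<omega> - K \<omega>)}
      \<subseteq> {\<omega> \<in> space M. \<epsilon>/2 < dist (X n \<omega>) (L \<omega>)} \<union> {\<omega> \<in> space M. \<epsilon>/2 < dist (Y n \<omega>) (K \<omega>)}"
    proof safe
      fix \<omega> assume "\<epsilon> < dist (X n \<omega> - Y n \<omega>) (L \<omega> - K \<omega>)" "\<not> \<epsilon>/2 < dist (Y n \<omega>) (K \<omega>)"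
      with d[of "X n \<omega>" "Y n \<omega>" "L \<omega>" "K \<omega>"] show "\<epsilon>/2 < dist (X n \<omega>) (L \<omega>)" by linarith
    qed
    then have "prob {\<omega> \<in> space M. \<epsilon> < dist (X n \<omega> - Y n \<omega>) (L \<omega> - K \<omega>)}
      \<le> prob ({\<omega> \<in> space M. \<epsilon>/2 < dist (X n \<omega>) (L \<omega>)} \<union> {\<omega> \<in> space M. \<epsilon>/2 < dist (Y n \<omega>) (K \<omega>)})"
      by (rule finite_measure_mono) measurable
    also have "\<dots> \<le> prob {\<omega> \<in> space M. \<epsilon>/2 < dist (X n \<omega>) (L \<omega>)} + prob {\<omega> \<in> space M. \<epsilon>/2 < dist (Y n \<omega>) (K \<omega>)}"
      by (rule measure_subadditive) auto
    finally show ?case using elim by linarith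
  qed
qed

lemma tendsto_prob_of_L1:
  fixes X :: "nat \<Rightarrow> 'a \<Rightarrow> 'b::euclidean_space"
  assumes int: "\<And>n. integrable M (X n)"
    and lim: "(\<lambda>n. expectation (\<lambda>\<omega>. norm (X n \<omega>))) \<longlonglongrightarrow> 0"
  shows "tendsto_prob M X (\<lambda>_. 0)"
  unfolding tendsto_prob_def
proof (intro allI impI)
  fix \<epsilon> :: real assume \<epsilon>: "\<epsilon> > 0"
  have [measurable]: "X n \<in> borel_measurable M" for n using int[of n] by auto
  have "\<forall>\<^sub>F n in sequentially. expectation (\<lambda>\<omega>. norm (X n \<omega>)) < \<epsilon> * \<epsilon>"
    using lim \<epsilon> by (intro order_tendstoD) auto
  then show "\<forall>\<^sub>F n in sequentially. prob {\<omega> \<in> space M. \<epsilon> < dist (X n \<omega>) 0} < \<epsilon>"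
  proof eventually_elim
    case (elim n)
    have "prob {\<omega> \<in> space M. \<epsilon> < dist (X n \<omega>) 0} \<le> prob {\<omega> \<in> space M. norm (X n \<omega>) \<ge> \<epsilon>}"
      by (rule finite_measure_mono) auto
    also have "\<dots> \<le> expectation (\<lambda>\<omega>. norm (X n \<omega>)) / \<epsilon>"
      using integral_Markov_inequality_measure[of M "\<lambda>\<omega>. norm (X n \<omega>)" "{}" \<epsilon>] int[of n] \<epsilon> by simp
    also have "\<dots> < \<epsilon>" using elim \<epsilon> by (simp add: pos_divide_less_eq)
    finally show ?case .
  qed
qed

end

text \<open>The index \<open>n\<close> stands for \<open>Suc n\<close> equal intervals, so the mesh
  is a quotient with nonzero denominator for every \<open>n\<close>.\<close>

definition grid :: "real \<Rightarrow> real \<Rightarrow> nat \<Rightarrow> nat \<Rightarrow> real" where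
  "grid s t n i = s + (t - s) * real i / real (Suc n)"

lemma grid_0 [simp]: "grid s t n 0 = s" and grid_end [simp]: "grid s t n (Suc n) = t"
  by (simp_all add: grid_def)

lemma grid_step: "grid s t n (Suc i) - grid s t n i = (t - s) / real (Suc n)"
  by (simp add: grid_def distrib_left add_divide_distrib)

lemma grid_mono: "s \<le> t \<Longrightarrow> i \<le> j \<Longrightarrow> grid s t n i \<le> grid s t n j"
  unfolding grid_def by (intro add_mono divide_right_mono mult_left_mono) auto

lemma grid_bounds: "s \<le> t \<Longrightarrow> i \<le> Suc n \<Longrightarrow> s \<le> grid s t n i \<and> grid s t n i \<le> t"
  using grid_mono[of s t 0 i n] grid_mono[of s t i "Suc n" n] by simp

lemma grid_mesh:
  assumes "d > 0"
  shows "\<forall>\<^sub>F n in sequentially. (t - s) / real (Suc n) < d"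
proof -
  have "(\<lambda>n. (t - s) / real (Suc n)) \<longlonglongrightarrow> 0"
    using tendsto_mult[OF tendsto_const[of "t - s"] LIMSEQ_inverse_real_of_nat] by (simp add: divide_inverse)
  then show ?thesis using assms by (rule order_tendstoD(2))
qed

lemma time_partition_grid: "0 \<le> t \<Longrightarrow> time_partition t (Suc n) (grid 0 t n)"
  by (auto simp: time_partition_def intro!: grid_mono)

lemma mesh_limit_tendsto_prob:
  assumes "mesh_limit M t S I" and "\<And>n. time_partition t (N n) (p n)"
    and "\<And>d. 0 < d \<Longrightarrow> \<forall>\<^sub>F n in sequentially. \<forall>i<N n. p n (Suc i) - p n i < d"
  shows "tendsto_prob M (\<lambda>n. S (N n) (p n)) I"
  unfolding tendsto_prob_def
proof (intro allI impI)
  fix \<epsilon> :: real assume "\<epsilon> > 0"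
  then obtain d where d: "d > 0" "\<And>n p. time_partition t n p \<Longrightarrow> (\<forall>i<n. p (Suc i) - p i < d) \<Longrightarrow>
        measure M {\<omega> \<in> space M. \<epsilon> < dist (S n p \<omega>) (I \<omega>)} < \<epsilon>"
    using assms(1) unfolding mesh_limit_def by metis
  show "\<forall>\<^sub>F n in sequentially. measure M {\<omega> \<in> space M. \<epsilon> < dist (S (N n) (p n) \<omega>) (I \<omega>)} < \<epsilon>"
    using assms(3)[OF d(1)] by eventually_elim (rule d(2)[OF assms(2)])
qed

lemma mesh_limit_grid:
  assumes "mesh_limit M t S I" and t: "0 \<le> t"
  shows "tendsto_prob M (\<lambda>n. S (Suc n) (grid 0 t n)) I"
proof (rule mesh_limit_tendsto_prob[OF assms(1)])
  show "\<forall>\<^sub>F n in sequentially. \<forall>i<Suc n. grid 0 t n (Suc i) - grid 0 t n i < d" if "0 < d" for d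
    unfolding grid_step using grid_mesh[OF that, of t 0] by eventually_elim simp
qed (rule time_partition_grid[OF t])

text \<open>The equation with A = \<alpha> B already substituted and the Stratonovich integral split
  into the Ito part J and the bracket C. The constant norm \<open>c\<close> of the solution supplies
  the integrable bounds in the estimates that follow.\<close>

locale linear_sde = wiener M F W + skew_operator b r
  for M :: "'w measure" and F :: "real \<Rightarrow> 'w measure" and W :: "real \<Rightarrow> 'w \<Rightarrow> real"
    and b :: "'b::euclidean_space \<Rightarrow> 'b" and r :: real +
  fixes \<alpha> c :: real and z :: 'b and Z J C :: "real \<Rightarrow> 'w \<Rightarrow> 'b"
  assumes Z_F: "0 \<le> t \<Longrightarrow> Z t \<in> borel_measurable (F t)"
    and Z_norm: "0 \<le> t \<Longrightarrow> \<omega> \<in> space M \<Longrightarrow> norm (Z t \<omega>) = c" and z_norm: "norm z = c"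
    and Z_continuous: "AE \<omega> in M. continuous_on {0..} (\<lambda>t. Z t \<omega>)"
    and ito: "0 \<le> t \<Longrightarrow> has_ito_integral M W (\<lambda>t \<omega>. b (Z t \<omega>)) t (J t)"
    and bracket: "has_bracket M W (\<lambda>t \<omega>. b (Z t \<omega>)) C"
    and eqn: "0 \<le> t \<Longrightarrow>
      AE \<omega> in M. Z t \<omega> = z + integral {0..t} (\<lambda>s. \<alpha> *\<^sub>R b (Z s \<omega>)) + (J t \<omega> + (1/2) *\<^sub>R C t \<omega>)"
begin

lemma c_nonneg: "0 \<le> c" using z_norm norm_ge_zero[of z] by simp

lemma Z_measurable_F: "0 \<le> s \<Longrightarrow> s \<le> t \<Longrightarrow> Z s \<in> borel_measurable (F t)"
  by (rule measurable_F_mono[OF Z_F])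

lemma Z_measurable: "0 \<le> t \<Longrightarrow> Z t \<in> borel_measurable M"
  by (rule measurable_F_M[OF Z_F])

lemma J_measurable: "0 \<le> t \<Longrightarrow> J t \<in> borel_measurable M"
  using ito by (simp add: has_ito_integral_def mesh_limit_def)

lemma C_measurable: "0 \<le> t \<Longrightarrow> C t \<in> borel_measurable M"
  using bracket by (simp add: has_bracket_def mesh_limit_def)

text \<open>A qualitative substitute for a mean-square rate. Violating pairs of times would approach
  each other; almost every path is uniformly continuous on the compact interval, and dominated
  convergence with the constant (2c)^2 sends their mean-square distance to 0.\<close>

lemma Z_modulus:
  assumes T: "0 \<le> T" and \<epsilon>: "0 < \<epsilon>"
  shows "\<exists>d>0. \<forall>s\<in>{0..T}. \<forall>t\<in>{0..T}. \<bar>s - t\<bar> < d \<longrightarrow> expectation (\<lambda>\<omega>. (norm (Z s \<omega> - Z t \<omega>))\<^sup>2) < \<epsilon>"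
proof (rule ccontr)
  assume "\<not> ?thesis"
  then have *: "\<exists>s t. s \<in> {0..T} \<and> t \<in> {0..T} \<and> \<bar>s - t\<bar> < d \<and> \<epsilon> \<le> expectation (\<lambda>\<omega>. (norm (Z s \<omega> - Z t \<omega>))\<^sup>2)"
    if "0 < d" for d using that by (meson not_le)
  have "\<exists>s t. s \<in> {0..T} \<and> t \<in> {0..T} \<and> \<bar>s - t\<bar> < inverse (real (Suc n)) \<and> \<epsilon> \<le> expectation (\<lambda>\<omega>. (norm (Z s \<omega> - Z t \<omega>))\<^sup>2)" for n
    by (rule *) simp
  then obtain s t where st: "\<And>n. s n \<in> {0..T}" "\<And>n. t n \<in> {0..T}" "\<And>n. \<bar>s n - t n\<bar> < inverse (real (Suc n))"
    "\<And>n. \<epsilon> \<le> expectation (\<lambda>\<omega>. (norm (Z (s n) \<omega> - Z (t n) \<omega>))\<^sup>2)"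
    by metis
  have [measurable]: "Z (s n) \<in> borel_measurable M" "Z (t n) \<in> borel_measurable M" for n
    using st(1,2)[of n] by (simp_all add: Z_measurable)
  have "(\<lambda>n. expectation (\<lambda>\<omega>. (norm (Z (s n) \<omega> - Z (t n) \<omega>))\<^sup>2)) \<longlonglongrightarrow> expectation (\<lambda>\<omega>. 0)"
  proof (rule integral_dominated_convergence[where w="\<lambda>_. (2 * c)\<^sup>2"])
    show "AE \<omega> in M. (\<lambda>n. (norm (Z (s n) \<omega> - Z (t n) \<omega>))\<^sup>2) \<longlonglongrightarrow> 0"
      using Z_continuous
    proof eventually_elim
      case (elim \<omega>)
      have "uniformly_continuous_on {0..T} (\<lambda>t. Z t \<omega>)"
        by (rule compact_uniformly_continuous[OF continuous_on_subset[OF elim]]) auto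
      moreover have "(\<lambda>n. dist (s n) (t n)) \<longlonglongrightarrow> 0"
        by (rule tendsto_sandwich[OF _ _ tendsto_const LIMSEQ_inverse_real_of_nat])
          (use less_imp_le[OF st(3)] in \<open>simp_all add: dist_real_def\<close>)
      ultimately have "(\<lambda>n. dist (Z (s n) \<omega>) (Z (t n) \<omega>)) \<longlonglongrightarrow> 0"
        using st(1,2) unfolding uniformly_continuous_on_sequentially by simp
      then have "(\<lambda>n. (dist (Z (s n) \<omega>) (Z (t n) \<omega>))\<^sup>2) \<longlonglongrightarrow> 0\<^sup>2" by (rule tendsto_power)
      then show ?case by (simp add: dist_norm)
    qed
    show "AE \<omega> in M. norm ((norm (Z (s n) \<omega> - Z (t n) \<omega>))\<^sup>2) \<le> (2 * c)\<^sup>2" for n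
    proof (rule AE_I2)
      fix \<omega> assume \<omega>: "\<omega> \<in> space M"
      have "norm (Z (s n) \<omega> - Z (t n) \<omega>) \<le> 2 * c"
        using norm_triangle_ineq4[of "Z (s n) \<omega>" "Z (t n) \<omega>"] Z_norm[OF _ \<omega>, of "s n"] Z_norm[OF _ \<omega>, of "t n"] st(1,2)[of n] by simp
      then have "(norm (Z (s n) \<omega> - Z (t n) \<omega>))\<^sup>2 \<le> (2 * c)\<^sup>2" by (rule power_mono) simp
      then show "norm ((norm (Z (s n) \<omega> - Z (t n) \<omega>))\<^sup>2) \<le> (2 * c)\<^sup>2" by simp
    qed
  qed simp_all
  then have "\<epsilon> \<le> 0" using st(4) by (intro LIMSEQ_le_const) auto
  then show False using \<epsilon> by simp
qed

text \<open>The Ito integral is given only from time 0. A partition through the intermediate time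
  \<open>s\<close> splits its sums, and subtracting the sums for \<open>J s\<close> leaves those
  over the interval from \<open>s\<close> to \<open>t\<close>.\<close>

lemma J_increment:
  assumes st: "0 \<le> s" "s \<le> t"
  shows "tendsto_prob M (\<lambda>n. left_sum (Suc n) (grid s t n) (\<lambda>i \<omega>. b (Z (grid s t n i) \<omega>))) (\<lambda>\<omega>. J t \<omega> - J s \<omega>)"
proof -
  \<comment> \<open>The first \<open>Suc n\<close> steps run through the grid from 0 to
    \<open>s\<close>, the next \<open>Suc n\<close> through the grid from \<open>s\<close> to
    \<open>t\<close>; at index \<open>Suc n\<close> both formulas give \<open>s\<close>.\<close>
  define q where "q n i = (if i \<le> Suc n then grid 0 s n i else grid s t n (i - Suc n))" for n i
  have q2: "q n (Suc n + i) = grid s t n i" for n i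
    by (cases i) (simp_all add: q_def)
  have qi: "(i < Suc n \<and> q n i = grid 0 s n i \<and> q n (Suc i) = grid 0 s n (Suc i)) \<or>
      (\<exists>j<Suc n. i = Suc n + j \<and> q n i = grid s t n j \<and> q n (Suc i) = grid s t n (Suc j))" if "i < Suc n + Suc n" for n i
  proof (cases "i < Suc n")
    case True then show ?thesis by (simp add: q_def)
  next
    case False
    then obtain j where j: "i = Suc n + j" by (metis le_add_diff_inverse not_le)
    then have "j < Suc n" using that by simp
    then show ?thesis using j q2[of n j] q2[of n "Suc j"] by auto
  qed
  have "tendsto_prob M (\<lambda>n \<omega>. \<Sum>i<Suc n + Suc n. (W (q n (Suc i)) \<omega> - W (q n i) \<omega>) *\<^sub>R b (Z (q n i) \<omega>)) (J t)"
  proof (rule mesh_limit_tendsto_prob[where p=q and N="\<lambda>n. Suc n + Suc n"])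
    show "mesh_limit M t (\<lambda>n p \<omega>. \<Sum>i<n. (W (p (Suc i)) \<omega> - W (p i) \<omega>) *\<^sub>R b (Z (p i) \<omega>)) (J t)"
      using ito[of t] st by (simp add: has_ito_integral_def)
    show "time_partition t (Suc n + Suc n) (q n)" for n
      unfolding time_partition_def
    proof (intro conjI allI impI)
      show "q n 0 = 0" by (simp add: q_def)
      show "q n (Suc n + Suc n) = t" unfolding q2 by simp
      fix i assume "i < Suc n + Suc n"
      from qi[OF this] show "q n i \<le> q n (Suc i)"
        using grid_mono[of 0 s i "Suc i" n] grid_mono[of s t] st by auto
    qed
    fix d :: real assume d: "0 < d"
    show "\<forall>\<^sub>F n in sequentially. \<forall>i<Suc n + Suc n. q n (Suc i) - q n i < d"
      using grid_mesh[OF d, of s 0] grid_mesh[OF d, of t s]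
    proof eventually_elim
      case (elim n)
      show ?case
      proof (intro allI impI)
        fix i assume "i < Suc n + Suc n"
        from qi[OF this] show "q n (Suc i) - q n i < d"
          using elim grid_step[of 0 s n i] grid_step[of s t n] by auto
      qed
    qed
  qed
  moreover have "tendsto_prob M (\<lambda>n \<omega>. \<Sum>i<Suc n. (W (grid 0 s n (Suc i)) \<omega> - W (grid 0 s n i) \<omega>) *\<^sub>R b (Z (grid 0 s n i) \<omega>)) (J s)"
    by (rule mesh_limit_grid[OF ito[OF st(1), unfolded has_ito_integral_def] st(1)])
  ultimately have "tendsto_prob M (\<lambda>n \<omega>. (\<Sum>i<Suc n + Suc n. (W (q n (Suc i)) \<omega> - W (q n i) \<omega>) *\<^sub>R b (Z (q n i) \<omega>))
      - (\<Sum>i<Suc n. (W (grid 0 s n (Suc i)) \<omega> - W (grid 0 s n i) \<omega>) *\<^sub>R b (Z (grid 0 s n i) \<omega>))) (\<lambda>\<omega>. J t \<omega> - J s \<omega>)"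
  proof (rule tendsto_prob_diff[rotated 4])
    have q0: "0 \<le> q n i" if "i \<le> Suc n + Suc n" for n i
    proof (cases "i \<le> Suc n")
      case True then show ?thesis using grid_bounds[of 0 s i n] st by (simp add: q_def)
    next
      case False have "i - Suc n \<le> Suc n" using that by simp
      from grid_bounds[OF st(2) this] False show ?thesis using st(1) by (simp add: q_def)
    qed
    have g0: "0 \<le> grid 0 s n i" if "i \<le> Suc n" for n i using grid_bounds[of 0 s i n] st that by simp
    show "(\<lambda>\<omega>. \<Sum>i<Suc n + Suc n. (W (q n (Suc i)) \<omega> - W (q n i) \<omega>) *\<^sub>R b (Z (q n i) \<omega>)) \<in> borel_measurable M" for n
      by (intro borel_measurable_sum borel_measurable_scaleR borel_measurable_diff W_measurable
          measurable_compose[OF Z_measurable b_measurable] q0) auto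
    show "(\<lambda>\<omega>. \<Sum>i<Suc n. (W (grid 0 s n (Suc i)) \<omega> - W (grid 0 s n i) \<omega>) *\<^sub>R b (Z (grid 0 s n i) \<omega>)) \<in> borel_measurable M" for n
      by (intro borel_measurable_sum borel_measurable_scaleR borel_measurable_diff W_measurable
          measurable_compose[OF Z_measurable b_measurable] g0) auto
    show "J t \<in> borel_measurable M" "J s \<in> borel_measurable M" using st by (simp_all add: J_measurable)
  qed
  moreover have "(\<Sum>i<Suc n + Suc n. (W (q n (Suc i)) \<omega> - W (q n i) \<omega>) *\<^sub>R b (Z (q n i) \<omega>))
      - (\<Sum>i<Suc n. (W (grid 0 s n (Suc i)) \<omega> - W (grid 0 s n i) \<omega>) *\<^sub>R b (Z (grid 0 s n i) \<omega>))
      = left_sum (Suc n) (grid s t n) (\<lambda>i \<omega>. b (Z (grid s t n i) \<omega>)) \<omega>" for n \<omega>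
  proof -
    have split: "(\<Sum>i<m + k. f i) = (\<Sum>i<m. f i) + (\<Sum>i<k. f (m + i))" for f :: "nat \<Rightarrow> 'b" and m k
      by (induction k) (simp_all add: add.assoc)
    have "(\<Sum>i<Suc n. (W (q n (Suc i)) \<omega> - W (q n i) \<omega>) *\<^sub>R b (Z (q n i) \<omega>))
      = (\<Sum>i<Suc n. (W (grid 0 s n (Suc i)) \<omega> - W (grid 0 s n i) \<omega>) *\<^sub>R b (Z (grid 0 s n i) \<omega>))"
      by (rule sum.cong) (auto simp: q_def)
    moreover have "(\<Sum>i<Suc n. (W (q n (Suc (Suc n + i))) \<omega> - W (q n (Suc n + i)) \<omega>) *\<^sub>R b (Z (q n (Suc n + i)) \<omega>))
      = left_sum (Suc n) (grid s t n) (\<lambda>i \<omega>. b (Z (grid s t n i) \<omega>)) \<omega>"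
      unfolding left_sum_def q2 by (simp only: add_Suc_right[symmetric] q2)
    ultimately show ?thesis unfolding split by (simp only: add_diff_cancel_left')
  qed
  ultimately show ?thesis by (simp only:)
qed

lemma bZ_norm: "0 \<le> t \<Longrightarrow> \<omega> \<in> space M \<Longrightarrow> norm (b (Z t \<omega>)) \<le> \<beta> * c"
  using b_bound[of "Z t \<omega>"] Z_norm[of t \<omega>] by simp

lemma bZ_measurable_F: "0 \<le> s \<Longrightarrow> s \<le> t \<Longrightarrow> (\<lambda>\<omega>. b (Z s \<omega>)) \<in> borel_measurable (F t)"
  by (rule measurable_compose[OF Z_measurable_F b_measurable])

text \<open>The increments of W telescope, so subtracting
  \<open>(W t \<omega> - W s \<omega>) *\<^sub>R g \<omega>\<close> amounts to replacing the
  integrand by its difference from \<open>g\<close>, which is known at time \<open>s\<close>. The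
  bound is half of the Ito isometry: it holds for the sums by orthogonality and for the limit by
  Fatou.\<close>

lemma J_error:
  assumes st: "0 \<le> s" "s \<le> t" and g: "g \<in> borel_measurable (F s)"
    and gd: "\<And>\<omega>. \<omega> \<in> space M \<Longrightarrow> norm (g \<omega>) \<le> d"
    and k: "\<And>u. s \<le> u \<Longrightarrow> u \<le> t \<Longrightarrow> expectation (\<lambda>\<omega>. (norm (b (Z u \<omega>) - g \<omega>))\<^sup>2) \<le> k"
  shows "integrable M (\<lambda>\<omega>. (norm (J t \<omega> - J s \<omega> - (W t \<omega> - W s \<omega>) *\<^sub>R g \<omega>))\<^sup>2)"
    and "expectation (\<lambda>\<omega>. (norm (J t \<omega> - J s \<omega> - (W t \<omega> - W s \<omega>) *\<^sub>R g \<omega>))\<^sup>2) \<le> k * (t - s)"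
proof -
  define X where "X n = left_sum (Suc n) (grid s t n) (\<lambda>i \<omega>. b (Z (grid s t n i) \<omega>) - g \<omega>)" for n
  have X: "X n \<omega> = left_sum (Suc n) (grid s t n) (\<lambda>i \<omega>. b (Z (grid s t n i) \<omega>)) \<omega> - (W t \<omega> - W s \<omega>) *\<^sub>R g \<omega>" for n \<omega>
  proof -
    have "(W t \<omega> - W s \<omega>) *\<^sub>R g \<omega> = (\<Sum>i<Suc n. W (grid s t n (Suc i)) \<omega> - W (grid s t n i) \<omega>) *\<^sub>R g \<omega>"
      using sum_lessThan_telescope[of "\<lambda>i. W (grid s t n i) \<omega>" "Suc n"] by (simp del: sum.lessThan_Suc)
    also have "\<dots> = (\<Sum>i<Suc n. (W (grid s t n (Suc i)) \<omega> - W (grid s t n i) \<omega>) *\<^sub>R g \<omega>)"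
      by (rule scaleR_left.sum)
    finally show ?thesis unfolding X_def left_sum_def by (simp only: scaleR_diff_right sum_subtractf)
  qed
  have gs: "s \<le> grid s t n i" "grid s t n i \<le> t" "0 \<le> grid s t n i" if "i \<le> Suc n" for n i
    using grid_bounds[OF st(2) that] st by auto
  have am: "(\<lambda>\<omega>. b (Z (grid s t n i) \<omega>) - g \<omega>) \<in> borel_measurable (F (grid s t n i))" if "i < Suc n" for n i
    using that by (intro borel_measurable_diff bZ_measurable_F measurable_F_mono[OF g] gs) auto
  have ab: "norm (b (Z (grid s t n i) \<omega>) - g \<omega>) \<le> \<beta> * c + d" if "i < Suc n" "\<omega> \<in> space M" for n i \<omega>
    using norm_triangle_ineq4[of "b (Z (grid s t n i) \<omega>)" "g \<omega>"] bZ_norm[of "grid s t n i" \<omega>] gd[of \<omega>] gs[of i n] that by simp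
  have p: "0 \<le> grid s t n 0" "grid s t n i \<le> grid s t n (Suc i)" for n i
    using st by (auto intro: grid_mono)
  have "expectation (\<lambda>\<omega>. (norm (b (Z (grid s t n i) \<omega>) - g \<omega>))\<^sup>2) \<le> k" if "i < Suc n" for n i
    using that gs[of i n] by (intro k) auto
  note S = left_sum_properties[where p="grid s t n" and n="Suc n" and a="\<lambda>i \<omega>. b (Z (grid s t n i) \<omega>) - g \<omega>" for n,
      OF p am ab this, folded X_def]
  have gM: "g \<in> borel_measurable M" by (rule measurable_F_M[OF g])
  have lim: "tendsto_prob M X (\<lambda>\<omega>. J t \<omega> - J s \<omega> - (W t \<omega> - W s \<omega>) *\<^sub>R g \<omega>)"
    using J_increment[OF st] unfolding tendsto_prob_def X dist_norm by simp
  have meas: "X n \<in> borel_measurable M" for n using S(1) by (rule measurable_F_M)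
  have m: "(\<lambda>\<omega>. J t \<omega> - J s \<omega> - (W t \<omega> - W s \<omega>) *\<^sub>R g \<omega>) \<in> borel_measurable M"
    using st gM by (intro borel_measurable_diff borel_measurable_scaleR J_measurable W_measurable) auto
  have e: "expectation (\<lambda>\<omega>. (norm (X n \<omega>))\<^sup>2) \<le> k * (t - s)" for n using S(3)[of n] by simp
  show "integrable M (\<lambda>\<omega>. (norm (J t \<omega> - J s \<omega> - (W t \<omega> - W s \<omega>) *\<^sub>R g \<omega>))\<^sup>2)"
    by (rule tendsto_prob_square_bound(1)[OF meas m lim S(2) e])
  show "expectation (\<lambda>\<omega>. (norm (J t \<omega> - J s \<omega> - (W t \<omega> - W s \<omega>) *\<^sub>R g \<omega>))\<^sup>2) \<le> k * (t - s)"
    by (rule tendsto_prob_square_bound(2)[OF meas m lim S(2) e])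
qed

text \<open>The martingale property of the Ito integral, taken over from the left-point sums through
  convergence in mean.\<close>

lemma J_inner_zero:
  assumes st: "0 \<le> s" "s \<le> t" and \<xi>: "\<xi> \<in> borel_measurable (F s)" "\<And>\<omega>. \<omega> \<in> space M \<Longrightarrow> norm (\<xi> \<omega>) \<le> d"
  shows "expectation (\<lambda>\<omega>. (J t \<omega> - J s \<omega>) \<bullet> \<xi> \<omega>) = 0"
proof -
  define X where "X n = left_sum (Suc n) (grid s t n) (\<lambda>i \<omega>. b (Z (grid s t n i) \<omega>))" for n
  have gs: "s \<le> grid s t n i" "grid s t n i \<le> t" "0 \<le> grid s t n i" if "i \<le> Suc n" for n i
    using grid_bounds[OF st(2) that] st by auto
  have am: "(\<lambda>\<omega>. b (Z (grid s t n i) \<omega>)) \<in> borel_measurable (F (grid s t n i))" if "i < Suc n" for n i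
    using that by (intro bZ_measurable_F gs) auto
  have ab: "norm (b (Z (grid s t n i) \<omega>)) \<le> \<beta> * c" if "i < Suc n" "\<omega> \<in> space M" for n i \<omega>
    using bZ_norm[of "grid s t n i" \<omega>] gs[of i n] that by simp
  have p: "0 \<le> grid s t n 0" "grid s t n i \<le> grid s t n (Suc i)" for n i
    using st by (auto intro: grid_mono)
  have sq: "expectation (\<lambda>\<omega>. (norm (b (Z (grid s t n i) \<omega>)))\<^sup>2) \<le> (\<beta> * c)\<^sup>2" if i: "i < Suc n" for n i
  proof -
    have "integrable M (\<lambda>\<omega>. (norm (b (Z (grid s t n i) \<omega>)))\<^sup>2)"
      by (rule integrable_const_bound[where B="(\<beta> * c)\<^sup>2"])
        (use ab[OF i] measurable_F_M[OF am[OF i]] in \<open>auto intro!: AE_I2 power_mono\<close>)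
    then have "expectation (\<lambda>\<omega>. (norm (b (Z (grid s t n i) \<omega>)))\<^sup>2) \<le> expectation (\<lambda>\<omega>. (\<beta> * c)\<^sup>2)"
      by (rule integral_mono) (use ab[OF i] in \<open>auto intro!: power_mono\<close>)
    then show ?thesis by (simp add: prob_space)
  qed
  note S = left_sum_properties[where p="grid s t n" and n="Suc n" and a="\<lambda>i \<omega>. b (Z (grid s t n i) \<omega>)" for n,
      OF p am ab sq, folded X_def]
  have meas: "X n \<in> borel_measurable M" for n using S(1) by (rule measurable_F_M)
  have m: "(\<lambda>\<omega>. J t \<omega> - J s \<omega>) \<in> borel_measurable M"
    using st by (intro borel_measurable_diff J_measurable) auto
  have lim: "tendsto_prob M X (\<lambda>\<omega>. J t \<omega> - J s \<omega>)" unfolding X_def by (rule J_increment[OF st])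
  have zero: "expectation (\<lambda>\<omega>. X n \<omega> \<bullet> \<xi> \<omega>) = 0" for n
    unfolding X_def by (rule left_sum_inner_zero[OF p am ab _ \<xi>(2)]) (use \<xi> in simp_all)
  have e: "expectation (\<lambda>\<omega>. (norm (X n \<omega>))\<^sup>2) \<le> (\<beta> * c)\<^sup>2 * (t - s)" for n using S(3)[of n] by simp
  show ?thesis
    by (rule tendsto_prob_inner_zero[OF meas m measurable_F_M[OF \<xi>(1)] lim S(2) e \<xi>(2) zero])
qed

lemma Z_continuous_b: "AE \<omega> in M. continuous_on {0..} (\<lambda>t. Z t \<omega>) \<and> continuous_on {0..} (\<lambda>t. b (Z t \<omega>)) \<and> continuous_on {0..} (\<lambda>t. b (b (Z t \<omega>)))"
  using Z_continuous by eventually_elim (auto intro!: linear_continuous_on_compose[OF _ lin])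

lemma W_small_increments:
  assumes T: "0 \<le> T" and cont: "continuous_on {0..} w" and e: "0 < (e::real)"
  shows "\<forall>\<^sub>F n in sequentially. \<forall>i<Suc n. \<bar>w (grid 0 T n (Suc i)) - w (grid 0 T n i)\<bar> < e"
proof -
  have "uniformly_continuous_on {0..T} w"
    by (rule compact_uniformly_continuous[OF continuous_on_subset[OF cont]]) auto
  then obtain d where d: "d > 0" "\<And>x y. x \<in> {0..T} \<Longrightarrow> y \<in> {0..T} \<Longrightarrow> dist y x < d \<Longrightarrow> dist (w y) (w x) < e"
    using e unfolding uniformly_continuous_on_def by metis
  show ?thesis
    using grid_mesh[OF d(1), of T 0]
  proof eventually_elim
    case (elim n)
    show ?case
    proof (intro allI impI)
      fix i assume i: "i < Suc n"
      have "dist (grid 0 T n (Suc i)) (grid 0 T n i) < d"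
        using elim grid_step[of 0 T n i] T by (simp add: dist_real_def)
      then show "\<bar>w (grid 0 T n (Suc i)) - w (grid 0 T n i)\<bar> < e"
        using d(2)[of "grid 0 T n i" "grid 0 T n (Suc i)"] grid_bounds[OF T, of i n] grid_bounds[OF T, of "Suc i" n] i
        by (simp add: dist_real_def)
    qed
  qed
qed

lemma bZ_diff_square:
  assumes "0 \<le> s" "0 \<le> u" "expectation (\<lambda>\<omega>. (norm (Z u \<omega> - Z s \<omega>))\<^sup>2) \<le> e"
  shows "integrable M (\<lambda>\<omega>. (norm (Z u \<omega> - Z s \<omega>))\<^sup>2)"
    and "expectation (\<lambda>\<omega>. (norm (b (Z u \<omega>) - b (Z s \<omega>)))\<^sup>2) \<le> \<beta>\<^sup>2 * e"
proof -
  have [measurable]: "Z u \<in> borel_measurable M" "Z s \<in> borel_measurable M"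
    using assms by (simp_all add: Z_measurable)
  have d: "norm (Z u \<omega> - Z s \<omega>) \<le> 2 * c" if "\<omega> \<in> space M" for \<omega>
    using norm_triangle_ineq4[of "Z u \<omega>" "Z s \<omega>"] Z_norm[OF assms(1) that] Z_norm[OF assms(2) that] by simp
  show i: "integrable M (\<lambda>\<omega>. (norm (Z u \<omega> - Z s \<omega>))\<^sup>2)"
    by (rule integrable_const_bound[where B="(2 * c)\<^sup>2"], rule AE_I2, unfold real_norm_def abs_power2,
        rule power_mono[OF d norm_ge_zero]) auto
  have le: "(norm (b (Z u \<omega>) - b (Z s \<omega>)))\<^sup>2 \<le> \<beta>\<^sup>2 * (norm (Z u \<omega> - Z s \<omega>))\<^sup>2" for \<omega>
    using power_mono[OF b_bound[of "Z u \<omega> - Z s \<omega>"] norm_ge_zero, of 2]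
    by (simp add: b_simps power_mult_distrib)
  have "expectation (\<lambda>\<omega>. (norm (b (Z u \<omega>) - b (Z s \<omega>)))\<^sup>2) \<le> expectation (\<lambda>\<omega>. \<beta>\<^sup>2 * (norm (Z u \<omega> - Z s \<omega>))\<^sup>2)"
  proof (rule integral_mono)
    show "integrable M (\<lambda>\<omega>. \<beta>\<^sup>2 * (norm (Z u \<omega> - Z s \<omega>))\<^sup>2)" using i by simp
    then show "integrable M (\<lambda>\<omega>. (norm (b (Z u \<omega>) - b (Z s \<omega>)))\<^sup>2)"
      by (rule Bochner_Integration.integrable_bound) (use le in auto)
  qed (rule le)
  also have "\<dots> \<le> \<beta>\<^sup>2 * e" using assms(3) by (simp add: mult_left_mono)
  finally show "expectation (\<lambda>\<omega>. (norm (b (Z u \<omega>) - b (Z s \<omega>)))\<^sup>2) \<le> \<beta>\<^sup>2 * e" .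
qed

text \<open>Freezing the integrand at the left end point costs a second moment of order
  \<open>e * (t - s)\<close>. With \<open>e\<close> small by \<open>Z_modulus\<close>, this is of
  smaller order than the step length.\<close>

lemma J_local_error:
  assumes st: "0 \<le> s" "s \<le> t"
    and e: "\<And>u. s \<le> u \<Longrightarrow> u \<le> t \<Longrightarrow> expectation (\<lambda>\<omega>. (norm (Z u \<omega> - Z s \<omega>))\<^sup>2) \<le> e"
  shows "integrable M (\<lambda>\<omega>. (norm (J t \<omega> - J s \<omega> - (W t \<omega> - W s \<omega>) *\<^sub>R b (Z s \<omega>)))\<^sup>2)"
    and "expectation (\<lambda>\<omega>. (norm (J t \<omega> - J s \<omega> - (W t \<omega> - W s \<omega>) *\<^sub>R b (Z s \<omega>)))\<^sup>2) \<le> \<beta>\<^sup>2 * e * (t - s)"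
proof -
  have g: "(\<lambda>\<omega>. b (Z s \<omega>)) \<in> borel_measurable (F s)" using st by (simp add: bZ_measurable_F)
  have k: "expectation (\<lambda>\<omega>. (norm (b (Z u \<omega>) - b (Z s \<omega>)))\<^sup>2) \<le> \<beta>\<^sup>2 * e" if "s \<le> u" "u \<le> t" for u
    using st that by (intro bZ_diff_square(2) e) auto
  show "integrable M (\<lambda>\<omega>. (norm (J t \<omega> - J s \<omega> - (W t \<omega> - W s \<omega>) *\<^sub>R b (Z s \<omega>)))\<^sup>2)"
    by (rule J_error(1)[OF st g bZ_norm[OF st(1)] k])
  show "expectation (\<lambda>\<omega>. (norm (J t \<omega> - J s \<omega> - (W t \<omega> - W s \<omega>) *\<^sub>R b (Z s \<omega>)))\<^sup>2) \<le> \<beta>\<^sup>2 * e * (t - s)"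
    by (rule J_error(2)[OF st g bZ_norm[OF st(1)] k])
qed

text \<open>Each centred square has variance 2h^2 with h = T / (n + 1), and the centred squares with
  past weights are orthogonal. The second moment of the sum is therefore of order T^2 / (n +
  1).\<close>

lemma quadratic_sum_L1:
  assumes T: "0 \<le> T"
  defines "R \<equiv> \<lambda>n \<omega>. \<Sum>i<Suc n. ((W (grid 0 T n (Suc i)) \<omega> - W (grid 0 T n i) \<omega>)\<^sup>2 - T / real (Suc n)) *\<^sub>R b (b (Z (grid 0 T n i) \<omega>))"
  shows "integrable M (R n)" and "(\<lambda>n. expectation (\<lambda>\<omega>. norm (R n \<omega>))) \<longlonglongrightarrow> 0"
proof -
  define K where "K = \<beta> * (\<beta> * c)"
  have K: "0 \<le> K" using c_nonneg \<beta>_nonneg by (simp add: K_def)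
  have gs: "0 \<le> grid 0 T n i" if "i \<le> Suc n" for n i using grid_bounds[OF T that] by auto
  have p: "0 \<le> grid 0 T n 0" "grid 0 T n i \<le> grid 0 T n (Suc i)" for n i using T by (auto intro: grid_mono)
  have bb: "norm (b (b (Z (grid 0 T n i) \<omega>))) \<le> K" if "i < Suc n" "\<omega> \<in> space M" for n i \<omega>
    unfolding K_def using order_trans[OF b_bound mult_left_mono[OF bZ_norm \<beta>_nonneg]] gs[of i n] that by simp
  have bm: "(\<lambda>\<omega>. b (b (Z (grid 0 T n i) \<omega>))) \<in> borel_measurable (F (grid 0 T n i))" if "i < Suc n" for n i
    using gs[of i n] that by (intro measurable_compose[OF bZ_measurable_F b_measurable]) auto
  have sq: "expectation (\<lambda>\<omega>. (norm (b (b (Z (grid 0 T n i) \<omega>))))\<^sup>2) \<le> K\<^sup>2" if i: "i < Suc n" for n i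
  proof -
    have "integrable M (\<lambda>\<omega>. (norm (b (b (Z (grid 0 T n i) \<omega>))))\<^sup>2)"
      by (rule integrable_const_bound[where B="K\<^sup>2"])
        (use bb[OF i] measurable_F_M[OF bm[OF i]] in \<open>auto intro!: AE_I2 power_mono\<close>)
    then have "expectation (\<lambda>\<omega>. (norm (b (b (Z (grid 0 T n i) \<omega>))))\<^sup>2) \<le> expectation (\<lambda>\<omega>. K\<^sup>2)"
      by (rule integral_mono) (use bb[OF i] in \<open>auto intro!: power_mono\<close>)
    then show ?thesis by (simp add: prob_space)
  qed
  have R: "R n = increment_sum (Suc n) (grid 0 T n) (\<lambda>i x. x\<^sup>2 - T / real (Suc n)) (\<lambda>i \<omega>. b (b (Z (grid 0 T n i) \<omega>)))" for n
    by (simp add: R_def increment_sum_def fun_eq_iff)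
  have props: "grid 0 T n 0 \<le> grid 0 T n (Suc n) \<and> R n \<in> borel_measurable (F (grid 0 T n (Suc n))) \<and>
    integrable M (\<lambda>\<omega>. (norm (R n \<omega>))\<^sup>2) \<and>
    expectation (\<lambda>\<omega>. (norm (R n \<omega>))\<^sup>2) \<le> K\<^sup>2 * (\<Sum>i<Suc n. 2 * (T / real (Suc n))\<^sup>2)" for n
    unfolding R
  proof (rule increment_sum_properties[OF p bm bb sq])
    fix i assume i: "i < Suc n"
    define h where "h = T / real (Suc n)"
    have h: "grid 0 T n (Suc i) - grid 0 T n i = h" using grid_step[of 0 T n i] by (simp add: h_def)
    have pi: "0 \<le> grid 0 T n i" "grid 0 T n i \<le> grid 0 T n (Suc i)" using p gs[of i n] i by auto
    define w where "w \<omega> = W (grid 0 T n (Suc i)) \<omega> - W (grid 0 T n i) \<omega>" for \<omega>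
    have w: "integrable M (\<lambda>\<omega>. (w \<omega>) ^ k)" for k unfolding w_def by (rule increment_integrable[OF pi])
    have mom: "expectation (\<lambda>\<omega>. (w \<omega>)\<^sup>2) = h" "expectation (\<lambda>\<omega>. (w \<omega>) ^ 4) = 3 * h\<^sup>2"
      using increment_moments[OF pi] unfolding h w_def by simp_all
    have eq: "((w \<omega>)\<^sup>2 - h)\<^sup>2 = (w \<omega>) ^ 4 - 2 * h * (w \<omega>)\<^sup>2 + h\<^sup>2" for \<omega>
      by (simp add: power2_eq_square algebra_simps eval_nat_numeral)
    show "integrable M (\<lambda>\<omega>. (W (grid 0 T n (Suc i)) \<omega> - W (grid 0 T n i) \<omega>)\<^sup>2 - T / real (Suc n))"
      unfolding w_def[symmetric] using w[of 2] by simp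
    show "expectation (\<lambda>\<omega>. (W (grid 0 T n (Suc i)) \<omega> - W (grid 0 T n i) \<omega>)\<^sup>2 - T / real (Suc n)) = 0"
      unfolding w_def[symmetric] h_def[symmetric] using w[of 2] mom by (simp add: prob_space)
    show "integrable M (\<lambda>\<omega>. ((W (grid 0 T n (Suc i)) \<omega> - W (grid 0 T n i) \<omega>)\<^sup>2 - T / real (Suc n))\<^sup>2)"
      unfolding w_def[symmetric] h_def[symmetric] eq using w[of 2] w[of 4] by simp
    show "expectation (\<lambda>\<omega>. ((W (grid 0 T n (Suc i)) \<omega> - W (grid 0 T n i) \<omega>)\<^sup>2 - T / real (Suc n))\<^sup>2) = 2 * (T / real (Suc n))\<^sup>2"
      unfolding w_def[symmetric] h_def[symmetric] eq using w[of 2] w[of 4] mom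
      by (simp add: prob_space power2_eq_square)
  qed simp_all
  have Rm: "R n \<in> borel_measurable M" for n using props[of n] measurable_F_M by blast
  show "integrable M (R n)" using props[of n] by (intro integrable_of_square[OF Rm]) auto
  \<comment> \<open>The square root of the second-moment bound K^2 (n + 1) 2 (T / (n +
    1))^2.\<close>
  define B where "B n = K * (sqrt 2 * T) / sqrt (real (Suc n))" for n
  have B: "0 \<le> B n" for n using K T by (simp add: B_def)
  have B2: "K\<^sup>2 * (\<Sum>i<Suc n. 2 * (T / real (Suc n))\<^sup>2) = (B n)\<^sup>2" for n
  proof -
    define x where "x = real (Suc n)"
    have x: "x > 0" by (simp add: x_def)
    have "(\<Sum>i<Suc n. 2 * (T / real (Suc n))\<^sup>2) = x * (2 * (T / x)\<^sup>2)"
      by (simp only: sum_constant card_lessThan x_def)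
    also have "\<dots> = 2 * T\<^sup>2 / x" using x by (simp add: power_divide power2_eq_square)
    finally have 1: "(\<Sum>i<Suc n. 2 * (T / real (Suc n))\<^sup>2) = 2 * T\<^sup>2 / x" .
    have "(B n)\<^sup>2 = K\<^sup>2 * (2 * T\<^sup>2 / x)"
      unfolding B_def x_def[symmetric] using x by (simp add: power_divide power_mult_distrib)
    then show ?thesis unfolding 1 by simp
  qed
  have le: "expectation (\<lambda>\<omega>. norm (R n \<omega>)) \<le> B n" for n
    using props[of n] unfolding B2 by (intro expectation_norm_le Rm B) auto
  have "(\<lambda>n. K * (sqrt 2 * T) * inverse (sqrt (real (Suc n)))) \<longlonglongrightarrow> K * (sqrt 2 * T) * 0"
    by (intro tendsto_intros tendsto_inverse_0_at_top filterlim_compose[OF sqrt_at_top]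
        filterlim_compose[OF filterlim_real_sequentially] filterlim_Suc)
  then have "B \<longlonglongrightarrow> 0" by (simp add: B_def[abs_def] divide_inverse)
  then show "(\<lambda>n. expectation (\<lambda>\<omega>. norm (R n \<omega>))) \<longlonglongrightarrow> 0"
    by (rule tendsto_sandwich[OF _ _ tendsto_const, rotated 2]) (auto simp: le integral_nonneg_AE)
qed

text \<open>A Wiener increment has size sqrt h and the freezing error \<open>E\<close> has second
  moment o(h), so each product is o(h) in mean, and there are T/h of them.\<close>

lemma cross_sum_L1:
  assumes T: "0 \<le> T"
  defines "w \<equiv> \<lambda>n i \<omega>. W (grid 0 T n (Suc i)) \<omega> - W (grid 0 T n i) \<omega>"
  defines "E \<equiv> \<lambda>n i \<omega>. J (grid 0 T n (Suc i)) \<omega> - J (grid 0 T n i) \<omega> - w n i \<omega> *\<^sub>R b (Z (grid 0 T n i) \<omega>)"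
  defines "Q \<equiv> \<lambda>n \<omega>. \<Sum>i<Suc n. w n i \<omega> *\<^sub>R b (E n i \<omega>)"
  shows "integrable M (Q n)" and "(\<lambda>n. expectation (\<lambda>\<omega>. norm (Q n \<omega>))) \<longlonglongrightarrow> 0"
proof -
  have gs: "0 \<le> grid 0 T n i" "grid 0 T n i \<le> T" if "i \<le> Suc n" for n i using grid_bounds[OF T that] by auto
  have p: "grid 0 T n i \<le> grid 0 T n (Suc i)" for n i using T by (auto intro: grid_mono)
  have pi: "0 \<le> grid 0 T n i" "grid 0 T n i \<le> grid 0 T n (Suc i)" "0 \<le> grid 0 T n (Suc i)" if "i < Suc n" for n i
    using p gs[of i n] gs[of "Suc i" n] that by auto
  have w2: "integrable M (\<lambda>\<omega>. (w n i \<omega>)\<^sup>2)" "expectation (\<lambda>\<omega>. (w n i \<omega>)\<^sup>2) = T / real (Suc n)" if "i < Suc n" for n i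
    using increment_integrable[OF pi(1,2)[OF that], of 2] increment_moments(2)[OF pi(1,2)[OF that]] grid_step[of 0 T n i]
    by (simp_all add: w_def)
  have wm: "w n i \<in> borel_measurable M" if "i < Suc n" for n i
    unfolding w_def by (intro borel_measurable_diff W_measurable pi that)
  have Em: "E n i \<in> borel_measurable M" if "i < Suc n" for n i
    unfolding E_def by (intro borel_measurable_diff borel_measurable_scaleR wm that J_measurable pi
        measurable_compose[OF Z_measurable b_measurable])
  \<comment> \<open>A crude bound from the constant norm; it serves for square integrability of
    \<open>E n i\<close>, while the smallness comes from \<open>Z_modulus\<close> below.\<close>
  have bound: "expectation (\<lambda>\<omega>. (norm (Z u \<omega> - Z s \<omega>))\<^sup>2) \<le> (2 * c)\<^sup>2" if "0 \<le> s" "0 \<le> u" for s u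
  proof -
    have "expectation (\<lambda>\<omega>. (norm (Z u \<omega> - Z s \<omega>))\<^sup>2) \<le> expectation (\<lambda>\<omega>. (2 * c)\<^sup>2)"
    proof (rule integral_mono)
      show "integrable M (\<lambda>\<omega>. (norm (Z u \<omega> - Z s \<omega>))\<^sup>2)" by (rule bZ_diff_square(1)[OF that order_refl])
      show "(norm (Z u \<omega> - Z s \<omega>))\<^sup>2 \<le> (2 * c)\<^sup>2" if "\<omega> \<in> space M" for \<omega>
        using norm_triangle_ineq4[of "Z u \<omega>" "Z s \<omega>"] Z_norm[OF \<open>0 \<le> s\<close> that] Z_norm[OF \<open>0 \<le> u\<close> that]
        by (intro power_mono) auto
    qed simp
    then show ?thesis by (simp add: prob_space)
  qed
  have E2: "integrable M (\<lambda>\<omega>. (norm (E n i \<omega>))\<^sup>2)" if i: "i < Suc n" for n i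
    unfolding E_def w_def
    by (rule J_local_error(1)[OF pi(1,2)[OF i] bound]) (use pi[OF i] in auto)
  \<comment> \<open>Young's inequality with weight \<open>e\<close>. It balances both parts because
    the second moment of \<open>E n i\<close> will be at most \<beta>^2 e^2 h: each part is then a
    multiple of e h.\<close>
  have term_le: "norm (w n i \<omega> *\<^sub>R b (E n i \<omega>)) \<le> \<beta> / 2 * (e * (w n i \<omega>)\<^sup>2 + (norm (E n i \<omega>))\<^sup>2 / e)"
    if e: "0 < e" for e :: real and n i \<omega>
  proof -
    have "0 \<le> (sqrt e * \<bar>w n i \<omega>\<bar> - norm (E n i \<omega>) / sqrt e)\<^sup>2" by simp
    also have "\<dots> = e * (w n i \<omega>)\<^sup>2 + (norm (E n i \<omega>))\<^sup>2 / e - 2 * (\<bar>w n i \<omega>\<bar> * norm (E n i \<omega>))"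
      using e by (simp add: power2_diff power_mult_distrib power_divide)
    finally have "\<bar>w n i \<omega>\<bar> * norm (E n i \<omega>) \<le> (e * (w n i \<omega>)\<^sup>2 + (norm (E n i \<omega>))\<^sup>2 / e) / 2" by simp
    then have "\<beta> * (\<bar>w n i \<omega>\<bar> * norm (E n i \<omega>)) \<le> \<beta> * ((e * (w n i \<omega>)\<^sup>2 + (norm (E n i \<omega>))\<^sup>2 / e) / 2)"
      by (rule mult_left_mono) (rule \<beta>_nonneg)
    moreover have "norm (w n i \<omega> *\<^sub>R b (E n i \<omega>)) \<le> \<bar>w n i \<omega>\<bar> * (\<beta> * norm (E n i \<omega>))"
      by (simp add: mult_left_mono b_bound)
    ultimately show ?thesis by (simp add: algebra_simps)
  qed
  have ti: "integrable M (\<lambda>\<omega>. w n i \<omega> *\<^sub>R b (E n i \<omega>))" if i: "i < Suc n" for n i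
  proof (rule Bochner_Integration.integrable_bound)
    show "integrable M (\<lambda>\<omega>. \<beta> / 2 * (1 * (w n i \<omega>)\<^sup>2 + (norm (E n i \<omega>))\<^sup>2 / 1))"
      using w2(1)[OF i] E2[OF i] by simp
    show "(\<lambda>\<omega>. w n i \<omega> *\<^sub>R b (E n i \<omega>)) \<in> borel_measurable M"
      by (intro borel_measurable_scaleR wm measurable_compose[OF Em b_measurable] i)
    show "AE \<omega> in M. norm (w n i \<omega> *\<^sub>R b (E n i \<omega>)) \<le> norm (\<beta> / 2 * (1 * (w n i \<omega>)\<^sup>2 + (norm (E n i \<omega>))\<^sup>2 / 1))"
      by (rule AE_I2, rule order_trans[OF term_le[of 1]]) (simp, unfold real_norm_def, rule abs_ge_self)
  qed
  show "integrable M (Q n)" for n unfolding Q_def by (rule Bochner_Integration.integrable_sum) (use ti in simp)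
  have key: "\<forall>\<^sub>F n in sequentially. expectation (\<lambda>\<omega>. norm (Q n \<omega>)) \<le> \<beta> / 2 * (1 + \<beta>\<^sup>2) * T * e" if e: "0 < e" for e
  proof -
    obtain d where d: "d > 0" "\<And>s t. s \<in> {0..T} \<Longrightarrow> t \<in> {0..T} \<Longrightarrow> \<bar>s - t\<bar> < d \<Longrightarrow> expectation (\<lambda>\<omega>. (norm (Z s \<omega> - Z t \<omega>))\<^sup>2) < e\<^sup>2"
      using Z_modulus[OF T, of "e\<^sup>2"] e by auto
    show ?thesis
      using grid_mesh[OF d(1), of T 0]
    proof eventually_elim
      case (elim n)
      define h where "h = T / real (Suc n)"
      have Ee: "expectation (\<lambda>\<omega>. (norm (E n i \<omega>))\<^sup>2) \<le> \<beta>\<^sup>2 * e\<^sup>2 * h" if i: "i < Suc n" for i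
      proof -
        have "expectation (\<lambda>\<omega>. (norm (Z u \<omega> - Z (grid 0 T n i) \<omega>))\<^sup>2) \<le> e\<^sup>2"
          if u: "grid 0 T n i \<le> u" "u \<le> grid 0 T n (Suc i)" for u
          using d(2)[of u "grid 0 T n i"] gs[of i n] gs[of "Suc i" n] i u elim grid_step[of 0 T n i]
          by (intro less_imp_le d(2)) auto
        from J_local_error(2)[OF pi(1,2)[OF i] this] show ?thesis
          using grid_step[of 0 T n i] by (simp add: E_def w_def h_def)
      qed
      have "expectation (\<lambda>\<omega>. norm (Q n \<omega>)) \<le> expectation (\<lambda>\<omega>. \<Sum>i<Suc n. \<beta> / 2 * (e * (w n i \<omega>)\<^sup>2 + (norm (E n i \<omega>))\<^sup>2 / e))"
      proof (rule integral_mono)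
        show "integrable M (\<lambda>\<omega>. norm (Q n \<omega>))" by (rule integrable_norm) fact
        show "integrable M (\<lambda>\<omega>. \<Sum>i<Suc n. \<beta> / 2 * (e * (w n i \<omega>)\<^sup>2 + (norm (E n i \<omega>))\<^sup>2 / e))"
          by (rule Bochner_Integration.integrable_sum) (use w2(1) E2 in simp)
        show "norm (Q n \<omega>) \<le> (\<Sum>i<Suc n. \<beta> / 2 * (e * (w n i \<omega>)\<^sup>2 + (norm (E n i \<omega>))\<^sup>2 / e))" for \<omega>
          unfolding Q_def by (rule sum_norm_le) (rule term_le[OF e])
      qed
      also have "\<dots> = (\<Sum>i<Suc n. expectation (\<lambda>\<omega>. \<beta> / 2 * (e * (w n i \<omega>)\<^sup>2 + (norm (E n i \<omega>))\<^sup>2 / e)))"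
        by (rule Bochner_Integration.integral_sum) (use w2(1) E2 in simp)
      also have "\<dots> = (\<Sum>i<Suc n. \<beta> / 2 * (e * h + expectation (\<lambda>\<omega>. (norm (E n i \<omega>))\<^sup>2) / e))"
        by (rule sum.cong[OF refl]) (use w2 E2 in \<open>simp add: h_def\<close>)
      also have "\<dots> \<le> (\<Sum>i<Suc n. \<beta> / 2 * (e * h + \<beta>\<^sup>2 * e\<^sup>2 * h / e))"
        using e \<beta>_nonneg by (intro sum_mono mult_left_mono add_left_mono divide_right_mono Ee) auto
      also have "\<dots> = real (Suc n) * (\<beta> / 2 * (e * h + \<beta>\<^sup>2 * e\<^sup>2 * h / e))" by (simp only: sum_constant card_lessThan)
      also have "\<dots> = \<beta> / 2 * (1 + \<beta>\<^sup>2) * (real (Suc n) * h) * e"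
        using e by (simp add: field_simps power2_eq_square)
      also have "real (Suc n) * h = T" by (simp add: h_def)
      finally show ?case .
    qed
  qed
  show "(\<lambda>n. expectation (\<lambda>\<omega>. norm (Q n \<omega>))) \<longlonglongrightarrow> 0"
  proof (rule tendstoI)
    fix e :: real assume e: "e > 0"
    define k where "k = \<beta> / 2 * (1 + \<beta>\<^sup>2) * T"
    have k: "0 \<le> k" using \<beta>_nonneg T by (simp add: k_def)
    have "k * (e / (k + 1)) < e" using e k by (simp add: field_simps)
    then show "\<forall>\<^sub>F n in sequentially. dist (expectation (\<lambda>\<omega>. norm (Q n \<omega>))) 0 < e"
      using key[of "e / (k + 1)"] e k unfolding k_def[symmetric]
      by (auto elim!: eventually_mono simp: integral_nonneg_AE)
  qed
qed

section \<open>Identification of the bracket and of the Ito drift\<close>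

section \<open>The bracket and the drift\<close>

text \<open>\<open>V\<close> contains the still unknown process C, but its variation on the interval
  is finite. The increments of W become uniformly small by path continuity, and small factors
  against a bounded total variation give a vanishing sum.\<close>

lemma bracket_remainder_limit:
  assumes T: "0 \<le> T" and \<omega>: "\<omega> \<in> space M"
    and Zc: "continuous_on {0..} (\<lambda>t. b (Z t \<omega>))" and Wc: "continuous_on {0..} (\<lambda>t. W t \<omega>)"
    and fv: "finite_variation (\<lambda>t. C t \<omega>)"
  defines "V \<equiv> \<lambda>t. integral {0..t} (\<lambda>s. \<alpha> *\<^sub>R b (Z s \<omega>)) + (1/2) *\<^sub>R C t \<omega>"
  shows "(\<lambda>n. \<Sum>i<Suc n. (W (grid 0 T n (Suc i)) \<omega> - W (grid 0 T n i) \<omega>) *\<^sub>R b (V (grid 0 T n (Suc i)) - V (grid 0 T n i))) \<longlonglongrightarrow> 0"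
proof -
  obtain VC where VC: "\<And>n p. time_partition T n p \<Longrightarrow> (\<Sum>i<n. norm (C (p (Suc i)) \<omega> - C (p i) \<omega>)) \<le> VC"
    using fv T unfolding finite_variation_def by blast
  \<comment> \<open>Bounds the variation of \<open>V\<close> over any grid: the drift integral is
    Lipschitz with constant |\<alpha>| \<beta> c, and C contributes half of its own
    variation.\<close>
  define B where "B = \<bar>\<alpha>\<bar> * (\<beta> * c) * T + VC / 2"
  have VC0: "0 \<le> VC" using VC[OF time_partition_grid[OF T, of 0]] by (rule order_trans[rotated]) (simp add: sum_nonneg)
  have B0: "0 \<le> B" using VC0 T \<beta>_nonneg c_nonneg by (simp add: B_def)
  have gs: "0 \<le> grid 0 T n i" "grid 0 T n i \<le> T" if "i \<le> Suc n" for n i using grid_bounds[OF T that] by auto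
  have gm: "grid 0 T n i \<le> grid 0 T n (Suc i)" for n i using T by (auto intro: grid_mono)
  have var: "(\<Sum>i<Suc n. norm (V (grid 0 T n (Suc i)) - V (grid 0 T n i))) \<le> B" for n
  proof -
    have loc: "norm (V (grid 0 T n (Suc i)) - V (grid 0 T n i))
        \<le> \<bar>\<alpha>\<bar> * (\<beta> * c) * (T / real (Suc n)) + norm (C (grid 0 T n (Suc i)) \<omega> - C (grid 0 T n i) \<omega>) / 2"
      if i: "i < Suc n" for i
    proof -
      define p q where "p = grid 0 T n i" and "q = grid 0 T n (Suc i)"
      have pq: "0 \<le> p" "p \<le> q" "q - p = T / real (Suc n)" using gs[of i n] gm[of n i] grid_step[of 0 T n i] i by (auto simp: p_def q_def)
      have ca: "continuous_on {0..} (\<lambda>s. \<alpha> *\<^sub>R b (Z s \<omega>))" by (intro continuous_intros Zc)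
      have int: "(\<lambda>s. \<alpha> *\<^sub>R b (Z s \<omega>)) integrable_on {u..v}" if "0 \<le> u" for u v
        by (rule integrable_continuous_real[OF continuous_on_subset[OF ca]]) (use that in auto)
      have "integral {0..p} (\<lambda>s. \<alpha> *\<^sub>R b (Z s \<omega>)) + integral {p..q} (\<lambda>s. \<alpha> *\<^sub>R b (Z s \<omega>)) = integral {0..q} (\<lambda>s. \<alpha> *\<^sub>R b (Z s \<omega>))"
        by (rule Henstock_Kurzweil_Integration.integral_combine[OF pq(1,2) int]) simp
      then have eq: "V q - V p = integral {p..q} (\<lambda>s. \<alpha> *\<^sub>R b (Z s \<omega>)) + (1/2) *\<^sub>R (C q \<omega> - C p \<omega>)"
        unfolding V_def by (simp add: algebra_simps)
      have "norm (integral {p..q} (\<lambda>s. \<alpha> *\<^sub>R b (Z s \<omega>))) \<le> \<bar>\<alpha>\<bar> * (\<beta> * c) * (q - p)"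
      proof (rule integral_bound[OF pq(2)])
        show "continuous_on {p..q} (\<lambda>s. \<alpha> *\<^sub>R b (Z s \<omega>))" by (rule continuous_on_subset[OF ca]) (use pq in auto)
        show "norm (\<alpha> *\<^sub>R b (Z s \<omega>)) \<le> \<bar>\<alpha>\<bar> * (\<beta> * c)" if "s \<in> {p..q}" for s
          using bZ_norm[of s \<omega>] \<omega> that pq by (simp add: mult_left_mono)
      qed
      then show ?thesis
        using norm_triangle_ineq[of "integral {p..q} (\<lambda>s. \<alpha> *\<^sub>R b (Z s \<omega>))" "(1/2) *\<^sub>R (C q \<omega> - C p \<omega>)"]
        unfolding p_def[symmetric] q_def[symmetric] eq pq(3) by simp
    qed
    have "(\<Sum>i<Suc n. norm (V (grid 0 T n (Suc i)) - V (grid 0 T n i)))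
        \<le> (\<Sum>i<Suc n. \<bar>\<alpha>\<bar> * (\<beta> * c) * (T / real (Suc n)) + norm (C (grid 0 T n (Suc i)) \<omega> - C (grid 0 T n i) \<omega>) / 2)"
      by (rule sum_mono) (use loc in simp)
    also have "\<dots> = \<bar>\<alpha>\<bar> * (\<beta> * c) * T + (\<Sum>i<Suc n. norm (C (grid 0 T n (Suc i)) \<omega> - C (grid 0 T n i) \<omega>)) / 2"
      by (simp only: sum.distrib sum_divide_distrib sum_constant card_lessThan) simp
    also have "\<dots> \<le> B" unfolding B_def using VC[OF time_partition_grid[OF T, of n]] by (intro add_left_mono divide_right_mono) auto
    finally show ?thesis .
  qed
  show ?thesis
  proof (rule tendstoI)
    fix e :: real assume e: "e > 0"
    define k where "k = \<beta> * B"
    have k: "0 \<le> k" using \<beta>_nonneg B0 by (simp add: k_def)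
    have e': "0 < e / (k + 1)" using e k by simp
    show "\<forall>\<^sub>F n in sequentially. dist (\<Sum>i<Suc n. (W (grid 0 T n (Suc i)) \<omega> - W (grid 0 T n i) \<omega>) *\<^sub>R b (V (grid 0 T n (Suc i)) - V (grid 0 T n i))) 0 < e"
      using W_small_increments[OF T Wc e']
    proof eventually_elim
      case (elim n)
      have "norm (\<Sum>i<Suc n. (W (grid 0 T n (Suc i)) \<omega> - W (grid 0 T n i) \<omega>) *\<^sub>R b (V (grid 0 T n (Suc i)) - V (grid 0 T n i)))
          \<le> (\<Sum>i<Suc n. e / (k + 1) * (\<beta> * norm (V (grid 0 T n (Suc i)) - V (grid 0 T n i))))"
      proof (rule sum_norm_le)
        fix i assume "i \<in> {..<Suc n}"
        then have "\<bar>W (grid 0 T n (Suc i)) \<omega> - W (grid 0 T n i) \<omega>\<bar> \<le> e / (k + 1)" using elim by (auto intro: less_imp_le)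
        then show "norm ((W (grid 0 T n (Suc i)) \<omega> - W (grid 0 T n i) \<omega>) *\<^sub>R b (V (grid 0 T n (Suc i)) - V (grid 0 T n i)))
           \<le> e / (k + 1) * (\<beta> * norm (V (grid 0 T n (Suc i)) - V (grid 0 T n i)))"
          unfolding norm_scaleR using e' by (intro mult_mono b_bound) auto
      qed
      also have "\<dots> = e / (k + 1) * (\<beta> * (\<Sum>i<Suc n. norm (V (grid 0 T n (Suc i)) - V (grid 0 T n i))))"
        by (simp only: sum_distrib_left)
      also have "\<dots> \<le> e / (k + 1) * k"
        unfolding k_def by (intro mult_left_mono var \<beta>_nonneg less_imp_le[OF e'[unfolded k_def]])
      also have "\<dots> < e" using e k by (simp add: field_simps)
      finally show ?case by (simp only: dist_norm diff_zero)
    qed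
  qed
qed

text \<open>Inserting the equation into the increments of b Z turns every bracket summand into h
  times b b Z plus three errors: a centred squared increment, the freezing error of the Ito
  integral, and the increment of the finite-variation part. The first two vanish in L1 after
  summation, the third along almost every path, and a Riemann sum remains.\<close>

lemma bracket_eq:
  assumes T: "0 \<le> T"
  shows "AE \<omega> in M. C T \<omega> = integral {0..T} (\<lambda>s. b (b (Z s \<omega>)))"
proof -
  define p where "p n i = grid 0 T n i" for n i
  define w where "w n i \<omega> = W (p n (Suc i)) \<omega> - W (p n i) \<omega>" for n i \<omega>
  define h where "h n = T / real (Suc n)" for n
  define E where "E n i \<omega> = J (p n (Suc i)) \<omega> - J (p n i) \<omega> - w n i \<omega> *\<^sub>R b (Z (p n i) \<omega>)" for n i \<omega>
  define Q where "Q n \<omega> = (\<Sum>i<Suc n. w n i \<omega> *\<^sub>R b (E n i \<omega>))" for n \<omega>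
  define R where "R n \<omega> = (\<Sum>i<Suc n. ((w n i \<omega>)\<^sup>2 - h n) *\<^sub>R b (b (Z (p n i) \<omega>)))" for n \<omega>
  define X where "X n \<omega> = (\<Sum>i<Suc n. w n i \<omega> *\<^sub>R (b (Z (p n (Suc i)) \<omega>) - b (Z (p n i) \<omega>)))" for n \<omega>
  define V where "V \<omega> t = integral {0..t} (\<lambda>s. \<alpha> *\<^sub>R b (Z s \<omega>)) + (1/2) *\<^sub>R C t \<omega>" for \<omega> t
  have gs: "0 \<le> p n i" if "i \<le> Suc n" for n i using grid_bounds[OF T that] by (auto simp: p_def)
  note Q = cross_sum_L1[OF T, folded p_def, folded w_def, folded E_def, folded Q_def]
  note R = quadratic_sum_L1[OF T, folded p_def h_def, folded w_def, folded R_def]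
  have Qm: "Q n \<in> borel_measurable M" and Rm: "R n \<in> borel_measurable M" for n using Q(1)[of n] R(1)[of n] by auto
  have Xm: "X n \<in> borel_measurable M" for n
    unfolding X_def w_def
    by (intro borel_measurable_sum borel_measurable_scaleR borel_measurable_diff W_measurable
        measurable_compose[OF Z_measurable b_measurable] gs) auto
  have X: "tendsto_prob M X (C T)"
  proof -
    have "mesh_limit M T (\<lambda>n p \<omega>. \<Sum>i<n. (W (p (Suc i)) \<omega> - W (p i) \<omega>) *\<^sub>R (b (Z (p (Suc i)) \<omega>) - b (Z (p i) \<omega>))) (C T)"
      using bracket T by (simp add: has_bracket_def)
    from mesh_limit_grid[OF this T] show ?thesis by (simp only: X_def[abs_def] w_def p_def)
  qed
  \<comment> \<open>Taking away the two sums that vanish in L1 keeps the limit \<open>C T\<close> in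
    probability and leaves an expression whose limit can be computed path by path.\<close>
  define P where "P n \<omega> = X n \<omega> - Q n \<omega> - R n \<omega>" for n \<omega>
  have Pm: "P n \<in> borel_measurable M" for n unfolding P_def by (intro borel_measurable_diff Xm Qm Rm)
  have CT: "C T \<in> borel_measurable M" by (rule C_measurable[OF T])
  have "tendsto_prob M P (\<lambda>\<omega>. C T \<omega> - 0 - 0)"
    unfolding P_def
    by (intro tendsto_prob_diff borel_measurable_diff Xm Qm Rm CT X tendsto_prob_of_L1 Q R borel_measurable_const)
  then have P: "tendsto_prob M P (C T)" by simp
  obtain \<sigma> :: "nat \<Rightarrow> nat" where \<sigma>: "strict_mono \<sigma>" "AE \<omega> in M. (\<lambda>n. P (\<sigma> n) \<omega>) \<longlonglongrightarrow> C T \<omega>"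
    by (rule tendsto_prob_AE_subseq[OF Pm CT P])
  \<comment> \<open>The equation is available almost surely at each fixed time; all grids together
    have countably many points, so a single null set can be discarded.\<close>
  have eqs: "AE \<omega> in M. \<forall>n. \<forall>i. i \<le> Suc n \<longrightarrow> Z (p n i) \<omega> = z + V \<omega> (p n i) + J (p n i) \<omega>"
    unfolding AE_all_countable
  proof (intro allI)
    fix n i
    show "AE \<omega> in M. i \<le> Suc n \<longrightarrow> Z (p n i) \<omega> = z + V \<omega> (p n i) + J (p n i) \<omega>"
    proof (cases "i \<le> Suc n")
      case True
      show ?thesis using eqn[OF gs[OF True]] by eventually_elim (simp add: V_def)
    qed simp
  qed
  have fv: "AE \<omega> in M. finite_variation (\<lambda>t. C t \<omega>)" using bracket unfolding has_bracket_def by auto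
  show ?thesis
    using \<sigma>(2) eqs fv Z_continuous_b W_continuous AE_space
  proof eventually_elim
    case (elim \<omega>)
    have Peq: "P n \<omega> = (\<Sum>i<Suc n. h n *\<^sub>R b (b (Z (p n i) \<omega>))) + (\<Sum>i<Suc n. w n i \<omega> *\<^sub>R b (V \<omega> (p n (Suc i)) - V \<omega> (p n i)))" for n
    proof -
      have "w n i \<omega> *\<^sub>R (b (Z (p n (Suc i)) \<omega>) - b (Z (p n i) \<omega>)) - w n i \<omega> *\<^sub>R b (E n i \<omega>) - ((w n i \<omega>)\<^sup>2 - h n) *\<^sub>R b (b (Z (p n i) \<omega>))
        = h n *\<^sub>R b (b (Z (p n i) \<omega>)) + w n i \<omega> *\<^sub>R b (V \<omega> (p n (Suc i)) - V \<omega> (p n i))" if "i < Suc n" for i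
      proof -
        have "Z (p n (Suc i)) \<omega> - Z (p n i) \<omega> = (V \<omega> (p n (Suc i)) - V \<omega> (p n i)) + (E n i \<omega> + w n i \<omega> *\<^sub>R b (Z (p n i) \<omega>))"
          using elim(2) that by (simp add: E_def)
        then have "b (Z (p n (Suc i)) \<omega>) - b (Z (p n i) \<omega>) = b (V \<omega> (p n (Suc i)) - V \<omega> (p n i)) + (b (E n i \<omega>) + w n i \<omega> *\<^sub>R b (b (Z (p n i) \<omega>)))"
          by (simp only: b_simps flip: linear_diff[OF lin])
        then show ?thesis by (simp add: algebra_simps power2_eq_square)
      qed
      then show ?thesis unfolding P_def X_def Q_def R_def sum_subtractf[symmetric] sum.distrib[symmetric]
        by (intro sum.cong) auto
    qed
    have "continuous_on {0..T} (\<lambda>s. b (b (Z s \<omega>)))"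
      by (rule continuous_on_subset[of "{0..}"]) (use elim(4) in auto)
    from riemann_sum_limit[OF T this]
    have "(\<lambda>n. \<Sum>i<Suc n. h n *\<^sub>R b (b (Z (p n i) \<omega>))) \<longlonglongrightarrow> integral {0..T} (\<lambda>s. b (b (Z s \<omega>)))"
      by (simp add: h_def p_def grid_def del: sum.lessThan_Suc)
    moreover have "(\<lambda>n. \<Sum>i<Suc n. w n i \<omega> *\<^sub>R b (V \<omega> (p n (Suc i)) - V \<omega> (p n i))) \<longlonglongrightarrow> 0"
      unfolding w_def V_def p_def
      by (rule bracket_remainder_limit[OF T]) (use elim in auto)
    ultimately have "(\<lambda>n. P n \<omega>) \<longlonglongrightarrow> integral {0..T} (\<lambda>s. b (b (Z s \<omega>))) + 0"
      unfolding Peq by (rule tendsto_add)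
    then have "(\<lambda>n. P (\<sigma> n) \<omega>) \<longlonglongrightarrow> integral {0..T} (\<lambda>s. b (b (Z s \<omega>)))"
      using LIMSEQ_subseq_LIMSEQ[OF _ \<sigma>(1)] by (simp add: o_def)
    with elim(1) show ?case by (rule LIMSEQ_unique)
  qed
qed

text \<open>The drift of the equation in Ito form: half of the bracket computed above is the
  Stratonovich correction \<open>(1/2) *\<^sub>R b (b x)\<close>.\<close>

definition L :: "'b \<Rightarrow> 'b" where "L x = \<alpha> *\<^sub>R b x + (1/2) *\<^sub>R b (b x)"

definition \<kappa> :: real where "\<kappa> = \<bar>\<alpha>\<bar> * \<beta> + \<beta>\<^sup>2 / 2"

lemma L_linear: "linear L"
  by (rule linearI) (simp_all add: L_def b_simps algebra_simps)

lemma \<kappa>_nonneg: "0 \<le> \<kappa>" using \<beta>_nonneg by (simp add: \<kappa>_def)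

lemma L_bound: "norm (L x) \<le> \<kappa> * norm x"
proof -
  have "norm (L x) \<le> \<bar>\<alpha>\<bar> * norm (b x) + 1/2 * norm (b (b x))"
    unfolding L_def by (rule order_trans[OF norm_triangle_ineq]) simp
  also have "\<dots> \<le> \<bar>\<alpha>\<bar> * (\<beta> * norm x) + 1/2 * (\<beta> * (\<beta> * norm x))"
    by (intro add_mono mult_left_mono b_bound order_trans[OF b_bound mult_left_mono[OF b_bound \<beta>_nonneg]]) auto
  also have "\<dots> = \<kappa> * norm x" by (simp add: \<kappa>_def algebra_simps power2_eq_square)
  finally show ?thesis .
qed

lemma L_measurable: "L \<in> borel_measurable borel"
  unfolding L_def by measurable

lemma Z_increment:
  assumes st: "0 \<le> s" "s \<le> t"
  shows "AE \<omega> in M. Z t \<omega> - Z s \<omega> - (J t \<omega> - J s \<omega>) = integral {s..t} (\<lambda>u. L (Z u \<omega>))"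
proof -
  have t: "0 \<le> t" using st by simp
  show ?thesis
    using eqn[OF st(1)] eqn[OF t] bracket_eq[OF st(1)] bracket_eq[OF t] Z_continuous_b
  proof eventually_elim
    case (elim \<omega>)
    have c1: "continuous_on {0..} (\<lambda>u. b (Z u \<omega>))" and c2: "continuous_on {0..} (\<lambda>u. b (b (Z u \<omega>)))" using elim by auto
    have i1: "(\<lambda>u. \<alpha> *\<^sub>R b (Z u \<omega>)) integrable_on {0..v}" and i2: "(\<lambda>u. b (b (Z u \<omega>))) integrable_on {0..v}" for v
      by (auto intro!: integrable_continuous_real continuous_intros continuous_on_subset[OF c1] continuous_on_subset[OF c2])
    have "integral {0..v} (\<lambda>u. L (Z u \<omega>)) = integral {0..v} (\<lambda>u. \<alpha> *\<^sub>R b (Z u \<omega>)) + (1/2) *\<^sub>R integral {0..v} (\<lambda>u. b (b (Z u \<omega>)))" for v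
      unfolding L_def using i1[of v] i2[of v] by (simp add: Henstock_Kurzweil_Integration.integral_add integrable_cmul)
    moreover have "integral {0..s} (\<lambda>u. L (Z u \<omega>)) + integral {s..t} (\<lambda>u. L (Z u \<omega>)) = integral {0..t} (\<lambda>u. L (Z u \<omega>))"
      unfolding L_def by (rule Henstock_Kurzweil_Integration.integral_combine[OF st])
        (intro integrable_add i1 integrable_cmul i2)
    ultimately show ?case using elim(1-4) by (simp add: algebra_simps)
  qed
qed

text \<open>The time integral is defined path by path. Replacing it by Riemann sums lets
  expectations be taken term by term over finitely many random vectors, and Fatou returns the bound
  to the integral. The result has second moment of order \<open>(t - s)\<^sup>2 * e\<close>, hence
  mean norm of order (t - s) sqrt e.\<close>

lemma drift_error:
  assumes st: "0 \<le> s" "s \<le> t"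
    and e: "\<And>u. s \<le> u \<Longrightarrow> u \<le> t \<Longrightarrow> expectation (\<lambda>\<omega>. (norm (Z u \<omega> - Z s \<omega>))\<^sup>2) \<le> e"
  defines "D \<equiv> \<lambda>\<omega>. Z t \<omega> - Z s \<omega> - (J t \<omega> - J s \<omega>) - (t - s) *\<^sub>R L (Z s \<omega>)"
  shows "D \<in> borel_measurable M" and "integrable M (\<lambda>\<omega>. (norm (D \<omega>))\<^sup>2)"
    and "expectation (\<lambda>\<omega>. (norm (D \<omega>))\<^sup>2) \<le> (t - s)\<^sup>2 * \<kappa>\<^sup>2 * e"
proof -
  have gs: "s \<le> grid s t n i" "grid s t n i \<le> t" "0 \<le> grid s t n i" if "i \<le> Suc n" for n i
    using grid_bounds[OF st(2) that] st by auto
  define h where "h n = (t - s) / real (Suc n)" for n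
  have h: "0 \<le> h n" for n using st by (simp add: h_def)
  define X where "X n \<omega> = (\<Sum>i<Suc n. h n *\<^sub>R L (Z (grid s t n i) \<omega> - Z s \<omega>))" for n \<omega>
  have Xm: "X n \<in> borel_measurable M" for n
    unfolding X_def using st
    by (intro borel_measurable_sum borel_measurable_scaleR measurable_compose[OF _ L_measurable] borel_measurable_diff
        Z_measurable gs borel_measurable_const) auto
  show Dm: "D \<in> borel_measurable M"
    unfolding D_def using st
    by (intro borel_measurable_scaleR measurable_compose[OF _ L_measurable] borel_measurable_diff
        Z_measurable J_measurable borel_measurable_const) auto
  have lim: "AE \<omega> in M. (\<lambda>n. X n \<omega>) \<longlonglongrightarrow> D \<omega>"
    using Z_increment[OF st] Z_continuous
  proof eventually_elim
    case (elim \<omega>)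
    have cont: "continuous_on {s..t} (\<lambda>u. L (Z u \<omega>))"
      by (rule linear_continuous_on_compose[OF continuous_on_subset[OF elim(2)] L_linear]) (use st in auto)
    have "X n \<omega> = (\<Sum>i<Suc n. ((t - s) / real (Suc n)) *\<^sub>R L (Z (s + (t - s) * real i / real (Suc n)) \<omega>)) - (t - s) *\<^sub>R L (Z s \<omega>)" for n
    proof -
      have "(\<Sum>i<Suc n. h n *\<^sub>R L (Z s \<omega>)) = (t - s) *\<^sub>R L (Z s \<omega>)"
        by (simp only: sum_constant_scaleR card_lessThan scaleR_scaleR h_def) simp
      then show ?thesis
        unfolding X_def linear_diff[OF L_linear] scaleR_diff_right sum_subtractf by (simp only: h_def grid_def)
    qed
    then show ?case
      unfolding D_def elim(1) by (simp only:) (intro tendsto_diff riemann_sum_limit[OF st(2) cont] tendsto_const)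
  qed
  have Zi: "integrable M (\<lambda>\<omega>. (norm (Z u \<omega> - Z s \<omega>))\<^sup>2)" if "s \<le> u" "u \<le> t" for u
    by (rule bZ_diff_square(1)[OF _ _ e]) (use that st in auto)
  \<comment> \<open>Cauchy-Schwarz over \<open>Suc n\<close> summands. The extra factor
    \<open>Suc n\<close>, the number of summands and \<open>(h n)\<^sup>2\<close> combine to the
    squared length of the interval.\<close>
  have le: "(norm (X n \<omega>))\<^sup>2 \<le> real (Suc n) * (h n)\<^sup>2 * \<kappa>\<^sup>2 * (\<Sum>i<Suc n. (norm (Z (grid s t n i) \<omega> - Z s \<omega>))\<^sup>2)" for n \<omega>
  proof -
    have "norm (X n \<omega>) \<le> (\<Sum>i<Suc n. h n * (\<kappa> * norm (Z (grid s t n i) \<omega> - Z s \<omega>)))"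
      unfolding X_def using h[of n] by (intro sum_norm_le) (simp add: mult_left_mono L_bound)
    then have "(norm (X n \<omega>))\<^sup>2 \<le> (\<Sum>i<Suc n. h n * (\<kappa> * norm (Z (grid s t n i) \<omega> - Z s \<omega>)))\<^sup>2"
      by (rule power_mono) simp
    also have "\<dots> \<le> (\<Sum>i<Suc n. (h n * (\<kappa> * norm (Z (grid s t n i) \<omega> - Z s \<omega>)))\<^sup>2) * real (card {..<Suc n})"
      by (rule sum_squared_le_sum_of_squares)
    also have "\<dots> = real (Suc n) * (h n)\<^sup>2 * \<kappa>\<^sup>2 * (\<Sum>i<Suc n. (norm (Z (grid s t n i) \<omega> - Z s \<omega>))\<^sup>2)"
      by (simp only: power_mult_distrib sum_distrib_left sum_distrib_right card_lessThan ac_simps)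
    finally show ?thesis .
  qed
  have ri: "integrable M (\<lambda>\<omega>. real (Suc n) * (h n)\<^sup>2 * \<kappa>\<^sup>2 * (\<Sum>i<Suc n. (norm (Z (grid s t n i) \<omega> - Z s \<omega>))\<^sup>2))" for n
    by (intro integrable_mult_right Bochner_Integration.integrable_sum Zi gs) auto
  have Xi: "integrable M (\<lambda>\<omega>. (norm (X n \<omega>))\<^sup>2)" for n
    by (rule Bochner_Integration.integrable_bound[OF ri[of n]])
      (use Xm in measurable, rule AE_I2, unfold real_norm_def, rule order_trans[OF _ abs_ge_self], simp only: abs_power2 le)
  have Xe: "expectation (\<lambda>\<omega>. (norm (X n \<omega>))\<^sup>2) \<le> (t - s)\<^sup>2 * \<kappa>\<^sup>2 * e" for n
  proof -
    have "expectation (\<lambda>\<omega>. (norm (X n \<omega>))\<^sup>2) \<le> expectation (\<lambda>\<omega>. real (Suc n) * (h n)\<^sup>2 * \<kappa>\<^sup>2 * (\<Sum>i<Suc n. (norm (Z (grid s t n i) \<omega> - Z s \<omega>))\<^sup>2))"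
      by (rule integral_mono[OF Xi ri le])
    also have "\<dots> = real (Suc n) * (h n)\<^sup>2 * \<kappa>\<^sup>2 * (\<Sum>i<Suc n. expectation (\<lambda>\<omega>. (norm (Z (grid s t n i) \<omega> - Z s \<omega>))\<^sup>2))"
      by (subst integral_mult_right_zero, subst Bochner_Integration.integral_sum) (use Zi gs in auto)
    also have "\<dots> \<le> real (Suc n) * (h n)\<^sup>2 * \<kappa>\<^sup>2 * (\<Sum>i<Suc n. e)"
      by (intro mult_left_mono sum_mono e gs) auto
    also have "\<dots> = (real (Suc n) * h n)\<^sup>2 * \<kappa>\<^sup>2 * e"
      by (simp only: sum_constant card_lessThan power2_eq_square ac_simps)
    also have "real (Suc n) * h n = t - s" by (simp add: h_def)
    finally show ?thesis .
  qed
  show "integrable M (\<lambda>\<omega>. (norm (D \<omega>))\<^sup>2)"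
    by (rule AE_limit_square_bound(1)[OF Xm Dm lim Xi Xe])
  show "expectation (\<lambda>\<omega>. (norm (D \<omega>))\<^sup>2) \<le> (t - s)\<^sup>2 * \<kappa>\<^sup>2 * e"
    by (rule AE_limit_square_bound(2)[OF Xm Dm lim Xi Xe])
qed

end

section \<open>One-step expansion of the flow and conservation of the mean inner product\<close>

section \<open>Comparison with the explicit flow\<close>

text \<open>\<open>q\<close> dominates every term that is to count as higher order. For a centred
  Gaussian w of variance h = \<eta>^2 its mean is 5 \<eta>^3, so it is of order h^(3/2). Only even
  powers of w occur in it, so the known moments suffice; |w|^3 is reached as the geometric mean of
  \<eta> w^2 and w^4 / \<eta>.\<close>

lemma small_power_bounds:
  fixes w h \<eta> :: real
  assumes h: "h = \<eta>\<^sup>2" and \<eta>: "0 < \<eta>" "\<eta> \<le> 1"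
  defines "q \<equiv> \<eta> ^ 3 + \<eta> * w\<^sup>2 + w ^ 4 / \<eta>"
  shows "\<bar>w\<bar> ^ 3 \<le> q" "h * \<bar>w\<bar> \<le> q" "w ^ 4 \<le> q" "h\<^sup>2 \<le> q" "h * w\<^sup>2 \<le> q" "h ^ 3 \<le> q" "h ^ 4 \<le> q" "0 \<le> q"
proof -
  have nn: "0 \<le> \<eta> ^ 3" "0 \<le> \<eta> * w\<^sup>2" "0 \<le> w ^ 4 / \<eta>" using \<eta> by simp_all
  show q: "0 \<le> q" using nn unfolding q_def by linarith
  have "0 \<le> (sqrt \<eta> * \<bar>w\<bar> - w\<^sup>2 / sqrt \<eta>)\<^sup>2" by simp
  also have "\<dots> = \<eta> * w\<^sup>2 + w ^ 4 / \<eta> - 2 * (\<bar>w\<bar> * w\<^sup>2)"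
    using \<eta> by (simp add: power2_diff power_mult_distrib power_divide)
  also have "\<bar>w\<bar> * w\<^sup>2 = \<bar>w\<bar> ^ 3"
    by (simp add: power2_eq_square power3_eq_cube)
  finally show "\<bar>w\<bar> ^ 3 \<le> q" using nn zero_le_power[OF abs_ge_zero[of w], of 3] unfolding q_def by linarith
  have "0 \<le> \<eta> * (\<eta> - \<bar>w\<bar>)\<^sup>2" using \<eta> by simp
  also have "\<dots> = \<eta> ^ 3 + \<eta> * w\<^sup>2 - 2 * (h * \<bar>w\<bar>)"
    unfolding power2_diff by (simp add: h power2_eq_square power3_eq_cube algebra_simps)
  finally have "2 * (h * \<bar>w\<bar>) \<le> \<eta> ^ 3 + \<eta> * w\<^sup>2" by linarith
  moreover have "0 \<le> h * \<bar>w\<bar>" by (simp add: h)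
  ultimately show "h * \<bar>w\<bar> \<le> q" using nn unfolding q_def by linarith
  have "w ^ 4 \<le> w ^ 4 / \<eta>" using \<eta> by (simp add: pos_le_divide_eq mult_left_le)
  then show "w ^ 4 \<le> q" using nn unfolding q_def by linarith
  have pw: "\<eta> ^ k \<le> \<eta> ^ 3" if "3 \<le> k" for k using \<eta> that by (intro power_decreasing) auto
  have hk: "h ^ k = \<eta> ^ (2 * k)" for k by (simp add: h power_mult)
  show "h\<^sup>2 \<le> q" "h ^ 3 \<le> q" "h ^ 4 \<le> q"
    unfolding hk q_def using pw[of "2 * 2"] pw[of "2 * 3"] pw[of "2 * 4"] nn by linarith+
  have "h \<le> \<eta>" using \<eta> by (simp add: h power2_eq_square mult_left_le)
  then have "h * w\<^sup>2 \<le> \<eta> * w\<^sup>2" by (rule mult_right_mono) simp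
  then show "h * w\<^sup>2 \<le> q" using nn unfolding q_def by linarith
qed

lemma power_add_bounds:
  fixes a b :: real
  shows "(a + b)\<^sup>2 \<le> 2 * a\<^sup>2 + 2 * b\<^sup>2" "\<bar>a + b\<bar> ^ 3 \<le> 4 * \<bar>a\<bar> ^ 3 + 4 * \<bar>b\<bar> ^ 3" "(a + b) ^ 4 \<le> 8 * a ^ 4 + 8 * b ^ 4"
proof -
  show 2: "(a + b)\<^sup>2 \<le> 2 * a\<^sup>2 + 2 * b\<^sup>2" for a b :: real
    using zero_le_power2[of "a - b"] unfolding power2_diff power2_sum by linarith
  have "(a + b) ^ 4 = ((a + b)\<^sup>2)\<^sup>2" by simp
  also have "\<dots> \<le> (2 * a\<^sup>2 + 2 * b\<^sup>2)\<^sup>2" by (rule power_mono[OF 2]) simp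
  also have "\<dots> \<le> 2 * (2 * a\<^sup>2)\<^sup>2 + 2 * (2 * b\<^sup>2)\<^sup>2" by (rule 2)
  also have "\<dots> = 8 * a ^ 4 + 8 * b ^ 4" by (simp add: power_mult_distrib)
  finally show "(a + b) ^ 4 \<le> 8 * a ^ 4 + 8 * b ^ 4" .
  define x y where "x = \<bar>a\<bar>" and "y = \<bar>b\<bar>"
  have xy: "0 \<le> x" "0 \<le> y" by (simp_all add: x_def y_def)
  have "0 \<le> (x + y) * (x - y)\<^sup>2" using xy by simp
  also have "(x + y) * (x - y)\<^sup>2 = x ^ 3 + y ^ 3 - (x * x * y + x * y * y)"
    by (simp add: power2_eq_square power3_eq_cube algebra_simps)
  finally have "(x + y) ^ 3 \<le> 4 * x ^ 3 + 4 * y ^ 3"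
    by (simp add: power3_eq_cube algebra_simps)
  moreover have "\<bar>a + b\<bar> ^ 3 \<le> (x + y) ^ 3" by (intro power_mono) (auto simp: x_def y_def)
  ultimately show "\<bar>a + b\<bar> ^ 3 \<le> 4 * \<bar>a\<bar> ^ 3 + 4 * \<bar>b\<bar> ^ 3" unfolding x_def y_def by linarith
qed

context linear_sde
begin

definition \<phi> :: "real \<Rightarrow> 'w \<Rightarrow> 'b" where
  "\<phi> t \<omega> = rot (cis (r * (\<alpha> * t + W t \<omega>))) z"

lemma \<phi>_norm: "norm (\<phi> t \<omega>) = c"
  by (simp add: \<phi>_def norm_rot z_norm)

lemma \<phi>_measurable_F: "0 \<le> t \<Longrightarrow> \<phi> t \<in> borel_measurable (F t)"
proof -
  assume t: "0 \<le> t"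
  have "W t \<in> borel_measurable (F t)" by (rule W_measurable_F[OF t order_refl])
  moreover have "(\<lambda>x. rot (cis (r * (\<alpha> * t + x))) z) \<in> borel_measurable borel"
    unfolding rot_def cis.sel by measurable
  ultimately have "(\<lambda>\<omega>. rot (cis (r * (\<alpha> * t + W t \<omega>))) z) \<in> borel_measurable (F t)"
    by (rule measurable_compose)
  then show ?thesis by (simp add: \<phi>_def[abs_def])
qed

lemma \<phi>_measurable: "0 \<le> t \<Longrightarrow> \<phi> t \<in> borel_measurable M"
  by (rule measurable_F_M[OF \<phi>_measurable_F])

lemma \<phi>_step: "\<phi> t \<omega> = rot (cis (r * (\<alpha> * (t - s) + (W t \<omega> - W s \<omega>)))) (\<phi> s \<omega>)"
  by (simp add: \<phi>_def rot_rot cis_mult algebra_simps)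

definition k1 :: real where "k1 = (r * \<beta> + \<beta>\<^sup>2) * (2 * \<alpha>\<^sup>2 + 2) * c + \<bar>\<alpha>\<bar> * \<beta> * c"

definition k2 :: real where
  "k2 = (r\<^sup>2 * \<beta> * (4 * \<bar>\<alpha>\<bar> ^ 3 + 4) + r\<^sup>2 * \<beta>\<^sup>2 * (8 * \<alpha> ^ 4 + 8)) * c + (\<bar>\<alpha>\<bar> + \<alpha>\<^sup>2 / 2) * (\<beta> * (\<beta> * c))"

lemma k1_nonneg: "0 \<le> k1" and k2_nonneg: "0 \<le> k2"
  using r_pos \<beta>_nonneg c_nonneg by (simp_all add: k1_def k2_def)

text \<open>Taylor expansion of the rotation at \<theta> = \<alpha> h + w, sorted by order with w
  counted as sqrt h. The numerical factors in \<open>k1\<close> and \<open>k2\<close> come from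
  splitting powers of \<theta> by \<open>power_add_bounds\<close>, the terms with |\<alpha>| from
  drift contributions moved into the error.\<close>

lemma flow_expansion:
  fixes w h \<eta> :: real
  assumes h: "h = \<eta>\<^sup>2" and \<eta>: "0 < \<eta>" "\<eta> \<le> 1" and x: "norm x = c"
  defines "q \<equiv> \<eta> ^ 3 + \<eta> * w\<^sup>2 + w ^ 4 / \<eta>"
  defines "\<Delta> \<equiv> rot (cis (r * (\<alpha> * h + w))) x - x"
  shows "norm (\<Delta> - w *\<^sub>R b x) \<le> k1 * (h + w\<^sup>2)"
    and "norm (\<Delta> - w *\<^sub>R b x - (\<alpha> * h) *\<^sub>R b x - (w\<^sup>2 / 2) *\<^sub>R b (b x)) \<le> k2 * q"
proof -
  note q = small_power_bounds[OF h \<eta>, of w, folded q_def]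
  have h1: "0 \<le> h" "h \<le> 1" using \<eta> by (auto simp: h power_le_one)
  have bx: "norm (b x) \<le> \<beta> * c" and bbx: "norm (b (b x)) \<le> \<beta> * (\<beta> * c)"
    using b_bound[of x] order_trans[OF b_bound[of "b x"] mult_left_mono[OF b_bound[of x] \<beta>_nonneg]] x by auto
  define \<theta> where "\<theta> = \<alpha> * h + w"
  have "h\<^sup>2 \<le> h" using h1 by (simp add: power2_eq_square mult_left_le)
  then have "\<alpha>\<^sup>2 * h\<^sup>2 \<le> \<alpha>\<^sup>2 * h" by (rule mult_left_mono) simp
  moreover have "0 \<le> \<alpha>\<^sup>2 * w\<^sup>2" "0 \<le> w\<^sup>2" "0 \<le> \<alpha>\<^sup>2 * h" using h1 by simp_all
  ultimately have t2: "\<theta>\<^sup>2 \<le> (2 * \<alpha>\<^sup>2 + 2) * (h + w\<^sup>2)"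
    using power_add_bounds(1)[of "\<alpha> * h" w] h1 unfolding \<theta>_def power_mult_distrib distrib_left distrib_right by linarith
  have t3: "\<bar>\<theta>\<bar> ^ 3 \<le> (4 * \<bar>\<alpha>\<bar> ^ 3 + 4) * q"
  proof -
    have "\<bar>\<alpha>\<bar> ^ 3 * h ^ 3 \<le> \<bar>\<alpha>\<bar> ^ 3 * q" by (rule mult_left_mono[OF q(6)]) simp
    then show ?thesis
      using power_add_bounds(2)[of "\<alpha> * h" w] q(1) h1
      unfolding \<theta>_def abs_mult power_mult_distrib distrib_right by simp
  qed
  have t4: "\<theta> ^ 4 \<le> (8 * \<alpha> ^ 4 + 8) * q"
  proof -
    have "\<alpha> ^ 4 * h ^ 4 \<le> \<alpha> ^ 4 * q" by (rule mult_left_mono[OF q(7)]) simp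
    then show ?thesis
      using power_add_bounds(3)[of "\<alpha> * h" w] q(3)
      unfolding \<theta>_def power_mult_distrib distrib_right by simp
  qed
  have "\<Delta> - w *\<^sub>R b x = (\<Delta> - \<theta> *\<^sub>R b x) + (\<alpha> * h) *\<^sub>R b x" by (simp add: \<theta>_def algebra_simps)
  also have "norm \<dots> \<le> (r * \<beta> + \<beta>\<^sup>2) * \<theta>\<^sup>2 * norm x + \<bar>\<alpha>\<bar> * h * norm (b x)"
    using norm_triangle_ineq[of "\<Delta> - \<theta> *\<^sub>R b x" "(\<alpha> * h) *\<^sub>R b x"] rot_taylor1[of \<theta> x] h1
    unfolding \<Delta>_def \<theta>_def by (simp add: abs_mult)
  also have "\<dots> \<le> (r * \<beta> + \<beta>\<^sup>2) * ((2 * \<alpha>\<^sup>2 + 2) * (h + w\<^sup>2)) * c + \<bar>\<alpha>\<bar> * (h + w\<^sup>2) * (\<beta> * c)"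
    unfolding x using r_pos \<beta>_nonneg c_nonneg h1
    by (intro add_mono mult_mono t2 bx order_refl mult_nonneg_nonneg add_nonneg_nonneg) auto
  also have "\<dots> = k1 * (h + w\<^sup>2)" by (simp add: k1_def algebra_simps)
  finally show "norm (\<Delta> - w *\<^sub>R b x) \<le> k1 * (h + w\<^sup>2)" .
  \<comment> \<open>In the quadratic term \<theta>^2 is replaced by w^2. The difference 2 \<alpha> h
    w + \<alpha>^2 h^2 is of order h^(3/2) and is absorbed by \<open>q\<close>.\<close>
  have "\<Delta> - w *\<^sub>R b x - (\<alpha> * h) *\<^sub>R b x - (w\<^sup>2 / 2) *\<^sub>R b (b x)
    = (\<Delta> - \<theta> *\<^sub>R b x - (\<theta>\<^sup>2 / 2) *\<^sub>R b (b x)) + ((\<theta>\<^sup>2 - w\<^sup>2) / 2) *\<^sub>R b (b x)"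
    by (simp add: \<theta>_def algebra_simps diff_divide_distrib)
  also have "norm \<dots> \<le> (r\<^sup>2 * \<beta> * \<bar>\<theta>\<bar> ^ 3 + r\<^sup>2 * \<beta>\<^sup>2 * \<theta> ^ 4) * norm x + \<bar>\<theta>\<^sup>2 - w\<^sup>2\<bar> / 2 * norm (b (b x))"
    using norm_triangle_ineq[of "\<Delta> - \<theta> *\<^sub>R b x - (\<theta>\<^sup>2 / 2) *\<^sub>R b (b x)" "((\<theta>\<^sup>2 - w\<^sup>2) / 2) *\<^sub>R b (b x)"] rot_taylor2[of \<theta> x]
    unfolding \<Delta>_def \<theta>_def by simp
  also have "\<bar>\<theta>\<^sup>2 - w\<^sup>2\<bar> / 2 \<le> (\<bar>\<alpha>\<bar> + \<alpha>\<^sup>2 / 2) * q"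
  proof -
    have "\<theta>\<^sup>2 - w\<^sup>2 = 2 * \<alpha> * (h * w) + \<alpha>\<^sup>2 * h\<^sup>2" by (simp add: \<theta>_def power2_sum power_mult_distrib)
    then have "\<bar>\<theta>\<^sup>2 - w\<^sup>2\<bar> \<le> \<bar>2 * \<alpha> * (h * w)\<bar> + \<bar>\<alpha>\<^sup>2 * h\<^sup>2\<bar>" by (simp only: abs_triangle_ineq)
    also have "\<dots> = 2 * (\<bar>\<alpha>\<bar> * (h * \<bar>w\<bar>)) + \<alpha>\<^sup>2 * h\<^sup>2" using h1 by (simp add: abs_mult)
    also have "\<dots> \<le> 2 * (\<bar>\<alpha>\<bar> * q) + \<alpha>\<^sup>2 * q"
      by (intro add_mono mult_left_mono q) auto
    finally show ?thesis by (simp add: algebra_simps)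
  qed
  also have "(r\<^sup>2 * \<beta> * \<bar>\<theta>\<bar> ^ 3 + r\<^sup>2 * \<beta>\<^sup>2 * \<theta> ^ 4) * norm x + (\<bar>\<alpha>\<bar> + \<alpha>\<^sup>2 / 2) * q * norm (b (b x))
     \<le> (r\<^sup>2 * \<beta> * ((4 * \<bar>\<alpha>\<bar> ^ 3 + 4) * q) + r\<^sup>2 * \<beta>\<^sup>2 * ((8 * \<alpha> ^ 4 + 8) * q)) * c + (\<bar>\<alpha>\<bar> + \<alpha>\<^sup>2 / 2) * q * (\<beta> * (\<beta> * c))"
    unfolding x using r_pos \<beta>_nonneg c_nonneg q(8)
    by (intro add_mono mult_right_mono mult_left_mono t3 t4 bbx mult_nonneg_nonneg add_nonneg_nonneg) auto
  also have "\<dots> = k2 * q" by (simp add: k2_def algebra_simps)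
  finally show "norm (\<Delta> - w *\<^sub>R b x - (\<alpha> * h) *\<^sub>R b x - (w\<^sup>2 / 2) *\<^sub>R b (b x)) \<le> k2 * q"
    by (simp add: mult_right_mono)
qed

end

context prob_space
begin

lemma integrable_inner_bounded:
  fixes X Y :: "'a \<Rightarrow> 'b::euclidean_space"
  assumes X: "integrable M X" and Y: "Y \<in> borel_measurable M" and b: "\<And>\<omega>. \<omega> \<in> space M \<Longrightarrow> norm (Y \<omega>) \<le> d"
  shows "integrable M (\<lambda>\<omega>. X \<omega> \<bullet> Y \<omega>)"
proof (rule Bochner_Integration.integrable_bound[where f="\<lambda>\<omega>. d * norm (X \<omega>)"])
  show "integrable M (\<lambda>\<omega>. d * norm (X \<omega>))" using X by simp
  show "(\<lambda>\<omega>. X \<omega> \<bullet> Y \<omega>) \<in> borel_measurable M"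
    using borel_measurable_integrable[OF X] Y by (rule borel_measurable_inner)
  show "AE \<omega> in M. norm (X \<omega> \<bullet> Y \<omega>) \<le> norm (d * norm (X \<omega>))"
  proof (rule AE_I2)
    fix \<omega> assume "\<omega> \<in> space M"
    then have "norm (X \<omega>) * norm (Y \<omega>) \<le> norm (X \<omega>) * d" using b by (intro mult_left_mono) auto
    then show "norm (X \<omega> \<bullet> Y \<omega>) \<le> norm (d * norm (X \<omega>))"
      using Cauchy_Schwarz_ineq2[of "X \<omega>" "Y \<omega>"] abs_ge_self[of "d * norm (X \<omega>)"]
      by (simp add: mult.commute)
  qed
qed

end

context linear_sde
begin

text \<open>Both vectors have norm c, so the mean squared distance is 2 c^2 minus twice this number;
  it vanishes exactly when the overlap has its maximal value c^2.\<close>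

definition overlap :: "real \<Rightarrow> real" where "overlap t = expectation (\<lambda>\<omega>. Z t \<omega> \<bullet> \<phi> t \<omega>)"

definition k3 :: real where "k3 = c * k2 + \<kappa> * c * (\<beta> * c + 2 * k1) + 2 * \<beta> * c * k1"

text \<open>Coefficients of the mean of the majorant in \<open>overlap_step\<close>: 3 c \<kappa>
  from the drift error, \<beta>^2 / 2 and \<beta>^2 c^2 from the two sides of Young's inequality, 8
  = 2 (1 + 3) from h^2 and the fourth moment 3 h^2, and 5 from the mean of the higher-order
  term.\<close>

definition k4 :: real where "k4 = 3 * c * \<kappa> + \<beta>\<^sup>2 / 2 + \<beta>\<^sup>2 * c\<^sup>2 + 8 * k1\<^sup>2 + 5 * k3"

lemma k3_nonneg: "0 \<le> k3" and k4_nonneg: "0 \<le> k4"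
  using \<beta>_nonneg c_nonneg \<kappa>_nonneg k1_nonneg k2_nonneg by (simp_all add: k3_def k4_def)

text \<open>A product rule for one step. Skewness cancels the two drift terms with \<alpha> and
  merges the second-order terms -w^2/2, -h/2 and w^2 into (w^2 - h)/2. The subtracted bracket
  consists of terms with mean zero given the past, and the right-hand side is small.\<close>

lemma remainder_identity:
  fixes x y E1 E2 E3 :: 'b and w h :: real
  assumes dJ: "dJ = E2 + w *\<^sub>R b x" and dx: "dx = h *\<^sub>R L x + E1 + dJ"
    and dy: "dy = w *\<^sub>R b y + (\<alpha> * h) *\<^sub>R b y + (w\<^sup>2 / 2) *\<^sub>R b (b y) + E3"
  shows "(x + dx) \<bullet> (y + dy) - x \<bullet> y - (dJ \<bullet> y + w * (x \<bullet> b y) + (w\<^sup>2 - h) / 2 * (b x \<bullet> b y))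
    = E1 \<bullet> y + x \<bullet> E3 + h * (L x \<bullet> dy) + E1 \<bullet> dy + E2 \<bullet> dy + w * (b x \<bullet> (dy - w *\<^sub>R b y))"
proof -
  have s1: "b x \<bullet> y = - (x \<bullet> b y)" and s2: "b (b x) \<bullet> y = - (b x \<bullet> b y)" and s3: "x \<bullet> b (b y) = - (b x \<bullet> b y)"
    using skew[of x y] skew[of "b x" y] skew[of x "b y"] by auto
  have Lxy: "L x \<bullet> y = - \<alpha> * (x \<bullet> b y) - 1/2 * (b x \<bullet> b y)"
    by (simp add: L_def inner_add_left s1 s2)
  have 1: "x \<bullet> dy = w * (x \<bullet> b y) + \<alpha> * h * (x \<bullet> b y) - w\<^sup>2 / 2 * (b x \<bullet> b y) + x \<bullet> E3"
    unfolding dy by (simp add: inner_add_right s3)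
  have 2: "dx \<bullet> y = h * (L x \<bullet> y) + E1 \<bullet> y + dJ \<bullet> y"
    unfolding dx by (simp add: inner_add_left)
  have 3: "dx \<bullet> dy = h * (L x \<bullet> dy) + E1 \<bullet> dy + E2 \<bullet> dy + w * (b x \<bullet> dy)"
    unfolding dx dJ by (simp add: inner_add_left)
  have 4: "b x \<bullet> dy = w * (b x \<bullet> b y) + b x \<bullet> (dy - w *\<^sub>R b y)"
    by (simp add: inner_diff_right)
  have "(x + dx) \<bullet> (y + dy) - x \<bullet> y = x \<bullet> dy + dx \<bullet> y + dx \<bullet> dy"
    by (simp add: inner_add_left inner_add_right)
  also have "\<dots> = (w * (x \<bullet> b y) + \<alpha> * h * (x \<bullet> b y) - w\<^sup>2 / 2 * (b x \<bullet> b y) + x \<bullet> E3)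
      + (h * (- \<alpha> * (x \<bullet> b y) - 1/2 * (b x \<bullet> b y)) + E1 \<bullet> y + dJ \<bullet> y)
      + (h * (L x \<bullet> dy) + E1 \<bullet> dy + E2 \<bullet> dy + w * (w * (b x \<bullet> b y) + b x \<bullet> (dy - w *\<^sub>R b y)))"
    by (simp only: 1 2 3 4 Lxy)
  finally show ?thesis by (simp add: algebra_simps power2_eq_square diff_divide_distrib)
qed

text \<open>The Ito error \<open>E2\<close> is only known to be small in mean square, so it is kept
  as a square; the drift error \<open>E1\<close> appears linearly, and everything else is of order
  h^(3/2) or carries the factor \<epsilon>.\<close>

lemma remainder_bound:
  fixes x y E1 E2 E3 dy :: 'b and w h \<eta> \<epsilon> :: real
  assumes h: "h = \<eta>\<^sup>2" and \<eta>: "0 < \<eta>" "\<eta> \<le> 1" and \<epsilon>: "0 < \<epsilon>"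
    and x: "norm x = c" and y: "norm y = c" and dy: "y + dy = rot (cis (r * (\<alpha> * h + w))) y"
    and E3: "dy = w *\<^sub>R b y + (\<alpha> * h) *\<^sub>R b y + (w\<^sup>2 / 2) *\<^sub>R b (b y) + E3"
  shows "\<bar>E1 \<bullet> y + x \<bullet> E3 + h * (L x \<bullet> dy) + E1 \<bullet> dy + E2 \<bullet> dy + w * (b x \<bullet> (dy - w *\<^sub>R b y))\<bar>
    \<le> 3 * c * norm E1 + (norm E2)\<^sup>2 / (2 * \<epsilon>) + \<epsilon> * (\<beta>\<^sup>2 * c\<^sup>2 * w\<^sup>2 + 2 * k1\<^sup>2 * (h\<^sup>2 + w ^ 4))
      + k3 * (\<eta> ^ 3 + \<eta> * w\<^sup>2 + w ^ 4 / \<eta>)"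
proof -
  define q where "q = \<eta> ^ 3 + \<eta> * w\<^sup>2 + w ^ 4 / \<eta>"
  note q = small_power_bounds[OF h \<eta>, of w, folded q_def]
  have h0: "0 \<le> h" by (simp add: h)
  have dy': "dy = rot (cis (r * (\<alpha> * h + w))) y - y" using dy by (simp add: eq_diff_eq add.commute)
  have E3': "E3 = dy - w *\<^sub>R b y - (\<alpha> * h) *\<^sub>R b y - (w\<^sup>2 / 2) *\<^sub>R b (b y)" using E3 by (simp add: algebra_simps)
  have f1: "norm (dy - w *\<^sub>R b y) \<le> k1 * (h + w\<^sup>2)"
    using flow_expansion(1)[OF h \<eta> y, of w] unfolding dy' .
  have f2: "norm E3 \<le> k2 * q"
    using flow_expansion(2)[OF h \<eta> y, of w] unfolding E3' dy' q_def .
  have dyc: "norm dy \<le> 2 * c"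
    using norm_triangle_ineq4[of "rot (cis (r * (\<alpha> * h + w))) y" y] y by (simp add: dy' norm_rot)
  have by': "norm (w *\<^sub>R b y) \<le> \<bar>w\<bar> * (\<beta> * c)" using b_bound[of y] y by (simp add: mult_left_mono)
  have dyw: "norm dy \<le> \<bar>w\<bar> * (\<beta> * c) + k1 * (h + w\<^sup>2)"
    using norm_triangle_ineq[of "w *\<^sub>R b y" "dy - w *\<^sub>R b y"] by' f1 by simp
  have dy2: "(norm dy)\<^sup>2 \<le> 2 * (\<beta>\<^sup>2 * c\<^sup>2 * w\<^sup>2) + 4 * k1\<^sup>2 * (h\<^sup>2 + w ^ 4)"
  proof -
    have "(norm dy)\<^sup>2 \<le> (\<bar>w\<bar> * (\<beta> * c) + k1 * (h + w\<^sup>2))\<^sup>2" by (rule power_mono[OF dyw]) simp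
    also have "\<dots> \<le> 2 * (\<bar>w\<bar> * (\<beta> * c))\<^sup>2 + 2 * (k1 * (h + w\<^sup>2))\<^sup>2" by (rule power_add_bounds)
    also have "\<dots> = 2 * (\<beta>\<^sup>2 * c\<^sup>2 * w\<^sup>2) + 2 * k1\<^sup>2 * (h + w\<^sup>2)\<^sup>2" by (simp add: power_mult_distrib)
    also have "\<dots> \<le> 2 * (\<beta>\<^sup>2 * c\<^sup>2 * w\<^sup>2) + 2 * k1\<^sup>2 * (2 * h\<^sup>2 + 2 * (w\<^sup>2)\<^sup>2)"
      by (intro add_left_mono mult_left_mono power_add_bounds) simp
    also have "\<dots> = 2 * (\<beta>\<^sup>2 * c\<^sup>2 * w\<^sup>2) + 4 * k1\<^sup>2 * (h\<^sup>2 + w ^ 4)" by (simp add: algebra_simps)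
    finally show ?thesis .
  qed
  have t1: "\<bar>E1 \<bullet> y\<bar> \<le> c * norm E1"
    using Cauchy_Schwarz_ineq2[of E1 y] y by (simp add: mult.commute)
  have t4: "\<bar>E1 \<bullet> dy\<bar> \<le> 2 * c * norm E1"
    using Cauchy_Schwarz_ineq2[of E1 dy] mult_left_mono[OF dyc norm_ge_zero[of E1]] by (simp add: ac_simps)
  have t2: "\<bar>x \<bullet> E3\<bar> \<le> c * k2 * q"
    using Cauchy_Schwarz_ineq2[of x E3] mult_left_mono[OF f2 c_nonneg] x by (simp add: ac_simps)
  have t3: "\<bar>h * (L x \<bullet> dy)\<bar> \<le> \<kappa> * c * (\<beta> * c + 2 * k1) * q"
  proof -
    have "h * norm dy \<le> \<beta> * c * (h * \<bar>w\<bar>) + k1 * (h\<^sup>2 + h * w\<^sup>2)"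
      using mult_left_mono[OF dyw h0] by (simp add: algebra_simps power2_eq_square)
    also have "\<dots> \<le> \<beta> * c * q + k1 * (q + q)"
      using \<beta>_nonneg c_nonneg k1_nonneg by (intro add_mono mult_left_mono q) auto
    finally have hd: "h * norm dy \<le> (\<beta> * c + 2 * k1) * q" by (simp add: algebra_simps)
    have "\<bar>h * (L x \<bullet> dy)\<bar> \<le> h * (norm (L x) * norm dy)"
      using h0 by (simp add: abs_mult mult_left_mono Cauchy_Schwarz_ineq2)
    also have "\<dots> = norm (L x) * (h * norm dy)" by simp
    also have "\<dots> \<le> (\<kappa> * c) * ((\<beta> * c + 2 * k1) * q)"
      using L_bound[of x] x h0 \<kappa>_nonneg c_nonneg by (intro mult_mono hd) auto
    finally show ?thesis by (simp add: ac_simps)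
  qed
  \<comment> \<open>Young's inequality with weight \<epsilon>. In \<open>overlap_step\<close> the
    second moment of \<open>E2\<close> is at most \<beta>^2 \<epsilon>^2 h, so dividing by 2
    \<epsilon> still leaves a factor \<epsilon> in front of h.\<close>
  have t5: "\<bar>E2 \<bullet> dy\<bar> \<le> (norm E2)\<^sup>2 / (2 * \<epsilon>) + \<epsilon> * (\<beta>\<^sup>2 * c\<^sup>2 * w\<^sup>2 + 2 * k1\<^sup>2 * (h\<^sup>2 + w ^ 4))"
  proof -
    have "0 \<le> (norm E2 / sqrt \<epsilon> - sqrt \<epsilon> * norm dy)\<^sup>2" by simp
    also have "\<dots> = (norm E2)\<^sup>2 / \<epsilon> + \<epsilon> * (norm dy)\<^sup>2 - 2 * (norm E2 * norm dy)"
      using \<epsilon> by (simp add: power2_diff power_mult_distrib power_divide)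
    finally have "norm E2 * norm dy \<le> (norm E2)\<^sup>2 / (2 * \<epsilon>) + \<epsilon> * (norm dy)\<^sup>2 / 2" by simp
    also have "\<epsilon> * (norm dy)\<^sup>2 / 2 \<le> \<epsilon> * (2 * (\<beta>\<^sup>2 * c\<^sup>2 * w\<^sup>2) + 4 * k1\<^sup>2 * (h\<^sup>2 + w ^ 4)) / 2"
      using \<epsilon> by (intro divide_right_mono mult_left_mono dy2) auto
    also have "\<dots> = \<epsilon> * (\<beta>\<^sup>2 * c\<^sup>2 * w\<^sup>2 + 2 * k1\<^sup>2 * (h\<^sup>2 + w ^ 4))" by (simp add: algebra_simps)
    finally show ?thesis using Cauchy_Schwarz_ineq2[of E2 dy] by simp
  qed
  have t6: "\<bar>w * (b x \<bullet> (dy - w *\<^sub>R b y))\<bar> \<le> 2 * \<beta> * c * k1 * q"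
  proof -
    have "\<bar>w * (b x \<bullet> (dy - w *\<^sub>R b y))\<bar> \<le> \<bar>w\<bar> * (norm (b x) * norm (dy - w *\<^sub>R b y))"
      unfolding abs_mult by (intro mult_left_mono Cauchy_Schwarz_ineq2) simp
    also have "\<dots> \<le> \<bar>w\<bar> * ((\<beta> * c) * (k1 * (h + w\<^sup>2)))"
      using b_bound[of x] x \<beta>_nonneg c_nonneg by (intro mult_left_mono mult_mono f1) auto
    also have "\<dots> = \<beta> * c * k1 * (h * \<bar>w\<bar> + \<bar>w\<bar> ^ 3)"
      by (simp add: algebra_simps power2_eq_square power3_eq_cube)
    also have "\<dots> \<le> \<beta> * c * k1 * (q + q)"
      using \<beta>_nonneg c_nonneg k1_nonneg by (intro mult_left_mono add_mono q) auto
    finally show ?thesis by (simp add: ac_simps)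
  qed
  have tri: "\<bar>a1 + a2 + a3 + a4 + a5 + a6\<bar> \<le> \<bar>a1\<bar> + \<bar>a2\<bar> + \<bar>a3\<bar> + \<bar>a4\<bar> + \<bar>a5\<bar> + \<bar>a6\<bar>" for a1 a2 a3 a4 a5 a6 :: real
    by linarith
  have "\<bar>E1 \<bullet> y + x \<bullet> E3 + h * (L x \<bullet> dy) + E1 \<bullet> dy + E2 \<bullet> dy + w * (b x \<bullet> (dy - w *\<^sub>R b y))\<bar>
    \<le> c * norm E1 + c * k2 * q + \<kappa> * c * (\<beta> * c + 2 * k1) * q + 2 * c * norm E1
      + ((norm E2)\<^sup>2 / (2 * \<epsilon>) + \<epsilon> * (\<beta>\<^sup>2 * c\<^sup>2 * w\<^sup>2 + 2 * k1\<^sup>2 * (h\<^sup>2 + w ^ 4))) + 2 * \<beta> * c * k1 * q"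
    by (rule order_trans[OF tri]) (intro add_mono t1 t2 t3 t4 t5 t6)
  also have "\<dots> = 3 * c * norm E1 + (norm E2)\<^sup>2 / (2 * \<epsilon>) + \<epsilon> * (\<beta>\<^sup>2 * c\<^sup>2 * w\<^sup>2 + 2 * k1\<^sup>2 * (h\<^sup>2 + w ^ 4))
      + (c * k2 * q + \<kappa> * c * (\<beta> * c + 2 * k1) * q + 2 * \<beta> * c * k1 * q)"
    by simp
  also have "c * k2 * q + \<kappa> * c * (\<beta> * c + 2 * k1) * q + 2 * \<beta> * c * k1 * q = k3 * q"
    by (simp add: k3_def algebra_simps)
  finally show ?thesis unfolding q_def .
qed

text \<open>The parts with mean zero given time \<open>s\<close> are collected in \<open>U\<close>,
  and the rest is dominated by \<open>G\<close>, whose mean is of order h (\<epsilon> + sqrt h). The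
  change of the overlap is thus o(h) as the modulus \<epsilon> and h shrink.\<close>

lemma overlap_step:
  assumes s: "0 \<le> s" and st: "s < t" "t - s \<le> 1" and \<epsilon>: "0 < \<epsilon>"
    and e: "\<And>u. s \<le> u \<Longrightarrow> u \<le> t \<Longrightarrow> expectation (\<lambda>\<omega>. (norm (Z u \<omega> - Z s \<omega>))\<^sup>2) \<le> \<epsilon>\<^sup>2"
  shows "\<bar>overlap t - overlap s\<bar> \<le> k4 * (t - s) * (\<epsilon> + sqrt (t - s))"
proof -
  define h \<eta> where "h = t - s" and "\<eta> = sqrt h"
  have h: "h = \<eta>\<^sup>2" "0 < h" "h \<le> 1" using st by (simp_all add: h_def \<eta>_def)
  have \<eta>: "0 < \<eta>" "\<eta> \<le> 1" using h by (auto simp: \<eta>_def)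
  have s0: "0 \<le> s" and st0: "s \<le> t" and t0: "0 \<le> t" using s st by auto
  define w where "w \<omega> = W t \<omega> - W s \<omega>" for \<omega>
  define E1 where "E1 \<omega> = Z t \<omega> - Z s \<omega> - (J t \<omega> - J s \<omega>) - h *\<^sub>R L (Z s \<omega>)" for \<omega>
  define E2 where "E2 \<omega> = J t \<omega> - J s \<omega> - w \<omega> *\<^sub>R b (Z s \<omega>)" for \<omega>
  define q where "q \<omega> = \<eta> ^ 3 + \<eta> * (w \<omega>)\<^sup>2 + (w \<omega>) ^ 4 / \<eta>" for \<omega>
  define G where "G \<omega> = 3 * c * norm (E1 \<omega>) + (norm (E2 \<omega>))\<^sup>2 / (2 * \<epsilon>)
      + \<epsilon> * (\<beta>\<^sup>2 * c\<^sup>2 * (w \<omega>)\<^sup>2 + 2 * k1\<^sup>2 * (h\<^sup>2 + (w \<omega>) ^ 4)) + k3 * q \<omega>" for \<omega>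
  \<comment> \<open>Each summand pairs a vector or scalar known at time \<open>s\<close> with a
    centred quantity: an Ito increment, a Wiener increment, or a centred squared increment.\<close>
  define U where "U \<omega> = (J t \<omega> - J s \<omega>) \<bullet> \<phi> s \<omega> + w \<omega> * (Z s \<omega> \<bullet> b (\<phi> s \<omega>)) + ((w \<omega>)\<^sup>2 - h) / 2 * (b (Z s \<omega>) \<bullet> b (\<phi> s \<omega>))" for \<omega>
  have Zm [measurable]: "Z s \<in> borel_measurable M" "Z t \<in> borel_measurable M" using s0 t0 by (simp_all add: Z_measurable)
  have \<phi>m [measurable]: "\<phi> s \<in> borel_measurable M" "\<phi> t \<in> borel_measurable M" using s0 t0 by (simp_all add: \<phi>_measurable)
  have D: "E1 \<in> borel_measurable M" "integrable M (\<lambda>\<omega>. (norm (E1 \<omega>))\<^sup>2)"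
    "expectation (\<lambda>\<omega>. (norm (E1 \<omega>))\<^sup>2) \<le> h\<^sup>2 * \<kappa>\<^sup>2 * \<epsilon>\<^sup>2"
    using drift_error[OF s0 st0 e] unfolding E1_def h_def by auto
  have E2: "integrable M (\<lambda>\<omega>. (norm (E2 \<omega>))\<^sup>2)" "expectation (\<lambda>\<omega>. (norm (E2 \<omega>))\<^sup>2) \<le> \<beta>\<^sup>2 * \<epsilon>\<^sup>2 * h"
    using J_local_error[OF s0 st0 e] unfolding E2_def w_def h_def by auto
  have E1i: "integrable M (\<lambda>\<omega>. norm (E1 \<omega>))" by (rule integrable_norm[OF integrable_of_square[OF D(1,2)]])
  have E1e: "expectation (\<lambda>\<omega>. norm (E1 \<omega>)) \<le> h * \<kappa> * \<epsilon>"
    by (rule expectation_norm_le[OF D(1,2)]) (use D(3) h \<kappa>_nonneg \<epsilon> in \<open>simp_all add: power_mult_distrib\<close>)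
  have wi: "integrable M (\<lambda>\<omega>. (w \<omega>) ^ k)" for k unfolding w_def by (rule increment_integrable[OF s0 st0])
  have wi1: "integrable M w" using wi[of 1] by simp
  have we: "expectation w = 0" "expectation (\<lambda>\<omega>. (w \<omega>)\<^sup>2) = h" "expectation (\<lambda>\<omega>. (w \<omega>) ^ 4) = 3 * h\<^sup>2"
    using increment_moments[OF s0 st0] unfolding w_def h_def by simp_all
  have Gi: "integrable M G"
    unfolding G_def q_def using E1i E2(1) wi[of 2] wi[of 4] by simp
  have "expectation G = 3 * c * expectation (\<lambda>\<omega>. norm (E1 \<omega>)) + expectation (\<lambda>\<omega>. (norm (E2 \<omega>))\<^sup>2) / (2 * \<epsilon>)
      + \<epsilon> * (\<beta>\<^sup>2 * c\<^sup>2 * h + 2 * k1\<^sup>2 * (h\<^sup>2 + 3 * h\<^sup>2)) + k3 * (\<eta> ^ 3 + \<eta> * h + 3 * h\<^sup>2 / \<eta>)"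
    unfolding G_def q_def using E1i E2(1) wi[of 2] wi[of 4] by (simp add: prob_space we)
  also have "\<dots> \<le> 3 * c * (h * \<kappa> * \<epsilon>) + (\<beta>\<^sup>2 * \<epsilon>\<^sup>2 * h) / (2 * \<epsilon>)
      + \<epsilon> * (\<beta>\<^sup>2 * c\<^sup>2 * h + 2 * k1\<^sup>2 * (h + 3 * h)) + k3 * (5 * (h * \<eta>))"
  \<comment> \<open>Steps of length at most 1 have h^2 \<le> h, and h = \<eta>^2 makes \<eta>^3 and
    h^2 / \<eta> both equal to h \<eta>; their weights 1 + 1 + 3 give the factor 5.\<close>
  proof (intro add_mono mult_left_mono divide_right_mono E1e E2(2))
    show "h\<^sup>2 \<le> h" "h\<^sup>2 \<le> h" using h by (simp_all add: power2_eq_square mult_left_le)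
    have "h\<^sup>2 / \<eta> = h * \<eta>" "\<eta> ^ 3 = h * \<eta>"
      using \<eta> by (simp_all add: h(1) power2_eq_square power3_eq_cube)
    then show "\<eta> ^ 3 + \<eta> * h + 3 * h\<^sup>2 / \<eta> \<le> 5 * (h * \<eta>)" by (simp add: mult.commute)
  qed (use c_nonneg \<epsilon> k3_nonneg in auto)
  also have "\<dots> = h * \<epsilon> * (3 * c * \<kappa> + \<beta>\<^sup>2 / 2 + \<beta>\<^sup>2 * c\<^sup>2 + 8 * k1\<^sup>2) + h * \<eta> * (5 * k3)"
    using \<epsilon> by (simp add: algebra_simps power2_eq_square)
  also have "\<dots> \<le> h * \<epsilon> * k4 + h * \<eta> * k4"
    using h \<epsilon> \<eta> c_nonneg \<kappa>_nonneg \<beta>_nonneg k3_nonneg by (intro add_mono mult_left_mono) (auto simp: k4_def)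
  finally have Ge: "expectation G \<le> k4 * h * (\<epsilon> + \<eta>)" by (simp add: algebra_simps)
  have rem: "\<bar>Z t \<omega> \<bullet> \<phi> t \<omega> - Z s \<omega> \<bullet> \<phi> s \<omega> - U \<omega>\<bar> \<le> G \<omega>" if \<omega>: "\<omega> \<in> space M" for \<omega>
  proof -
    define dy where "dy = \<phi> t \<omega> - \<phi> s \<omega>"
    define E3 where "E3 = dy - (w \<omega> *\<^sub>R b (\<phi> s \<omega>) + (\<alpha> * h) *\<^sub>R b (\<phi> s \<omega>) + ((w \<omega>)\<^sup>2 / 2) *\<^sub>R b (b (\<phi> s \<omega>)))"
    have dy: "dy = w \<omega> *\<^sub>R b (\<phi> s \<omega>) + (\<alpha> * h) *\<^sub>R b (\<phi> s \<omega>) + ((w \<omega>)\<^sup>2 / 2) *\<^sub>R b (b (\<phi> s \<omega>)) + E3"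
      by (simp add: E3_def)
    have rt: "\<phi> s \<omega> + dy = rot (cis (r * (\<alpha> * h + w \<omega>))) (\<phi> s \<omega>)"
      using \<phi>_step[of t \<omega> s] by (simp add: dy_def h_def w_def)
    have dJ: "J t \<omega> - J s \<omega> = E2 \<omega> + w \<omega> *\<^sub>R b (Z s \<omega>)" by (simp add: E2_def)
    have dx: "Z t \<omega> - Z s \<omega> = h *\<^sub>R L (Z s \<omega>) + E1 \<omega> + (J t \<omega> - J s \<omega>)" by (simp add: E1_def)
    have "Z t \<omega> \<bullet> \<phi> t \<omega> - Z s \<omega> \<bullet> \<phi> s \<omega> - U \<omega>
      = E1 \<omega> \<bullet> \<phi> s \<omega> + Z s \<omega> \<bullet> E3 + h * (L (Z s \<omega>) \<bullet> dy) + E1 \<omega> \<bullet> dy + E2 \<omega> \<bullet> dy + w \<omega> * (b (Z s \<omega>) \<bullet> (dy - w \<omega> *\<^sub>R b (\<phi> s \<omega>)))"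
      using remainder_identity[OF dJ dx dy] by (simp add: U_def dy_def)
    then show ?thesis
      using remainder_bound[OF h(1) \<eta> \<epsilon> Z_norm[OF s0 \<omega>] \<phi>_norm rt dy, of "E1 \<omega>" "E2 \<omega>"]
      by (simp add: G_def q_def)
  qed
  have b\<phi>: "norm (b (\<phi> s \<omega>)) \<le> \<beta> * c" for \<omega> using b_bound[of "\<phi> s \<omega>"] by (simp add: \<phi>_norm)
  have b\<phi>F: "(\<lambda>\<omega>. b (\<phi> s \<omega>)) \<in> borel_measurable (F s)"
    by (rule measurable_compose[OF \<phi>_measurable_F[OF s0] b_measurable])
  have ZF: "Z s \<in> borel_measurable (F s)" and bZF: "(\<lambda>\<omega>. b (Z s \<omega>)) \<in> borel_measurable (F s)"
    using s0 by (auto intro: Z_F bZ_measurable_F)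
  have bdd: "integrable M (\<lambda>\<omega>. X \<omega> \<bullet> Y \<omega>)"
    if "X \<in> borel_measurable M" "Y \<in> borel_measurable M" "\<And>\<omega>. \<omega> \<in> space M \<Longrightarrow> norm (X \<omega>) \<le> d" "\<And>\<omega>. \<omega> \<in> space M \<Longrightarrow> norm (Y \<omega>) \<le> d'"
    for X Y :: "'w \<Rightarrow> 'b" and d d'
    by (rule integrable_inner_bounded[OF _ that(2,4)], rule integrable_const_bound[OF AE_I2[OF that(3)] that(1)])
  have i0: "integrable M (\<lambda>\<omega>. Z s \<omega> \<bullet> \<phi> s \<omega>)" "integrable M (\<lambda>\<omega>. Z t \<omega> \<bullet> \<phi> t \<omega>)"
    by (rule bdd[of _ _ c c], simp_all add: Z_norm \<phi>_norm s0 t0)+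
  have mF: "(\<lambda>\<omega>. Z s \<omega> \<bullet> b (\<phi> s \<omega>)) \<in> borel_measurable (F s)" "(\<lambda>\<omega>. b (Z s \<omega>) \<bullet> b (\<phi> s \<omega>)) \<in> borel_measurable (F s)"
    by (intro borel_measurable_inner ZF bZF b\<phi>F)+
  have i1: "integrable M (\<lambda>\<omega>. Z s \<omega> \<bullet> b (\<phi> s \<omega>))"
    by (rule bdd[of _ _ c "\<beta> * c"]) (auto simp: Z_norm s0 b\<phi> intro: measurable_F_M[OF b\<phi>F])
  have i2: "integrable M (\<lambda>\<omega>. b (Z s \<omega>) \<bullet> b (\<phi> s \<omega>))"
    by (rule bdd[of _ _ "\<beta> * c" "\<beta> * c"]) (auto simp: bZ_norm s0 b\<phi> intro: measurable_F_M[OF b\<phi>F] measurable_F_M[OF bZF])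
  have dJi: "integrable M (\<lambda>\<omega>. J t \<omega> - J s \<omega>)"
  proof -
    have bZi: "integrable M (\<lambda>\<omega>. w \<omega> *\<^sub>R b (Z s \<omega>))"
    proof (rule Bochner_Integration.integrable_bound[where f="\<lambda>\<omega>. \<beta> * c * w \<omega>"])
      show "integrable M (\<lambda>\<omega>. \<beta> * c * w \<omega>)" using wi1 by simp
      show "(\<lambda>\<omega>. w \<omega> *\<^sub>R b (Z s \<omega>)) \<in> borel_measurable M"
        by (intro borel_measurable_scaleR borel_measurable_integrable[OF wi1] measurable_F_M[OF bZF])
      show "AE \<omega> in M. norm (w \<omega> *\<^sub>R b (Z s \<omega>)) \<le> norm (\<beta> * c * w \<omega>)"
        using mult_left_mono[OF bZ_norm[OF s0] abs_ge_zero] \<beta>_nonneg c_nonneg by (intro AE_I2) (simp add: abs_mult mult.commute)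
    qed
    have "E2 \<in> borel_measurable M"
      unfolding E2_def using s0 t0
      by (intro borel_measurable_diff J_measurable borel_measurable_integrable[OF bZi])
    from Bochner_Integration.integrable_add[OF integrable_of_square[OF this E2(1)] bZi] show ?thesis by (simp add: E2_def)
  qed
  have u1: "integrable M (\<lambda>\<omega>. (J t \<omega> - J s \<omega>) \<bullet> \<phi> s \<omega>)" "expectation (\<lambda>\<omega>. (J t \<omega> - J s \<omega>) \<bullet> \<phi> s \<omega>) = 0"
    using integrable_inner_bounded[OF dJi \<phi>m(1), of c] J_inner_zero[OF s0 st0 \<phi>_measurable_F[OF s0], of c]
    by (simp_all add: \<phi>_norm)
  have u2: "integrable M (\<lambda>\<omega>. (Z s \<omega> \<bullet> b (\<phi> s \<omega>)) * w \<omega>)" "expectation (\<lambda>\<omega>. (Z s \<omega> \<bullet> b (\<phi> s \<omega>)) * w \<omega>) = 0"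
    using increment_indep[where f="\<lambda>x. x", OF s0 st0 mF(1) _ i1] wi1 we(1) unfolding w_def by simp_all
  have u3: "integrable M (\<lambda>\<omega>. (b (Z s \<omega>) \<bullet> b (\<phi> s \<omega>)) * (((w \<omega>)\<^sup>2 - h) / 2))"
    "expectation (\<lambda>\<omega>. (b (Z s \<omega>) \<bullet> b (\<phi> s \<omega>)) * (((w \<omega>)\<^sup>2 - h) / 2)) = 0"
  proof -
    have i: "integrable M (\<lambda>\<omega>. ((W t \<omega> - W s \<omega>)\<^sup>2 - h) / 2)" using wi[of 2] unfolding w_def by simp
    have z: "expectation (\<lambda>\<omega>. ((W t \<omega> - W s \<omega>)\<^sup>2 - h) / 2) = 0" using wi[of 2] we(2) unfolding w_def by (simp add: prob_space)
    show "integrable M (\<lambda>\<omega>. (b (Z s \<omega>) \<bullet> b (\<phi> s \<omega>)) * (((w \<omega>)\<^sup>2 - h) / 2))"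
      unfolding w_def by (rule increment_indep(1)[where f="\<lambda>x. (x\<^sup>2 - h) / 2", OF s0 st0 mF(2) _ i2 i]) simp
    have "expectation (\<lambda>\<omega>. (b (Z s \<omega>) \<bullet> b (\<phi> s \<omega>)) * (((w \<omega>)\<^sup>2 - h) / 2)) = expectation (\<lambda>\<omega>. b (Z s \<omega>) \<bullet> b (\<phi> s \<omega>)) * expectation (\<lambda>\<omega>. ((W t \<omega> - W s \<omega>)\<^sup>2 - h) / 2)"
      unfolding w_def by (rule increment_indep(2)[where f="\<lambda>x. (x\<^sup>2 - h) / 2", OF s0 st0 mF(2) _ i2 i]) simp
    then show "expectation (\<lambda>\<omega>. (b (Z s \<omega>) \<bullet> b (\<phi> s \<omega>)) * (((w \<omega>)\<^sup>2 - h) / 2)) = 0" unfolding z by simp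
  qed
  have U': "U \<omega> = (J t \<omega> - J s \<omega>) \<bullet> \<phi> s \<omega> + (Z s \<omega> \<bullet> b (\<phi> s \<omega>)) * w \<omega> + (b (Z s \<omega>) \<bullet> b (\<phi> s \<omega>)) * (((w \<omega>)\<^sup>2 - h) / 2)" for \<omega>
    by (simp add: U_def mult.commute)
  have Ui: "integrable M U" "expectation U = 0"
    unfolding U'[abs_def] using u1 u2 u3 by simp_all
  have eq: "overlap t - overlap s = expectation (\<lambda>\<omega>. Z t \<omega> \<bullet> \<phi> t \<omega> - Z s \<omega> \<bullet> \<phi> s \<omega> - U \<omega>)"
    using i0 Ui by (simp add: overlap_def)
  have "\<bar>overlap t - overlap s\<bar> \<le> expectation (\<lambda>\<omega>. \<bar>Z t \<omega> \<bullet> \<phi> t \<omega> - Z s \<omega> \<bullet> \<phi> s \<omega> - U \<omega>\<bar>)"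
    unfolding eq by (rule integral_abs_bound)
  also have "\<dots> \<le> expectation G"
  proof (rule integral_mono[OF _ Gi rem])
    have "integrable M (\<lambda>\<omega>. Z t \<omega> \<bullet> \<phi> t \<omega> - Z s \<omega> \<bullet> \<phi> s \<omega> - U \<omega>)"
      using i0 Ui(1) by (intro Bochner_Integration.integrable_diff)
    then show "integrable M (\<lambda>\<omega>. \<bar>Z t \<omega> \<bullet> \<phi> t \<omega> - Z s \<omega> \<bullet> \<phi> s \<omega> - U \<omega>\<bar>)"
      by (rule integrable_abs)
  qed
  also note Ge
  finally show ?thesis by (simp add: h_def \<eta>_def)
qed

text \<open>The steps of length h number T/h, and each changes the overlap by at most 2 k4 h
  \<epsilon>, so the total change is at most 2 k4 T \<epsilon> for every positive
  \<epsilon>.\<close>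

lemma overlap_constant:
  assumes T: "0 \<le> T"
  shows "overlap T = overlap 0"
proof -
  have small: "\<bar>overlap T - overlap 0\<bar> \<le> 2 * k4 * T * \<epsilon>" if \<epsilon>: "0 < \<epsilon>" for \<epsilon>
  proof (cases "T = 0")
    case False
    then have T: "0 < T" using T by simp
    obtain d where d: "d > 0" "\<And>s t. s \<in> {0..T} \<Longrightarrow> t \<in> {0..T} \<Longrightarrow> \<bar>s - t\<bar> < d \<Longrightarrow> expectation (\<lambda>\<omega>. (norm (Z s \<omega> - Z t \<omega>))\<^sup>2) < \<epsilon>\<^sup>2"
      using Z_modulus[of T "\<epsilon>\<^sup>2"] T \<epsilon> by auto
    \<comment> \<open>The mesh must lie below the modulus \<open>d\<close>, below 1 for
      \<open>overlap_step\<close>, and below \<epsilon>^2 so that its square root is at most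
      \<epsilon>.\<close>
    have "\<forall>\<^sub>F n in sequentially. (T - 0) / real (Suc n) < min d (min 1 (\<epsilon>\<^sup>2))"
      using d(1) \<epsilon> by (intro grid_mesh) simp
    then obtain n where n: "T / real (Suc n) < min d (min 1 (\<epsilon>\<^sup>2))"
      unfolding eventually_sequentially by auto
    define h where "h = T / real (Suc n)"
    have h: "0 < h" "h < d" "h \<le> 1" "h \<le> \<epsilon>\<^sup>2" using n T by (simp_all add: h_def)
    have sh: "sqrt h \<le> \<epsilon>" using h(4) \<epsilon> by (simp add: real_le_lsqrt)
    define p where "p i = grid 0 T n i" for i
    have ps: "p (Suc i) - p i = h" for i using grid_step[of 0 T n i] by (simp add: p_def h_def)
    have step: "\<bar>overlap (p (Suc i)) - overlap (p i)\<bar> \<le> 2 * k4 * h * \<epsilon>" if i: "i < Suc n" for i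
    proof -
      have b: "0 \<le> p i" "p (Suc i) \<le> T" using grid_bounds[of 0 T i n] grid_bounds[of 0 T "Suc i" n] T i by (auto simp: p_def)
      have "\<bar>overlap (p (Suc i)) - overlap (p i)\<bar> \<le> k4 * (p (Suc i) - p i) * (\<epsilon> + sqrt (p (Suc i) - p i))"
      proof (rule overlap_step)
        show "0 \<le> p i" "p i < p (Suc i)" "p (Suc i) - p i \<le> 1" "0 < \<epsilon>" using b h ps[of i] \<epsilon> by auto
        show "expectation (\<lambda>\<omega>. (norm (Z u \<omega> - Z (p i) \<omega>))\<^sup>2) \<le> \<epsilon>\<^sup>2" if "p i \<le> u" "u \<le> p (Suc i)" for u
          using that b h ps[of i] by (intro less_imp_le d(2)) auto
      qed
      also have "\<dots> = k4 * h * (\<epsilon> + sqrt h)" by (simp only: ps)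
      also have "\<dots> \<le> k4 * h * (\<epsilon> + \<epsilon>)" using sh h k4_nonneg by (intro mult_left_mono) auto
      finally show ?thesis by (simp add: algebra_simps)
    qed
    have "\<bar>overlap T - overlap 0\<bar> = \<bar>\<Sum>i<Suc n. overlap (p (Suc i)) - overlap (p i)\<bar>"
      using sum_lessThan_telescope[of "\<lambda>i. overlap (p i)" "Suc n"] by (simp add: p_def del: sum.lessThan_Suc)
    also have "\<dots> \<le> (\<Sum>i<Suc n. \<bar>overlap (p (Suc i)) - overlap (p i)\<bar>)" by (rule sum_abs)
    also have "\<dots> \<le> (\<Sum>i<Suc n. 2 * k4 * h * \<epsilon>)" by (rule sum_mono) (use step in simp)
    also have "\<dots> = 2 * k4 * (real (Suc n) * h) * \<epsilon>" by (simp only: sum_constant card_lessThan ac_simps)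
    also have "real (Suc n) * h = T" by (simp add: h_def)
    finally show ?thesis .
  qed simp
  have k: "0 \<le> 2 * k4 * T" using k4_nonneg T by simp
  have *: "\<bar>overlap T - overlap 0\<bar> \<le> x" if x: "0 < x" for x
  proof -
    have "0 < x / (2 * k4 * T + 1)" using x k by (simp add: add_nonneg_pos)
    from small[OF this] have "\<bar>overlap T - overlap 0\<bar> \<le> 2 * k4 * T * (x / (2 * k4 * T + 1))" .
    also have "\<dots> \<le> x" using k x by (simp add: pos_divide_le_eq algebra_simps)
    finally show ?thesis .
  qed
  have "\<bar>overlap T - overlap 0\<bar> \<le> 0" by (rule field_le_epsilon) (use * in simp)
  then show ?thesis by simp
qed

text \<open>The starting point is read off from the equation at time 0: the Ito sums over the
  degenerate interval are 0, and \<open>bracket_eq\<close> makes the bracket an integral over a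
  single point.\<close>

lemma Z_0: "AE \<omega> in M. Z 0 \<omega> = z"
proof -
  have J0: "AE \<omega> in M. J 0 \<omega> = 0"
  proof -
    have "tendsto_prob M (\<lambda>n \<omega>. \<Sum>i<Suc n. (W (grid 0 0 n (Suc i)) \<omega> - W (grid 0 0 n i) \<omega>) *\<^sub>R b (Z (grid 0 0 n i) \<omega>)) (J 0)"
      by (rule mesh_limit_grid[OF ito[OF order_refl, unfolded has_ito_integral_def] order_refl])
    then have "tendsto_prob M (\<lambda>n \<omega>. 0) (J 0)" by (simp add: grid_def)
    then obtain \<sigma> :: "nat \<Rightarrow> nat" where "AE \<omega> in M. (\<lambda>n. 0) \<longlonglongrightarrow> J 0 \<omega>"
      using tendsto_prob_AE_subseq[of "\<lambda>n \<omega>. 0" "J 0"] J_measurable[of 0] by auto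
    then show ?thesis by eventually_elim (simp add: LIMSEQ_const_iff)
  qed
  show ?thesis
    using J0 eqn[OF order_refl] bracket_eq[OF order_refl] by eventually_elim simp
qed

text \<open>The overlap equals c^2 at time 0 and therefore at all times. Equality in Cauchy-Schwarz
  in the mean forces the mean squared distance to be 0.\<close>

theorem solution_eq:
  assumes t: "0 \<le> t"
  shows "AE \<omega> in M. Z t \<omega> = rot (cis (r * (\<alpha> * t + W t \<omega>))) z"
proof -
  have [measurable]: "Z t \<in> borel_measurable M" "\<phi> t \<in> borel_measurable M" "Z 0 \<in> borel_measurable M" "\<phi> 0 \<in> borel_measurable M"
    using t by (simp_all add: Z_measurable \<phi>_measurable)
  have "overlap 0 = expectation (\<lambda>\<omega>. c\<^sup>2)"
    unfolding overlap_def
  proof (rule integral_cong_AE)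
    show "AE \<omega> in M. Z 0 \<omega> \<bullet> \<phi> 0 \<omega> = c\<^sup>2"
      using Z_0 W_0 by eventually_elim (simp add: \<phi>_def cis_zero z_norm flip: power2_norm_eq_inner)
  qed measurable
  then have m: "overlap t = c\<^sup>2" using overlap_constant[OF t] by (simp add: prob_space)
  have i: "integrable M (\<lambda>\<omega>. Z t \<omega> \<bullet> \<phi> t \<omega>)"
  proof (rule integrable_const_bound[where B="c * c"])
    show "AE \<omega> in M. norm (Z t \<omega> \<bullet> \<phi> t \<omega>) \<le> c * c"
    proof (rule AE_I2)
      fix \<omega> assume "\<omega> \<in> space M"
      then show "norm (Z t \<omega> \<bullet> \<phi> t \<omega>) \<le> c * c"
        using Cauchy_Schwarz_ineq2[of "Z t \<omega>" "\<phi> t \<omega>"] Z_norm[OF t] by (simp add: \<phi>_norm)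
    qed
  qed measurable
  have eq: "(norm (Z t \<omega> - \<phi> t \<omega>))\<^sup>2 = 2 * c\<^sup>2 - 2 * (Z t \<omega> \<bullet> \<phi> t \<omega>)" if "\<omega> \<in> space M" for \<omega>
  proof -
    have "(norm (Z t \<omega> - \<phi> t \<omega>))\<^sup>2 = (norm (Z t \<omega>))\<^sup>2 + (norm (\<phi> t \<omega>))\<^sup>2 - 2 * (Z t \<omega> \<bullet> \<phi> t \<omega>)"
      unfolding power2_norm_eq_inner by (simp add: inner_diff inner_commute)
    then show ?thesis using Z_norm[OF t that] by (simp add: \<phi>_norm)
  qed
  have "expectation (\<lambda>\<omega>. (norm (Z t \<omega> - \<phi> t \<omega>))\<^sup>2) = expectation (\<lambda>\<omega>. 2 * c\<^sup>2 - 2 * (Z t \<omega> \<bullet> \<phi> t \<omega>))"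
    by (rule Bochner_Integration.integral_cong[OF refl eq])
  also have "\<dots> = 0" using i m unfolding overlap_def by (simp add: prob_space)
  finally have 0: "expectation (\<lambda>\<omega>. (norm (Z t \<omega> - \<phi> t \<omega>))\<^sup>2) = 0" .
  have "integrable M (\<lambda>\<omega>. 2 * c\<^sup>2 - 2 * (Z t \<omega> \<bullet> \<phi> t \<omega>))" using i by simp
  then have "integrable M (\<lambda>\<omega>. (norm (Z t \<omega> - \<phi> t \<omega>))\<^sup>2)"
    by (subst Bochner_Integration.integrable_cong[OF refl eq])
  from integral_nonneg_eq_0_iff_AE[OF this] 0
  have "AE \<omega> in M. (norm (Z t \<omega> - \<phi> t \<omega>))\<^sup>2 = 0" by simp
  then show ?thesis by eventually_elim (simp add: \<phi>_def)
qed

end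

section \<open>Uniqueness and construction of the invariant probability on the circle\<close>

section \<open>The Haar measure of the circle\<close>

lemma space_borel_on [simp]: "space (borel_on K) = K"
  by (simp add: borel_on_def space_restrict_space)

lemma measurable_borel_on_iff: "f \<in> N \<rightarrow>\<^sub>M borel_on K \<longleftrightarrow> f \<in> borel_measurable N \<and> f \<in> space N \<rightarrow> K"
  by (simp add: borel_on_def measurable_restrict_space2_iff)

lemma borel_on_to_borel: "(\<lambda>x. x) \<in> borel_on K \<rightarrow>\<^sub>M borel"
  unfolding borel_on_def by (rule measurable_restrict_space1) simp

lemma fst_borel_on [measurable]: "fst \<in> borel_on K \<Otimes>\<^sub>M N \<rightarrow>\<^sub>M borel"
  by (rule measurable_compose[OF measurable_fst borel_on_to_borel])

lemma snd_borel_on [measurable]: "snd \<in> N \<Otimes>\<^sub>M borel_on K \<rightarrow>\<^sub>M borel"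
  by (rule measurable_compose[OF measurable_snd borel_on_to_borel])

lemma circle_mult_measurable: "p \<in> circle \<Longrightarrow> (\<lambda>q. p * q) \<in> borel_on circle \<rightarrow>\<^sub>M borel_on circle"
  unfolding measurable_borel_on_iff
  using borel_measurable_times[OF borel_measurable_const[of p] borel_on_to_borel[of circle]]
  by (auto simp: norm_mult)

lemma emeasure_lborel_translate:
  fixes S :: "real set"
  assumes S: "S \<in> sets borel"
  shows "emeasure lborel {x. x + a \<in> S} = emeasure lborel S"
proof -
  have "emeasure lborel S = emeasure (distr lborel borel ((+) a)) S" by (simp add: lborel_distr_plus)
  also have "\<dots> = emeasure lborel ((+) a -` S \<inter> space lborel)"
    by (rule emeasure_distr) (use S in auto)
  also have "(+) a -` S \<inter> space lborel = {x. x + a \<in> S}" by (auto simp: add.commute)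
  finally show ?thesis by simp
qed

text \<open>Translation moves the window to [a, a + d); the part of it beyond d is brought back by
  one period and fills the gap [0, a).\<close>

lemma emeasure_periodic_shift:
  fixes P :: "real set" and a d :: real
  assumes P: "P \<in> sets borel" and per: "\<And>x. x + d \<in> P \<longleftrightarrow> x \<in> P" and a: "0 \<le> a" "a < d"
  shows "emeasure lborel {x \<in> {0..<d}. x + a \<in> P} = emeasure lborel {x \<in> {0..<d}. x \<in> P}"
proof -
  have sets: "P \<inter> {u..<v} \<in> sets lborel" for u v :: real using P by auto
  have "{x \<in> {0..<d}. x + a \<in> P} = {x. x + a \<in> P \<inter> {a..<a+d}}" by auto
  then have "emeasure lborel {x \<in> {0..<d}. x + a \<in> P} = emeasure lborel (P \<inter> {a..<a+d})"
    using emeasure_lborel_translate[of "P \<inter> {a..<a+d}" a] P by simp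
  also have "P \<inter> {a..<a+d} = (P \<inter> {a..<d}) \<union> (P \<inter> {d..<a+d})" using a by auto
  also have "emeasure lborel \<dots> = emeasure lborel (P \<inter> {a..<d}) + emeasure lborel (P \<inter> {d..<a+d})"
    by (rule plus_emeasure[symmetric]) (use sets in auto)
  also have "emeasure lborel (P \<inter> {d..<a+d}) = emeasure lborel {x. x + d \<in> P \<inter> {d..<a+d}}"
    using emeasure_lborel_translate[of "P \<inter> {d..<a+d}" d] P by simp
  also have "{x. x + d \<in> P \<inter> {d..<a+d}} = P \<inter> {0..<a}" using per by auto
  also have "emeasure lborel (P \<inter> {a..<d}) + emeasure lborel (P \<inter> {0..<a}) = emeasure lborel ((P \<inter> {a..<d}) \<union> (P \<inter> {0..<a}))"
    by (rule plus_emeasure) (use sets in auto)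
  also have "(P \<inter> {a..<d}) \<union> (P \<inter> {0..<a}) = {x \<in> {0..<d}. x \<in> P}" using a by auto
  finally show ?thesis .
qed

definition circle_invariant :: "complex measure \<Rightarrow> bool" where
  "circle_invariant m \<longleftrightarrow> m \<in> borel_probabilities (borel_on circle) \<and>
     (\<forall>p\<in>circle. distr m (borel_on circle) (\<lambda>q. p * q) = m)"

text \<open>Integrate the indicator of \<open>J\<close> at the product x y against both measures.
  Integrating over x first gives the value of \<open>m1\<close>, over y first that of
  \<open>m2\<close>, and Fubini equates them; commutativity lets one invariance condition serve on
  both sides.\<close>

lemma circle_invariant_unique:
  assumes 1: "circle_invariant m1" and 2: "circle_invariant m2"
  shows "m1 = m2"
proof (rule measure_eqI)
  have s: "sets m1 = sets (borel_on circle)" "sets m2 = sets (borel_on circle)" "prob_space m1" "prob_space m2"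
    using 1 2 by (auto simp: circle_invariant_def borel_probabilities_def space_prob_algebra)
  then show "sets m1 = sets m2" by simp
  interpret m1: prob_space m1 by fact
  interpret m2: prob_space m2 by fact
  interpret pair_sigma_finite m1 m2 ..
  have sp: "space m1 = circle" "space m2 = circle" using s(1,2) by (auto dest: sets_eq_imp_space_eq)
  fix J assume "J \<in> sets m1"
  then have J: "J \<in> sets (borel_on circle)" using s by simp
  have inv: "emeasure m {q \<in> circle. p * q \<in> J} = emeasure m J" if m: "circle_invariant m" and p: "p \<in> circle" for m p
  proof -
    have sm: "sets m = sets (borel_on circle)" "space m = circle"
      using m by (auto simp: circle_invariant_def borel_probabilities_def space_prob_algebra dest: sets_eq_imp_space_eq)
    have "emeasure m J = emeasure (distr m (borel_on circle) (\<lambda>q. p * q)) J"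
      using m p by (simp add: circle_invariant_def)
    also have "\<dots> = emeasure m ((\<lambda>q. p * q) -` J \<inter> space m)"
      by (rule emeasure_distr[OF _ J]) (use circle_mult_measurable[OF p] in \<open>simp add: measurable_cong_sets[OF sm(1) refl]\<close>)
    also have "(\<lambda>q. p * q) -` J \<inter> space m = {q \<in> circle. p * q \<in> J}" by (auto simp: sm)
    finally show ?thesis by simp
  qed
  have mult: "(\<lambda>x. fst x * snd x) \<in> m1 \<Otimes>\<^sub>M m2 \<rightarrow>\<^sub>M borel_on circle"
  proof -
    have "(\<lambda>x. fst x * snd x) \<in> borel_on circle \<Otimes>\<^sub>M borel_on circle \<rightarrow>\<^sub>M borel_on circle"
      unfolding measurable_borel_on_iff by (auto simp: space_pair_measure norm_mult)
    then show ?thesis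
      by (simp add: measurable_cong_sets[OF sets_pair_measure_cong[OF s(1,2)] refl])
  qed
  have ind: "(\<lambda>(x, y). indicator J (x * y) :: ennreal) \<in> borel_measurable (m1 \<Otimes>\<^sub>M m2)"
    using measurable_compose[OF mult borel_measurable_indicator[OF J]] by (simp add: split_beta')
  have "emeasure m1 J = (\<integral>\<^sup>+y. emeasure m1 J \<partial>m2)" by (simp add: m2.emeasure_space_1)
  also have "\<dots> = (\<integral>\<^sup>+y. (\<integral>\<^sup>+x. indicator J (x * y) \<partial>m1) \<partial>m2)"
  proof (rule nn_integral_cong)
    fix y assume "y \<in> space m2"
    then have y: "y \<in> circle" using sp by simp
    have "(\<integral>\<^sup>+x. indicator J (x * y) \<partial>m1) = (\<integral>\<^sup>+x. indicator {q \<in> circle. y * q \<in> J} x \<partial>m1)"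
      by (rule nn_integral_cong) (auto simp: sp mult.commute split: split_indicator)
    also have "\<dots> = emeasure m1 {q \<in> circle. y * q \<in> J}"
    proof (rule nn_integral_indicator)
      have "(\<lambda>q. y * q) -` J \<inter> space (borel_on circle) \<in> sets (borel_on circle)"
        by (rule measurable_sets[OF circle_mult_measurable[OF y] J])
      moreover have "(\<lambda>q. y * q) -` J \<inter> space (borel_on circle) = {q \<in> circle. y * q \<in> J}" by auto
      ultimately show "{q \<in> circle. y * q \<in> J} \<in> sets m1" by (simp add: s)
    qed
    finally show "emeasure m1 J = (\<integral>\<^sup>+x. indicator J (x * y) \<partial>m1)" using inv[OF 1 y] by simp
  qed
  also have "\<dots> = (\<integral>\<^sup>+x. (\<integral>\<^sup>+y. indicator J (x * y) \<partial>m2) \<partial>m1)"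
    by (rule Fubini'[OF ind])
  also have "\<dots> = (\<integral>\<^sup>+x. emeasure m2 J \<partial>m1)"
  proof (rule nn_integral_cong)
    fix x assume "x \<in> space m1"
    then have x: "x \<in> circle" using sp by simp
    have "(\<integral>\<^sup>+y. indicator J (x * y) \<partial>m2) = (\<integral>\<^sup>+y. indicator {q \<in> circle. x * q \<in> J} y \<partial>m2)"
      by (rule nn_integral_cong) (auto simp: sp split: split_indicator)
    also have "\<dots> = emeasure m2 {q \<in> circle. x * q \<in> J}"
    proof (rule nn_integral_indicator)
      have "(\<lambda>q. x * q) -` J \<inter> space (borel_on circle) \<in> sets (borel_on circle)"
        by (rule measurable_sets[OF circle_mult_measurable[OF x] J])
      moreover have "(\<lambda>q. x * q) -` J \<inter> space (borel_on circle) = {q \<in> circle. x * q \<in> J}" by auto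
      ultimately show "{q \<in> circle. x * q \<in> J} \<in> sets m2" by (simp add: s)
    qed
    finally show "(\<integral>\<^sup>+y. indicator J (x * y) \<partial>m2) = emeasure m2 J" using inv[OF 2 x] by simp
  qed
  also have "\<dots> = emeasure m2 J" by (simp add: m1.emeasure_space_1)
  finally show "emeasure m1 J = emeasure m2 J" .
qed

text \<open>The image of the uniform law on [0, 2 pi) under \<open>cis\<close>; multiplication on
  the circle becomes translation modulo the period.\<close>

lemma circle_invariant_exists: "\<exists>m. circle_invariant m"
proof -
  define N where "N = uniform_measure lborel {0..<2 * pi}"
  define m where "m = distr N (borel_on circle) cis"
  have N: "prob_space N" unfolding N_def by (rule prob_space_uniform_measure) auto
  have Ns: "sets N = sets borel" "space N = UNIV" by (simp_all add: N_def)
  have cis: "cis \<in> N \<rightarrow>\<^sub>M borel_on circle"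
    unfolding measurable_borel_on_iff
  proof
    show "cis \<in> borel_measurable N"
      unfolding measurable_cong_sets[OF Ns(1) refl]
      by (intro borel_measurable_continuous_onI continuous_on_cis continuous_on_id)
  qed auto
  interpret N: prob_space N by (rule N)
  have prob: "m \<in> borel_probabilities (borel_on circle)"
    unfolding m_def borel_probabilities_def space_prob_algebra by (simp add: N.prob_space_distr[OF cis])
  have "distr m (borel_on circle) (\<lambda>q. p * q) = m" if p: "p \<in> circle" for p
  proof (rule measure_eqI)
    show "sets (distr m (borel_on circle) (\<lambda>q. p * q)) = sets m" by (simp add: m_def)
    fix J assume "J \<in> sets (distr m (borel_on circle) (\<lambda>q. p * q))"
    then have J: "J \<in> sets (borel_on circle)" by simp
    obtain a where a: "0 \<le> a" "a < 2 * pi" "p = cis a"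
      using Arg2pi_ge_0[of p] Arg2pi_lt_2pi[of p] complex_norm_eq_1_exp[of p] p
      by (auto simp: cis_conv_exp)
    \<comment> \<open>The preimage on the whole line is periodic with period 2 pi, and
      multiplication by \<open>cis a\<close> shifts it by \<open>a\<close>.\<close>
    define P where "P = cis -` J"
    have P: "P \<in> sets borel"
      using measurable_sets[OF cis J] by (simp add: P_def Ns)
    have per: "x + 2 * pi \<in> P \<longleftrightarrow> x \<in> P" for x by (simp add: P_def cis_mult[symmetric])
    have u: "emeasure N S = emeasure lborel ({0..<2 * pi} \<inter> S) / emeasure lborel {0..<2 * pi}" if "S \<in> sets borel" for S
      unfolding N_def using that by (intro emeasure_uniform_measure) auto
    have Pa: "{x. x + a \<in> P} \<in> sets borel"
      using measurable_sets[of "\<lambda>x. x + a" borel borel P] P by (simp add: vimage_def)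
    have "emeasure (distr m (borel_on circle) (\<lambda>q. p * q)) J = emeasure m ((\<lambda>q. p * q) -` J \<inter> circle)"
      using circle_mult_measurable[OF p] J by (subst emeasure_distr) (auto simp: m_def)
    also have "\<dots> = emeasure N (cis -` ((\<lambda>q. p * q) -` J \<inter> circle) \<inter> space N)"
      unfolding m_def using measurable_sets[OF circle_mult_measurable[OF p] J]
      by (intro emeasure_distr cis) simp
    also have "cis -` ((\<lambda>q. p * q) -` J \<inter> circle) \<inter> space N = {x. x + a \<in> P}"
      by (auto simp: Ns P_def a(3) cis_mult add.commute)
    also have "emeasure N {x. x + a \<in> P} = emeasure N P"
    proof -
      have "{0..<2 * pi} \<inter> {x. x + a \<in> P} = {x \<in> {0..<2 * pi}. x + a \<in> P}" "{0..<2 * pi} \<inter> P = {x \<in> {0..<2 * pi}. x \<in> P}" by auto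
      then show ?thesis unfolding u[OF P] u[OF Pa] using emeasure_periodic_shift[OF P per a(1,2)] by simp
    qed
    also have "\<dots> = emeasure m J"
      unfolding m_def using J by (subst emeasure_distr[OF cis]) (auto simp: P_def Ns)
    finally show "emeasure (distr m (borel_on circle) (\<lambda>q. p * q)) J = emeasure m J" .
  qed
  with prob show ?thesis unfolding circle_invariant_def by blast
qed

lemma circle_invariant_haar: "circle_invariant circle_haar"
proof -
  have "\<exists>!m. circle_invariant m" using circle_invariant_exists circle_invariant_unique by blast
  from theI'[OF this] show ?thesis by (simp add: circle_haar_def circle_invariant_def)
qed

lemma prob_space_haar: "prob_space circle_haar" and sets_haar: "sets circle_haar = sets (borel_on circle)"
  and distr_haar: "p \<in> circle \<Longrightarrow> distr circle_haar (borel_on circle) (\<lambda>q. p * q) = circle_haar"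
  using circle_invariant_haar by (auto simp: circle_invariant_def borel_probabilities_def space_prob_algebra)

lemma space_haar: "space circle_haar = circle"
  using sets_eq_imp_space_eq[OF sets_haar] by simp

section \<open>Disintegration of circle-invariant measures over the orbit space\<close>

section \<open>Orbits of a circle action\<close>

locale circle_flow = skew_operator b r
  for b :: "'b::euclidean_space \<Rightarrow> 'b" and r :: real +
  fixes act :: "real^3^3 \<Rightarrow> 'b \<Rightarrow> 'b" and B :: "real^3^3" and K :: "'b set"
  assumes act_rot: "act (circle_matrix B p) x = rot p x"
    and K_closed: "closed K"
    and K_rot: "p \<in> circle \<Longrightarrow> z \<in> K \<Longrightarrow> rot p z \<in> K"
begin

abbreviation orb :: "'b \<Rightarrow> 'b set" where "orb \<equiv> orbit_of act B"
abbreviation HB :: "'b set measure" where "HB \<equiv> orbit_borel act B K"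

lemma orb_def: "orb z = (\<lambda>p. rot p z) ` circle"
  by (simp add: orbit_of_def act_rot)

lemma orb_rot: "p \<in> circle \<Longrightarrow> orb (rot p z) = orb z"
proof (intro equalityI subsetI)
  fix y assume p: "p \<in> circle" and "y \<in> orb (rot p z)"
  then obtain q where "q \<in> circle" "y = rot (q * p) z" by (auto simp: orb_def rot_rot)
  then show "y \<in> orb z" using p by (auto simp: orb_def norm_mult intro!: image_eqI[of _ _ "q * p"])
next
  fix y assume p: "p \<in> circle" and "y \<in> orb z"
  then obtain q where q: "q \<in> circle" "y = rot q z" by (auto simp: orb_def)
  have "p * cnj p = 1" using p by (simp add: complex_norm_square[symmetric])
  then have "y = rot (q * cnj p) (rot p z)" by (simp add: q rot_rot mult.assoc mult.commute[of "cnj p"])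
  then show "y \<in> orb (rot p z)" using p q by (auto simp: orb_def norm_mult intro!: image_eqI[of _ _ "q * cnj p"])
qed

lemma orb_self: "z \<in> orb z"
  by (auto simp: orb_def intro!: image_eqI[of _ _ 1])

lemma space_HB: "space HB = orbit_space act B K"
  unfolding orbit_borel_def by (rule space_measure_of) (auto simp: openin_orbit_topology)

lemma space_HB_E:
  assumes "X \<in> space HB"
  obtains z where "z \<in> K" "X = orb z"
  using assms by (auto simp: space_HB orbit_space_def)

lemma sets_HB: "sets HB = sigma_sets (orbit_space act B K) {U. openin (orbit_topology act B K) U}"
  unfolding orbit_borel_def by (rule sets_measure_of) (auto simp: openin_orbit_topology)

lemma open_in_borel_on: "openin (top_of_set K) S \<Longrightarrow> S \<in> sets (borel_on K)"
  unfolding borel_on_def sets_restrict_space openin_open by auto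

lemma orb_measurable: "orb \<in> borel_on K \<rightarrow>\<^sub>M HB"
proof (rule measurable_sigma_sets[OF sets_HB])
  show "orb \<in> space (borel_on K) \<rightarrow> orbit_space act B K" by (auto simp: orbit_space_def)
  fix U assume "U \<in> {U. openin (orbit_topology act B K) U}"
  then have "{z \<in> K. orb z \<in> U} \<in> sets (borel_on K)"
    by (intro open_in_borel_on) (simp add: openin_orbit_topology)
  moreover have "orb -` U \<inter> space (borel_on K) = {z \<in> K. orb z \<in> U}" by auto
  ultimately show "orb -` U \<inter> space (borel_on K) \<in> sets (borel_on K)" by simp
qed (auto simp: openin_orbit_topology)

text \<open>The universal property of the quotient topology: a function on the orbit space is
  continuous once its composition with the projection is.\<close>

lemma borel_measurable_HB:
  fixes g :: "'b set \<Rightarrow> real"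
  assumes cont: "continuous_on K (\<lambda>z. g (orb z))"
  shows "g \<in> borel_measurable HB"
proof (rule borel_measurableI)
  fix S :: "real set" assume S: "open S"
  have "{z \<in> K. orb z \<in> g -` S \<inter> space HB} = K \<inter> (\<lambda>z. g (orb z)) -` S"
    by (auto simp: space_HB orbit_space_def)
  moreover have "openin (top_of_set K) (K \<inter> (\<lambda>z. g (orb z)) -` S)"
    using cont S by (rule continuous_openin_preimage_gen)
  ultimately have "openin (orbit_topology act B K) (g -` S \<inter> space HB)"
    unfolding openin_orbit_topology by (auto simp: space_HB)
  then show "g -` S \<inter> space HB \<in> sets HB" unfolding sets_HB by blast
qed

lemma rot_measurable2: "(\<lambda>x. rot (fst x) (snd x)) \<in> borel_on circle \<Otimes>\<^sub>M borel_on K \<rightarrow>\<^sub>M borel_on K"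
  unfolding measurable_borel_on_iff
proof
  have "(\<lambda>x. rot (fst x) (snd x)) \<in> borel_measurable (borel_on circle \<Otimes>\<^sub>M borel_on K)"
    unfolding rot_def by measurable
  then show "(\<lambda>x. rot (fst x) (snd x)) \<in> borel_measurable (borel_on circle \<Otimes>\<^sub>M borel_on K)" .
qed (auto simp: space_pair_measure K_rot)

lemma rot_measurable_point: "z \<in> K \<Longrightarrow> (\<lambda>p. rot p z) \<in> borel_on circle \<rightarrow>\<^sub>M borel_on K"
  using measurable_compose[OF measurable_Pair2' rot_measurable2, of z] by simp

lemma rot_measurable: "p \<in> circle \<Longrightarrow> rot p \<in> borel_on K \<rightarrow>\<^sub>M borel_on K"
  using measurable_compose[OF measurable_Pair1' rot_measurable2, of p] by simp

definition \<mu> :: "'b \<Rightarrow> 'b measure" where "\<mu> z = distr circle_haar (borel_on K) (\<lambda>p. rot p z)"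

lemma haar_rot: "z \<in> K \<Longrightarrow> (\<lambda>p. rot p z) \<in> circle_haar \<rightarrow>\<^sub>M borel_on K"
  using rot_measurable_point by (simp add: measurable_cong_sets[OF sets_haar refl])

text \<open>Moving the base point by \<open>p\<close> precomposes the orbit map with multiplication
  by \<open>p\<close>, and the Haar measure is unaffected by that.\<close>

lemma \<mu>_rot:
  assumes p: "p \<in> circle" and z: "z \<in> K"
  shows "\<mu> (rot p z) = \<mu> z"
proof -
  have "\<mu> z = distr (distr circle_haar (borel_on circle) (\<lambda>q. p * q)) (borel_on K) (\<lambda>p. rot p z)"
    by (simp add: \<mu>_def distr_haar[OF p])
  also have "\<dots> = distr circle_haar (borel_on K) ((\<lambda>p. rot p z) \<circ> (\<lambda>q. p * q))"
    by (rule distr_distr[OF rot_measurable_point[OF z]])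
      (simp add: measurable_cong_sets[OF sets_haar refl] circle_mult_measurable[OF p])
  also have "(\<lambda>p. rot p z) \<circ> (\<lambda>q. p * q) = (\<lambda>q. rot q (rot p z))"
    by (simp add: fun_eq_iff rot_rot mult.commute)
  finally show ?thesis by (simp add: \<mu>_def)
qed

text \<open>Eliminates the choice operator: whichever point of the orbit is selected, it is a
  rotation of \<open>z\<close>.\<close>

lemma orbit_measure_orb:
  assumes z: "z \<in> K"
  shows "orbit_measure act B K (orb z) = \<mu> z"
proof -
  have "(SOME U. U \<in> orb z) \<in> orb z" by (rule someI[of _ z]) (rule orb_self)
  then obtain q where q: "q \<in> circle" "(SOME U. U \<in> orb z) = rot q z" by (auto simp: orb_def)
  have "orbit_measure act B K (orb z) = \<mu> (rot q z)"
    unfolding orbit_measure_def act_rot q(2) \<mu>_def ..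
  then show ?thesis using \<mu>_rot[OF q(1) z] by simp
qed

lemma \<mu>_prob: "z \<in> K \<Longrightarrow> prob_space (\<mu> z)" and \<mu>_sets: "sets (\<mu> z) = sets (borel_on K)"
  unfolding \<mu>_def by (auto intro: prob_space.prob_space_distr[OF prob_space_haar haar_rot])

lemma \<mu>_rot_invariant:
  assumes p: "p \<in> circle" and z: "z \<in> K"
  shows "distr (\<mu> z) (borel_on K) (rot p) = \<mu> z"
proof -
  have "distr (\<mu> z) (borel_on K) (rot p) = distr circle_haar (borel_on K) (rot p \<circ> (\<lambda>q. rot q z))"
    unfolding \<mu>_def by (rule distr_distr[OF rot_measurable[OF p] haar_rot[OF z]])
  also have "rot p \<circ> (\<lambda>q. rot q z) = (\<lambda>q. rot q (rot p z))"
    by (simp add: fun_eq_iff rot_rot mult.commute)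
  finally show ?thesis using \<mu>_rot[OF p z] by (simp add: \<mu>_def)
qed

text \<open>Dominated convergence over the circle. Such averages depend only on the orbit, which
  makes them continuous test functions on the orbit space.\<close>

lemma orbit_average_continuous:
  fixes f :: "'b \<Rightarrow> real"
  assumes f: "continuous_on UNIV f" and bound: "\<And>x. \<bar>f x\<bar> \<le> 1"
  shows "continuous_on K (\<lambda>z. \<integral>p. f (rot p z) \<partial>circle_haar)"
proof (rule continuous_on_sequentiallyI)
  fix u z assume u: "\<forall>n. u n \<in> K" and z: "z \<in> K" and lim: "u \<longlonglongrightarrow> z"
  interpret haar: prob_space circle_haar by (rule prob_space_haar)
  have fm: "f \<in> borel_measurable borel" using f by (rule borel_measurable_continuous_onI)
  have m: "(\<lambda>p. f (rot p x)) \<in> borel_measurable circle_haar" if "x \<in> K" for x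
  proof -
    have "(\<lambda>p. rot p x) \<in> borel_measurable circle_haar" using haar_rot[OF that] by (simp add: measurable_borel_on_iff)
    then show ?thesis by (rule measurable_compose[OF _ fm])
  qed
  show "(\<lambda>n. \<integral>p. f (rot p (u n)) \<partial>circle_haar) \<longlonglongrightarrow> (\<integral>p. f (rot p z) \<partial>circle_haar)"
  proof (rule integral_dominated_convergence[where w="\<lambda>_. 1"])
    show "AE p in circle_haar. (\<lambda>n. f (rot p (u n))) \<longlonglongrightarrow> f (rot p z)"
    proof (rule AE_I2)
      fix p
      have "continuous_on UNIV (\<lambda>x. f (rot p x))"
        by (rule continuous_on_compose2[OF f linear_continuous_on_compose[OF continuous_on_id rot_linear]]) auto
      then show "(\<lambda>n. f (rot p (u n))) \<longlonglongrightarrow> f (rot p z)"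
        using lim by (auto simp: continuous_on_eq_continuous_at intro!: isCont_tendsto_compose[of z "\<lambda>x. f (rot p x)"])
    qed
  qed (use m u z bound in auto)
qed

text \<open>Traces of open sets are stable under intersection and generate the Borel sets of K, so
  they suffice. The indicator of an open \<open>S\<close> is the pointwise limit of the continuous
  functions \<open>f n\<close>, and their orbit averages are measurable on the orbit space.\<close>

lemma orbit_measure_measurable: "orbit_measure act B K \<in> HB \<rightarrow>\<^sub>M prob_algebra (borel_on K)"
proof (rule measurable_prob_algebra_generated[where \<Omega>=K and G="(\<inter>) K ` {S. open S}"])
  show "sets (borel_on K) = sigma_sets K ((\<inter>) K ` {S. open S})"
  proof -
    have "K \<in> sets borel" using K_closed by (rule borel_closed)
    then have "(\<inter>) K ` sigma_sets UNIV {S. open S} = sigma_sets K ((\<inter>) K ` {S. open S})"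
      by (intro sigma_sets_Int) (simp_all add: sets_borel)
    then show ?thesis by (simp add: borel_on_def sets_restrict_space sets_borel)
  qed
  show "Int_stable ((\<inter>) K ` {S. open S})"
  proof (rule Int_stableI)
    fix a b :: "'b set" assume "a \<in> (\<inter>) K ` {S. open S}" "b \<in> (\<inter>) K ` {S. open S}"
    then obtain S T where "open S" "open T" "a = K \<inter> S" "b = K \<inter> T" by auto
    then have "open (S \<inter> T)" "a \<inter> b = K \<inter> (S \<inter> T)" by auto
    then show "a \<inter> b \<in> (\<inter>) K ` {S. open S}" by blast
  qed
  show "(\<inter>) K ` {S. open S} \<subseteq> Pow K" by auto
  show "prob_space (orbit_measure act B K X)" "sets (orbit_measure act B K X) = sets (borel_on K)" if "X \<in> space HB" for X
    using that by (auto elim!: space_HB_E simp: orbit_measure_orb \<mu>_prob \<mu>_sets)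
  fix A assume "A \<in> (\<inter>) K ` {S. open S}"
  then obtain S where S: "open S" "A = K \<inter> S" by auto
  define f where "f n x = min 1 (real n * infdist x (- S))" for n x
  have fc: "continuous_on UNIV (f n)" for n
    unfolding f_def by (intro continuous_intros)
  have fb: "\<bar>f n x\<bar> \<le> 1" for n x by (auto simp: f_def infdist_nonneg)
  have A: "A \<in> sets (borel_on K)" unfolding S(2) by (rule open_in_borel_on[OF openin_open_Int[OF S(1)]])
  have meas: "(\<lambda>X. measure (orbit_measure act B K X) A) \<in> borel_measurable HB"
  \<comment> \<open>\<open>infdist\<close> to the empty complement is 0 by convention, so the
    functions \<open>f n\<close> would vanish identically instead of approximating the
    indicator.\<close>
  proof (cases "S = UNIV")
    case True
    have "measure (orbit_measure act B K X) A = 1" if X: "X \<in> space HB" for X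
    proof -
      obtain z where z: "z \<in> K" "X = orb z" by (rule space_HB_E[OF X])
      have "space (\<mu> z) = K" using sets_eq_imp_space_eq[OF \<mu>_sets] by simp
      with prob_space.prob_space[OF \<mu>_prob[OF z(1)]] show ?thesis
        using True by (simp add: z(2) orbit_measure_orb[OF z(1)] S(2))
    qed
    then show ?thesis by (subst measurable_cong[where g="\<lambda>_. 1"]) simp_all
  next
    case False
    define g where "g n X = (\<integral>x. f n x \<partial>(orbit_measure act B K X))" for n X
    have fm: "f n \<in> borel_measurable (borel_on K)" for n
      using borel_measurable_continuous_onI[OF fc] unfolding borel_on_def by (rule measurable_restrict_space1)
    have g: "g n (orb z) = (\<integral>p. f n (rot p z) \<partial>circle_haar)" if "z \<in> K" for n z
      unfolding g_def orbit_measure_orb[OF that] \<mu>_def by (rule integral_distr[OF haar_rot[OF that] fm])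
    have gm: "g n \<in> borel_measurable HB" for n
    proof (rule borel_measurable_HB)
      show "continuous_on K (\<lambda>z. g n (orb z))"
        using orbit_average_continuous[OF fc fb, of n] by (rule continuous_on_eq) (simp add: g)
    qed
    have lim: "(\<lambda>n. g n X) \<longlonglongrightarrow> measure (orbit_measure act B K X) A" if X: "X \<in> space HB" for X
    proof -
      obtain z where z: "z \<in> K" "X = orb z" by (rule space_HB_E[OF X])
      interpret p: prob_space "\<mu> z" by (rule \<mu>_prob[OF z(1)])
      have sp: "space (\<mu> z) = K" using sets_eq_imp_space_eq[OF \<mu>_sets] by simp
      have "(\<lambda>n. \<integral>x. f n x \<partial>\<mu> z) \<longlonglongrightarrow> (\<integral>x. indicator A x \<partial>\<mu> z)"
      proof (rule integral_dominated_convergence[where w="\<lambda>_. 1"])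
        show "AE x in \<mu> z. (\<lambda>n. f n x) \<longlonglongrightarrow> indicator A x"
        proof (rule AE_I2)
          fix x assume "x \<in> space (\<mu> z)"
          then have x: "x \<in> K" by (simp add: sp)
          show "(\<lambda>n. f n x) \<longlonglongrightarrow> indicator A x"
          proof (cases "x \<in> S")
            case True
            have "infdist x (- S) \<noteq> 0"
              using in_closed_iff_infdist_zero[of "- S" x] S(1) False True by auto
            then have d: "0 < infdist x (- S)" using infdist_nonneg[of x "- S"] by linarith
            obtain N where N: "1 < real N * infdist x (- S)" using reals_Archimedean3[OF d] by blast
            have "f n x = 1" if "n \<ge> N" for n
            proof -
              have "real N * infdist x (- S) \<le> real n * infdist x (- S)" using that d by (intro mult_right_mono) auto
              then show ?thesis using N by (simp add: f_def)
            qed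
            then have "\<forall>\<^sub>F n in sequentially. f n x = 1" unfolding eventually_sequentially by blast
            then show ?thesis using True x by (auto simp: S(2) tendsto_eventually)
          next
            case False
            then have "f n x = 0" for n by (simp add: f_def)
            then show ?thesis using False by (simp add: S(2))
          qed
        qed
      qed (use fm A fb in \<open>simp_all add: measurable_cong_sets[OF \<mu>_sets refl]\<close>)
      moreover have "(\<integral>x. indicator A x \<partial>\<mu> z) = measure (\<mu> z) A"
      proof -
        have "A \<inter> K = A" using S(2) by auto
        then show ?thesis using A by (simp add: \<mu>_sets sp)
      qed
      ultimately show ?thesis by (simp add: g_def z(2) orbit_measure_orb[OF z(1)])
    qed
    show ?thesis by (rule borel_measurable_LIMSEQ_real[OF lim gm])
  qed
  have "emeasure (orbit_measure act B K X) A = ennreal (measure (orbit_measure act B K X) A)" if X: "X \<in> space HB" for X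
  proof -
    obtain z where z: "z \<in> K" "X = orb z" by (rule space_HB_E[OF X])
    interpret p: prob_space "\<mu> z" by (rule \<mu>_prob[OF z(1)])
    show ?thesis by (simp add: z(2) orbit_measure_orb[OF z(1)] p.emeasure_eq_measure)
  qed
  then show "(\<lambda>X. emeasure (orbit_measure act B K X) A) \<in> borel_measurable HB"
    using meas by (subst measurable_cong[where g="\<lambda>X. ennreal (measure (orbit_measure act B K X) A)"]) auto
qed

definition circle_invariants :: "'b measure set" where
  "circle_invariants = {\<nu> \<in> borel_probabilities (borel_on K). \<forall>p\<in>circle. distr \<nu> (borel_on K) (rot p) = \<nu>}"

text \<open>\<open>measure_of\<close> returns its set function only if that is a measure. The
  monadic bind is a measure with the same values, so countable additivity and total mass 1 come from
  the measurability of the kernel.\<close>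

lemma orbit_mixture_bind:
  assumes \<theta>: "\<theta> \<in> borel_probabilities HB"
  shows "orbit_mixture act B K \<theta> = \<theta> \<bind> orbit_measure act B K"
    and "J \<in> sets (borel_on K) \<Longrightarrow> emeasure (orbit_mixture act B K \<theta>) J = (\<integral>\<^sup>+X. emeasure (orbit_measure act B K X) J \<partial>\<theta>)"
    and "orbit_mixture act B K \<theta> \<in> borel_probabilities (borel_on K)"
proof -
  have \<theta>': "\<theta> \<in> space (prob_algebra HB)" using \<theta> by (simp add: borel_probabilities_def)
  let ?b = "\<theta> \<bind> orbit_measure act B K"
  have sb: "sets ?b = sets (borel_on K)" by (rule sets_bind'[OF \<theta>' orbit_measure_measurable])
  have spb: "space ?b = K" using sets_eq_imp_space_eq[OF sb] by simp
  have em: "emeasure ?b J = (\<integral>\<^sup>+X. emeasure (orbit_measure act B K X) J \<partial>\<theta>)" if "J \<in> sets (borel_on K)" for J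
    by (rule emeasure_bind_prob_algebra[OF \<theta>' orbit_measure_measurable that])
  have "orbit_mixture act B K \<theta> = measure_of K (sets (borel_on K)) (emeasure ?b)"
    unfolding orbit_mixture_def
  proof (rule measure_of_eq)
    show "sets (borel_on K) \<subseteq> Pow K" using sets.space_closed[of "borel_on K"] by simp
    fix J assume "J \<in> sigma_sets K (sets (borel_on K))"
    then have "J \<in> sets (borel_on K)" using sets.sigma_sets_eq[of "borel_on K"] by simp
    then show "(\<integral>\<^sup>+X. emeasure (orbit_measure act B K X) J \<partial>\<theta>) = emeasure ?b J" by (simp add: em)
  qed
  also have "\<dots> = ?b" using measure_of_of_measure[of ?b] by (simp add: sb spb)
  finally show eq: "orbit_mixture act B K \<theta> = ?b" .
  show "J \<in> sets (borel_on K) \<Longrightarrow> emeasure (orbit_mixture act B K \<theta>) J = (\<integral>\<^sup>+X. emeasure (orbit_measure act B K X) J \<partial>\<theta>)"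
    unfolding eq by (rule em)
  show "orbit_mixture act B K \<theta> \<in> borel_probabilities (borel_on K)"
    unfolding eq borel_probabilities_def space_prob_algebra
    using sb prob_space_bind'[OF \<theta>' orbit_measure_measurable] by simp
qed

lemma borel_probabilitiesD:
  assumes "\<nu> \<in> borel_probabilities N"
  shows "sets \<nu> = sets N" "space \<nu> = space N" "prob_space \<nu>"
  using assms by (auto simp: borel_probabilities_def space_prob_algebra dest: sets_eq_imp_space_eq)

lemma emeasure_orbit_measure_rot:
  assumes p: "p \<in> circle" and J: "J \<in> sets (borel_on K)" and X: "X \<in> space HB"
  shows "emeasure (orbit_measure act B K X) {z \<in> K. rot p z \<in> J} = emeasure (orbit_measure act B K X) J"
proof -
  obtain z where z: "z \<in> K" "X = orb z" by (rule space_HB_E[OF X])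
  have sp: "space (\<mu> z) = K" using sets_eq_imp_space_eq[OF \<mu>_sets] by simp
  have "emeasure (\<mu> z) J = emeasure (distr (\<mu> z) (borel_on K) (rot p)) J" by (simp add: \<mu>_rot_invariant[OF p z(1)])
  also have "\<dots> = emeasure (\<mu> z) (rot p -` J \<inter> space (\<mu> z))"
    by (rule emeasure_distr[OF _ J]) (simp add: measurable_cong_sets[OF \<mu>_sets refl] rot_measurable[OF p])
  also have "rot p -` J \<inter> space (\<mu> z) = {z \<in> K. rot p z \<in> J}" by (auto simp: sp)
  finally show ?thesis by (simp add: z orbit_measure_orb[OF z(1)])
qed

lemma rot_preimage_sets: "p \<in> circle \<Longrightarrow> J \<in> sets (borel_on K) \<Longrightarrow> {z \<in> K. rot p z \<in> J} \<in> sets (borel_on K)"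
  using measurable_sets[OF rot_measurable, of p J] by (simp add: vimage_def Collect_conj_eq Int_commute)

lemma emeasure_distr_rot:
  assumes \<nu>: "\<nu> \<in> borel_probabilities (borel_on K)" and p: "p \<in> circle" and J: "J \<in> sets (borel_on K)"
  shows "emeasure (distr \<nu> (borel_on K) (rot p)) J = emeasure \<nu> {z \<in> K. rot p z \<in> J}"
proof -
  note \<nu> = borel_probabilitiesD[OF \<nu>]
  have "emeasure (distr \<nu> (borel_on K) (rot p)) J = emeasure \<nu> (rot p -` J \<inter> space \<nu>)"
    by (rule emeasure_distr[OF _ J]) (simp add: measurable_cong_sets[OF \<nu>(1) refl] rot_measurable[OF p])
  also have "rot p -` J \<inter> space \<nu> = {z \<in> K. rot p z \<in> J}" by (auto simp: \<nu>)
  finally show ?thesis .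
qed

lemma circle_invariants_iff:
  "\<nu> \<in> circle_invariants \<longleftrightarrow> \<nu> \<in> borel_probabilities (borel_on K) \<and>
    (\<forall>p\<in>circle. \<forall>J\<in>sets (borel_on K). emeasure \<nu> {z \<in> K. rot p z \<in> J} = emeasure \<nu> J)"
proof (cases "\<nu> \<in> borel_probabilities (borel_on K)")
  case True
  have "distr \<nu> (borel_on K) (rot p) = \<nu> \<longleftrightarrow> (\<forall>J\<in>sets (borel_on K). emeasure \<nu> {z \<in> K. rot p z \<in> J} = emeasure \<nu> J)"
    if p: "p \<in> circle" for p
  proof
    assume "distr \<nu> (borel_on K) (rot p) = \<nu>"
    then show "\<forall>J\<in>sets (borel_on K). emeasure \<nu> {z \<in> K. rot p z \<in> J} = emeasure \<nu> J"
      using emeasure_distr_rot[OF True p] by simp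
  next
    assume *: "\<forall>J\<in>sets (borel_on K). emeasure \<nu> {z \<in> K. rot p z \<in> J} = emeasure \<nu> J"
    show "distr \<nu> (borel_on K) (rot p) = \<nu>"
      by (rule measure_eqI) (simp_all add: borel_probabilitiesD[OF True] emeasure_distr_rot[OF True p] *)
  qed
  then show ?thesis using True by (simp add: circle_invariants_def)
qed (simp add: circle_invariants_def)

lemma orbit_mixture_invariant:
  assumes \<theta>: "\<theta> \<in> borel_probabilities HB"
  shows "orbit_mixture act B K \<theta> \<in> circle_invariants"
  unfolding circle_invariants_iff
proof (intro conjI ballI orbit_mixture_bind(3)[OF \<theta>])
  fix p :: complex and J assume p: "p \<in> circle" and J: "J \<in> sets (borel_on K)"
  show "emeasure (orbit_mixture act B K \<theta>) {z \<in> K. rot p z \<in> J} = emeasure (orbit_mixture act B K \<theta>) J"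
    unfolding orbit_mixture_bind(2)[OF \<theta> J] orbit_mixture_bind(2)[OF \<theta> rot_preimage_sets[OF p J]]
    by (rule nn_integral_cong) (simp add: borel_probabilitiesD[OF \<theta>] emeasure_orbit_measure_rot[OF p J])
qed

text \<open>Provides the left inverse of the mixture map, hence its injectivity.\<close>

lemma distr_orb_orbit_mixture:
  assumes \<theta>: "\<theta> \<in> borel_probabilities HB"
  shows "distr (orbit_mixture act B K \<theta>) HB orb = \<theta>"
proof (rule measure_eqI)
  note \<nu> = borel_probabilitiesD[OF orbit_mixture_bind(3)[OF \<theta>]]
  show "sets (distr (orbit_mixture act B K \<theta>) HB orb) = sets \<theta>" by (simp add: borel_probabilitiesD[OF \<theta>])
  fix E assume "E \<in> sets (distr (orbit_mixture act B K \<theta>) HB orb)"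
  then have E: "E \<in> sets HB" by simp
  have E': "orb -` E \<inter> K \<in> sets (borel_on K)" using measurable_sets[OF orb_measurable E] by simp
  have "emeasure (distr (orbit_mixture act B K \<theta>) HB orb) E = emeasure (orbit_mixture act B K \<theta>) (orb -` E \<inter> K)"
    using orb_measurable by (subst emeasure_distr[OF _ E]) (simp_all add: measurable_cong_sets[OF \<nu>(1) refl] \<nu>(2))
  also have "\<dots> = (\<integral>\<^sup>+X. emeasure (orbit_measure act B K X) (orb -` E \<inter> K) \<partial>\<theta>)"
    by (rule orbit_mixture_bind(2)[OF \<theta> E'])
  also have "\<dots> = (\<integral>\<^sup>+X. indicator E X \<partial>\<theta>)"
  proof (rule nn_integral_cong)
    fix X assume "X \<in> space \<theta>"
    then have X: "X \<in> space HB" by (simp add: borel_probabilitiesD[OF \<theta>])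
    obtain z where z: "z \<in> K" "X = orb z" by (rule space_HB_E[OF X])
    have "emeasure (\<mu> z) (orb -` E \<inter> K) = emeasure circle_haar ((\<lambda>p. rot p z) -` (orb -` E \<inter> K) \<inter> space circle_haar)"
      unfolding \<mu>_def by (rule emeasure_distr[OF haar_rot[OF z(1)] E'])
    \<comment> \<open>The projection is constant along one orbit, so the preimage is the whole
      circle or empty.\<close>
    also have "(\<lambda>p. rot p z) -` (orb -` E \<inter> K) \<inter> space circle_haar = (if orb z \<in> E then space circle_haar else {})"
      using orb_rot[of _ z] K_rot[OF _ z(1)] by (auto simp: space_haar)
    also have "emeasure circle_haar \<dots> = indicator E X"
      using prob_space.emeasure_space_1[OF prob_space_haar] by (simp add: z(2))
    finally show "emeasure (orbit_measure act B K X) (orb -` E \<inter> K) = indicator E X"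
      by (simp add: z(2) orbit_measure_orb[OF z(1)])
  qed
  also have "\<dots> = emeasure \<theta> E" using E by (simp add: borel_probabilitiesD[OF \<theta>])
  finally show "emeasure (distr (orbit_mixture act B K \<theta>) HB orb) E = emeasure \<theta> E" .
qed

text \<open>After a change of variables along the projection, the mixture of \<open>J\<close> is the
  circle average of the indicator at rotated points, integrated over \<nu>. By Fubini it equals the
  Haar average of the \<nu>-measures of rotated preimages of \<open>J\<close>, all of which are
  \<nu> of \<open>J\<close>. This gives surjectivity.\<close>

lemma orbit_mixture_distr_orb:
  assumes \<nu>: "\<nu> \<in> circle_invariants"
  shows "distr \<nu> HB orb \<in> borel_probabilities HB" and "orbit_mixture act B K (distr \<nu> HB orb) = \<nu>"
proof -
  have \<nu>p: "\<nu> \<in> borel_probabilities (borel_on K)"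
    and inv: "\<And>p J. p \<in> circle \<Longrightarrow> J \<in> sets (borel_on K) \<Longrightarrow> emeasure \<nu> {z \<in> K. rot p z \<in> J} = emeasure \<nu> J"
    using \<nu> unfolding circle_invariants_iff by auto
  note \<nu>' = borel_probabilitiesD[OF \<nu>p]
  interpret \<nu>: prob_space \<nu> by (rule \<nu>'(3))
  interpret haar: prob_space circle_haar by (rule prob_space_haar)
  interpret pair_sigma_finite circle_haar \<nu> ..
  have om: "orb \<in> \<nu> \<rightarrow>\<^sub>M HB" using orb_measurable by (simp add: measurable_cong_sets[OF \<nu>'(1) refl])
  show \<theta>: "distr \<nu> HB orb \<in> borel_probabilities HB"
    unfolding borel_probabilities_def space_prob_algebra by (simp add: \<nu>.prob_space_distr[OF om])
  show "orbit_mixture act B K (distr \<nu> HB orb) = \<nu>"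
  proof (rule measure_eqI)
    show "sets (orbit_mixture act B K (distr \<nu> HB orb)) = sets \<nu>"
      by (simp add: borel_probabilitiesD[OF orbit_mixture_bind(3)[OF \<theta>]] \<nu>')
    fix J assume "J \<in> sets (orbit_mixture act B K (distr \<nu> HB orb))"
    then have J: "J \<in> sets (borel_on K)" by (simp add: borel_probabilitiesD[OF orbit_mixture_bind(3)[OF \<theta>]])
    have m2: "(\<lambda>x. rot (fst x) (snd x)) \<in> circle_haar \<Otimes>\<^sub>M \<nu> \<rightarrow>\<^sub>M borel_on K"
      using rot_measurable2 by (simp add: measurable_cong_sets[OF sets_pair_measure_cong[OF sets_haar \<nu>'(1)] refl])
    have ind: "(\<lambda>(p, z). indicator J (rot p z) :: ennreal) \<in> borel_measurable (circle_haar \<Otimes>\<^sub>M \<nu>)"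
      using measurable_compose[OF m2 borel_measurable_indicator[OF J]] by (simp add: split_beta')
    have "(\<lambda>X. emeasure (orbit_measure act B K X) J) \<in> borel_measurable HB"
      by (rule measurable_compose[OF measurable_prob_algebraD[OF orbit_measure_measurable] measurable_emeasure_subprob_algebra[OF J]])
    then have "emeasure (orbit_mixture act B K (distr \<nu> HB orb)) J = (\<integral>\<^sup>+z. emeasure (orbit_measure act B K (orb z)) J \<partial>\<nu>)"
      unfolding orbit_mixture_bind(2)[OF \<theta> J]
      using nn_integral_distr[OF om, of "\<lambda>X. emeasure (orbit_measure act B K X) J"] by simp
    also have "\<dots> = (\<integral>\<^sup>+z. (\<integral>\<^sup>+p. indicator J (rot p z) \<partial>circle_haar) \<partial>\<nu>)"
    proof (rule nn_integral_cong)
      fix z assume "z \<in> space \<nu>"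
      then have z: "z \<in> K" by (simp add: \<nu>')
      have "emeasure (\<mu> z) J = (\<integral>\<^sup>+x. indicator J x \<partial>\<mu> z)" using J by (simp add: \<mu>_sets)
      also have "\<dots> = (\<integral>\<^sup>+p. indicator J (rot p z) \<partial>circle_haar)"
        unfolding \<mu>_def using borel_measurable_indicator[OF J] by (intro nn_integral_distr[OF haar_rot[OF z]]) simp
      finally show "emeasure (orbit_measure act B K (orb z)) J = (\<integral>\<^sup>+p. indicator J (rot p z) \<partial>circle_haar)"
        by (simp add: orbit_measure_orb[OF z])
    qed
    also have "\<dots> = (\<integral>\<^sup>+p. (\<integral>\<^sup>+z. indicator J (rot p z) \<partial>\<nu>) \<partial>circle_haar)"
      by (rule Fubini'[OF ind])
    also have "\<dots> = (\<integral>\<^sup>+p. emeasure \<nu> J \<partial>circle_haar)"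
    proof (rule nn_integral_cong)
      fix p assume "p \<in> space circle_haar"
      then have p: "p \<in> circle" by (simp add: space_haar)
      have "(\<integral>\<^sup>+z. indicator J (rot p z) \<partial>\<nu>) = (\<integral>\<^sup>+z. indicator {z \<in> K. rot p z \<in> J} z \<partial>\<nu>)"
        by (rule nn_integral_cong) (auto simp: \<nu>' split: split_indicator)
      also have "\<dots> = emeasure \<nu> {z \<in> K. rot p z \<in> J}"
        using rot_preimage_sets[OF p J] by (simp add: \<nu>')
      also have "\<dots> = emeasure \<nu> J" by (rule inv[OF p J])
      finally show "(\<integral>\<^sup>+z. indicator J (rot p z) \<partial>\<nu>) = emeasure \<nu> J" .
    qed
    also have "\<dots> = emeasure \<nu> J" by (simp add: haar.emeasure_space_1)
    finally show "emeasure (orbit_mixture act B K (distr \<nu> HB orb)) J = emeasure \<nu> J" .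
  qed
qed

theorem orbit_mixture_bij:
  "bij_betw (orbit_mixture act B K) (borel_probabilities HB) circle_invariants"
  by (rule bij_betw_byWitness[where f'="\<lambda>\<nu>. distr \<nu> HB orb"])
    (auto simp: distr_orb_orbit_mixture orbit_mixture_distr_orb orbit_mixture_invariant)

end

section \<open>Asymptotic shift invariance of Gaussian transition laws\<close>

section \<open>Invariance under the transition kernels\<close>

text \<open>The integral is the total variation distance between a centred Gaussian and its
  translate by \<open>d\<close>. Rescaling to unit variance reduces the translation to d / (n + 1),
  and the standard density dominates the positive part.\<close>

lemma normal_density_shift_tendsto:
  "(\<lambda>n. \<integral>\<^sup>+x. ennreal (max 0 (normal_density 0 (real (Suc n)) x - normal_density 0 (real (Suc n)) (x - d))) \<partial>lborel) \<longlonglongrightarrow> 0"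
proof -
  define f where "f n y = max 0 (std_normal_density y - std_normal_density (y - d / real (Suc n)))" for n y
  have "(\<integral>\<^sup>+x. ennreal (max 0 (normal_density 0 (real (Suc n)) x - normal_density 0 (real (Suc n)) (x - d))) \<partial>lborel)
      = (\<integral>\<^sup>+y. ennreal (f n y) \<partial>lborel)" for n
  proof -
    define s where "s = real (Suc n)"
    have s: "0 < s" by (simp add: s_def)
    have nd: "s * normal_density 0 s x = std_normal_density (x / s)" for x
      using s by (simp add: normal_density_def real_sqrt_mult power_divide)
    have eq: "s * max 0 (normal_density 0 s (s * y) - normal_density 0 s (s * y - d)) = f n y" for y
    proof -
      have "s * max 0 (normal_density 0 s (s * y) - normal_density 0 s (s * y - d))
        = max 0 (s * normal_density 0 s (s * y) - s * normal_density 0 s (s * y - d))"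
        using s by (simp add: max_mult_distrib_left right_diff_distrib)
      also have "\<dots> = f n y"
        unfolding nd f_def s_def[symmetric] using s by (simp add: diff_divide_distrib)
      finally show ?thesis .
    qed
    \<comment> \<open>The substitution x = s y brings a Jacobian factor s, exactly the factor that
      turns the density of standard deviation s into the standard one.\<close>
    have "(\<integral>\<^sup>+x. ennreal (max 0 (normal_density 0 s x - normal_density 0 s (x - d))) \<partial>lborel)
      = \<bar>s\<bar> * (\<integral>\<^sup>+y. ennreal (max 0 (normal_density 0 s (0 + s * y) - normal_density 0 s (0 + s * y - d))) \<partial>lborel)"
      by (rule nn_integral_real_affine) (use s in auto)
    also have "\<dots> = (\<integral>\<^sup>+y. ennreal s * ennreal (max 0 (normal_density 0 s (s * y) - normal_density 0 s (s * y - d))) \<partial>lborel)"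
      using s by (subst nn_integral_cmult) auto
    also have "\<dots> = (\<integral>\<^sup>+y. ennreal (f n y) \<partial>lborel)"
      by (simp only: eq[symmetric] ennreal_mult'[OF less_imp_le[OF s]])
    finally show ?thesis by (simp only: s_def)
  qed
  moreover have "(\<lambda>n. \<integral>\<^sup>+y. ennreal (f n y) \<partial>lborel) \<longlonglongrightarrow> (\<integral>\<^sup>+(y::real). 0 \<partial>lborel)"
  proof (rule nn_integral_dominated_convergence[where w="\<lambda>y. ennreal (std_normal_density y)"])
    show "(\<integral>\<^sup>+y. ennreal (std_normal_density y) \<partial>lborel) < \<infinity>"
      by (simp add: nn_integral_eq_integral)
    show "AE y in lborel. ennreal (f n y) \<le> ennreal (std_normal_density y)" for n
      by (intro AE_I2 ennreal_leI) (simp add: f_def)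
    show "AE y in lborel. (\<lambda>n. ennreal (f n y)) \<longlonglongrightarrow> 0"
    proof (rule AE_I2)
      fix y :: real
      have "(\<lambda>n. d / real (Suc n)) \<longlonglongrightarrow> 0"
        using tendsto_mult[OF tendsto_const[of d] LIMSEQ_inverse_real_of_nat] by (simp add: divide_inverse)
      then have "(\<lambda>n. max 0 (std_normal_density y - std_normal_density (y - d / real (Suc n)))) \<longlonglongrightarrow> max 0 (std_normal_density y - std_normal_density (y - 0))"
        unfolding std_normal_density_def by (intro tendsto_intros) simp_all
      then have "(\<lambda>n. ennreal (f n y)) \<longlonglongrightarrow> ennreal 0" unfolding f_def by (intro tendsto_ennrealI) simp
      then show "(\<lambda>n. ennreal (f n y)) \<longlonglongrightarrow> 0" by simp
    qed
  qed (auto simp: f_def)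
  ultimately show ?thesis by simp
qed

locale flow_diffusion = wiener M F W + circle_flow b r act B K
  for M :: "'w measure" and F :: "real \<Rightarrow> 'w measure" and W :: "real \<Rightarrow> 'w \<Rightarrow> real"
    and b :: "'b::euclidean_space \<Rightarrow> 'b" and r :: real
    and act :: "real^3^3 \<Rightarrow> 'b \<Rightarrow> 'b" and B :: "real^3^3" and K :: "'b set" +
  fixes \<alpha> :: real and Z :: "'b \<Rightarrow> real \<Rightarrow> 'w \<Rightarrow> 'b"
  assumes Z_measurable: "z \<in> K \<Longrightarrow> 0 \<le> t \<Longrightarrow> Z z t \<in> M \<rightarrow>\<^sub>M borel_on K"
    and Z_eq: "z \<in> K \<Longrightarrow> 0 \<le> t \<Longrightarrow> AE \<omega> in M. Z z t \<omega> = rot (cis (r * (\<alpha> * t + W t \<omega>))) z"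
begin

definition phase :: "real \<Rightarrow> 'w \<Rightarrow> complex" where "phase t \<omega> = cis (r * (\<alpha> * t + W t \<omega>))"

lemma cis_borel: "(\<lambda>x::real. cis (r * (a + x))) \<in> borel \<rightarrow>\<^sub>M borel_on circle"
  unfolding measurable_borel_on_iff
  by (auto intro!: borel_measurable_continuous_onI continuous_intros)

lemma phase_measurable: "0 \<le> t \<Longrightarrow> phase t \<in> M \<rightarrow>\<^sub>M borel_on circle"
  unfolding phase_def[abs_def] by (rule measurable_compose[OF W_measurable cis_borel])

lemma rot_indicator_measurable:
  assumes J: "J \<in> sets (borel_on K)" and f: "f \<in> N \<rightarrow>\<^sub>M borel_on circle" and N': "sets N' = sets (borel_on K)"
  shows "(\<lambda>(x, z). indicator J (rot (f x) z) :: ennreal) \<in> borel_measurable (N \<Otimes>\<^sub>M N')"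
proof -
  have "(\<lambda>x. (f (fst x), snd x)) \<in> N \<Otimes>\<^sub>M borel_on K \<rightarrow>\<^sub>M borel_on circle \<Otimes>\<^sub>M borel_on K"
    by (intro measurable_Pair measurable_compose[OF measurable_fst f] measurable_snd)
  from measurable_compose[OF measurable_compose[OF this rot_measurable2] borel_measurable_indicator[OF J]]
  show ?thesis
    by (simp add: split_beta' measurable_cong_sets[OF sets_pair_measure_cong[OF refl N'] refl])
qed

text \<open>The solution is known measurable in \<omega> for each starting point. The explicit flow
  is measurable in \<omega> and \<open>z\<close> jointly, so this form of the transition probability
  admits Fubini and integration over the starting point.\<close>

lemma transition_eq:
  assumes z: "z \<in> K" and t: "0 \<le> t" and J: "J \<in> sets (borel_on K)"
  shows "emeasure M {\<omega> \<in> space M. Z z t \<omega> \<in> J} = (\<integral>\<^sup>+\<omega>. indicator J (rot (phase t \<omega>) z) \<partial>M)"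
proof -
  have m: "(\<lambda>\<omega>. rot (phase t \<omega>) z) \<in> M \<rightarrow>\<^sub>M borel_on K"
    by (rule measurable_compose[OF phase_measurable[OF t] rot_measurable_point[OF z]])
  have s1: "{\<omega> \<in> space M. Z z t \<omega> \<in> J} \<in> sets M"
    using measurable_sets[OF Z_measurable[OF z t] J] by (simp add: vimage_def Collect_conj_eq Int_commute)
  have s2: "{\<omega> \<in> space M. rot (phase t \<omega>) z \<in> J} \<in> sets M"
    using measurable_sets[OF m J] by (simp add: vimage_def Collect_conj_eq Int_commute)
  have "emeasure M {\<omega> \<in> space M. Z z t \<omega> \<in> J} = emeasure M {\<omega> \<in> space M. rot (phase t \<omega>) z \<in> J}"
    using Z_eq[OF z t] by (intro emeasure_eq_AE s1 s2) (auto simp: phase_def)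
  also have "\<dots> = (\<integral>\<^sup>+\<omega>. indicator {\<omega> \<in> space M. rot (phase t \<omega>) z \<in> J} \<omega> \<partial>M)" using s2 by simp
  also have "\<dots> = (\<integral>\<^sup>+\<omega>. indicator J (rot (phase t \<omega>) z) \<partial>M)"
    by (rule nn_integral_cong) (auto split: split_indicator)
  finally show ?thesis .
qed

text \<open>For a fixed \<omega> the flow at time \<open>t\<close> is a single rotation and
  preserves \<nu>; averaging over \<omega> after Fubini changes nothing.\<close>

lemma circle_invariant_is_invariant:
  assumes \<nu>: "\<nu> \<in> circle_invariants"
  shows "\<nu> \<in> invariant_measures M K Z"
  unfolding invariant_measures_def
proof (intro CollectI conjI allI impI ballI)
  show \<nu>p: "\<nu> \<in> borel_probabilities (borel_on K)" using \<nu> by (simp add: circle_invariants_def)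
  note \<nu>' = borel_probabilitiesD[OF \<nu>p]
  fix t :: real and J assume t: "0 \<le> t" and J: "J \<in> sets (borel_on K)"
  interpret \<nu>: prob_space \<nu> by (rule \<nu>'(3))
  interpret pair_sigma_finite M \<nu> ..
  have "(\<integral>\<^sup>+z. emeasure M {\<omega> \<in> space M. Z z t \<omega> \<in> J} \<partial>\<nu>) = (\<integral>\<^sup>+z. (\<integral>\<^sup>+\<omega>. indicator J (rot (phase t \<omega>) z) \<partial>M) \<partial>\<nu>)"
    by (rule nn_integral_cong) (simp add: \<nu>' transition_eq[OF _ t J])
  also have "\<dots> = (\<integral>\<^sup>+\<omega>. (\<integral>\<^sup>+z. indicator J (rot (phase t \<omega>) z) \<partial>\<nu>) \<partial>M)"
    by (rule Fubini'[OF rot_indicator_measurable[OF J phase_measurable[OF t] \<nu>'(1)]])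
  also have "\<dots> = (\<integral>\<^sup>+\<omega>. emeasure \<nu> J \<partial>M)"
  proof (rule nn_integral_cong)
    fix \<omega> assume "\<omega> \<in> space M"
    have p: "phase t \<omega> \<in> circle" by (simp add: phase_def)
    have "(\<integral>\<^sup>+z. indicator J (rot (phase t \<omega>) z) \<partial>\<nu>) = (\<integral>\<^sup>+z. indicator {z \<in> K. rot (phase t \<omega>) z \<in> J} z \<partial>\<nu>)"
      by (rule nn_integral_cong) (auto simp: \<nu>' split: split_indicator)
    also have "\<dots> = emeasure \<nu> {z \<in> K. rot (phase t \<omega>) z \<in> J}"
      using rot_preimage_sets[OF p J] by (simp add: \<nu>')
    also have "\<dots> = emeasure \<nu> J" using \<nu> p J by (simp add: circle_invariants_iff)
    finally show "(\<integral>\<^sup>+z. indicator J (rot (phase t \<omega>) z) \<partial>\<nu>) = emeasure \<nu> J" .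
  qed
  also have "\<dots> = emeasure \<nu> J" by (simp add: emeasure_space_1)
  finally show "(\<integral>\<^sup>+z. emeasure M {\<omega> \<in> space M. Z z t \<omega> \<in> J} \<partial>\<nu>) = emeasure \<nu> J" .
qed

text \<open>At the squared time the Wiener process has standard deviation \<open>n\<close>. The law
  is known for increments, and \<open>W 0\<close> is almost surely 0.\<close>

lemma transition_density:
  assumes z: "z \<in> K" and J: "J \<in> sets (borel_on K)" and n: "0 < n"
  shows "emeasure M {\<omega> \<in> space M. Z z (n\<^sup>2) \<omega> \<in> J}
    = (\<integral>\<^sup>+x. ennreal (normal_density 0 n x) * indicator J (rot (cis (r * (\<alpha> * n\<^sup>2 + x))) z) \<partial>lborel)"
proof -
  define g where "g x = (indicator J (rot (cis (r * (\<alpha> * n\<^sup>2 + x))) z) :: ennreal)" for x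
  have gm: "g \<in> borel_measurable borel"
    unfolding g_def
    by (rule measurable_compose[OF measurable_compose[OF cis_borel rot_measurable_point[OF z]] borel_measurable_indicator[OF J]])
  have D: "distributed M lborel (\<lambda>\<omega>. W (n\<^sup>2) \<omega> - W 0 \<omega>) (normal_density 0 n)"
    using increment_distributed[of 0 "n\<^sup>2"] n by simp
  have "emeasure M {\<omega> \<in> space M. Z z (n\<^sup>2) \<omega> \<in> J} = (\<integral>\<^sup>+\<omega>. g (W (n\<^sup>2) \<omega>) \<partial>M)"
    using transition_eq[OF z _ J, of "n\<^sup>2"] by (simp add: phase_def g_def)
  also have "\<dots> = (\<integral>\<^sup>+\<omega>. g (W (n\<^sup>2) \<omega> - W 0 \<omega>) \<partial>M)"
    using W_0 by (intro nn_integral_cong_AE) auto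
  also have "\<dots> = (\<integral>\<^sup>+x. ennreal (normal_density 0 n x) * g x \<partial>lborel)"
    using distributed_nn_integral[OF D, of g] gm by simp
  finally show ?thesis by (simp add: g_def)
qed

text \<open>Invariance is evaluated at large times. A rotation by \<open>a\<close> translates the
  Gaussian phase, so the transition probabilities into \<open>J\<close> and into its preimage differ
  by at most \<open>e n\<close>, uniformly in the starting point. The estimate is one-sided because
  \<open>e n\<close> integrates the positive part of the difference of densities.\<close>

lemma invariant_rot_le:
  assumes \<nu>: "\<nu> \<in> invariant_measures M K Z" and J: "J \<in> sets (borel_on K)"
  shows "emeasure \<nu> J \<le> emeasure \<nu> {z \<in> K. rot (cis a) z \<in> J}"
proof -
  have \<nu>p: "\<nu> \<in> borel_probabilities (borel_on K)"
    and inv: "\<And>t J. 0 \<le> t \<Longrightarrow> J \<in> sets (borel_on K) \<Longrightarrow> (\<integral>\<^sup>+z. emeasure M {\<omega> \<in> space M. Z z t \<omega> \<in> J} \<partial>\<nu>) = emeasure \<nu> J"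
    using \<nu> by (auto simp: invariant_measures_def)
  note \<nu>' = borel_probabilitiesD[OF \<nu>p]
  interpret \<nu>: prob_space \<nu> by (rule \<nu>'(3))
  define J' where "J' = {z \<in> K. rot (cis a) z \<in> J}"
  have J': "J' \<in> sets (borel_on K)" unfolding J'_def by (rule rot_preimage_sets[OF _ J]) simp
  \<comment> \<open>The phase is r times the Wiener value plus a constant, so shifting W by a / r
    rotates by the angle a.\<close>
  define d where "d = a / r"
  have rd: "r * d = a" using r_pos by (simp add: d_def)
  define e where "e n = (\<integral>\<^sup>+x. ennreal (max 0 (normal_density 0 (real (Suc n)) x - normal_density 0 (real (Suc n)) (x - d))) \<partial>lborel)" for n
  have e: "e \<longlonglongrightarrow> 0" unfolding e_def by (rule normal_density_shift_tendsto)
  have "emeasure \<nu> J \<le> emeasure \<nu> J' + e n" for n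
  proof -
    define N where "N = real (Suc n)"
    have N: "0 < N" "0 \<le> N\<^sup>2" by (simp_all add: N_def)
    have kernel: "emeasure M {\<omega> \<in> space M. Z z (N\<^sup>2) \<omega> \<in> J} \<le> emeasure M {\<omega> \<in> space M. Z z (N\<^sup>2) \<omega> \<in> J'} + e n"
      if z: "z \<in> K" for z
    proof -
      define g where "g x = (indicator J (rot (cis (r * (\<alpha> * N\<^sup>2 + x))) z) :: ennreal)" for x
      have gm [measurable]: "g \<in> borel_measurable borel"
        unfolding g_def
        by (rule measurable_compose[OF measurable_compose[OF cis_borel rot_measurable_point[OF z]] borel_measurable_indicator[OF J]])
      \<comment> \<open>With the Wiener value as variable, hitting the rotated preimage means
        hitting \<open>J\<close> from the shifted value; a substitution then moves the shift from
        \<open>g\<close> to the density.\<close>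
      have shift: "indicator J' (rot (cis (r * (\<alpha> * N\<^sup>2 + x))) z) = g (x + d)" for x
      proof -
        have "rot (cis (r * (\<alpha> * N\<^sup>2 + x))) z \<in> K" by (rule K_rot[OF _ z]) simp
        moreover have "rot (cis a) (rot (cis (r * (\<alpha> * N\<^sup>2 + x))) z) = rot (cis (r * (\<alpha> * N\<^sup>2 + (x + d)))) z"
        proof -
          have "a + r * (\<alpha> * N\<^sup>2 + x) = r * (\<alpha> * N\<^sup>2 + (x + d))" using rd by (simp add: distrib_left)
          then show ?thesis by (simp only: rot_rot cis_mult)
        qed
        ultimately show ?thesis by (simp add: g_def J'_def indicator_def)
      qed
      have "emeasure M {\<omega> \<in> space M. Z z (N\<^sup>2) \<omega> \<in> J'} = (\<integral>\<^sup>+x. ennreal (normal_density 0 N x) * g (x + d) \<partial>lborel)"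
        using transition_density[OF z J' N(1)] by (simp add: shift)
      also have "\<dots> = (\<integral>\<^sup>+x. ennreal (normal_density 0 N (x - d)) * g x \<partial>lborel)"
      proof -
        have "(\<integral>\<^sup>+x. ennreal (normal_density 0 N (x - d)) * g x \<partial>lborel)
          = ennreal \<bar>1::real\<bar> * (\<integral>\<^sup>+x. ennreal (normal_density 0 N (d + 1 * x - d)) * g (d + 1 * x) \<partial>lborel)"
          by (rule nn_integral_real_affine) auto
        then show ?thesis by (simp add: add.commute)
      qed
      finally have J'eq: "emeasure M {\<omega> \<in> space M. Z z (N\<^sup>2) \<omega> \<in> J'} = (\<integral>\<^sup>+x. ennreal (normal_density 0 N (x - d)) * g x \<partial>lborel)" .
      have "emeasure M {\<omega> \<in> space M. Z z (N\<^sup>2) \<omega> \<in> J} = (\<integral>\<^sup>+x. ennreal (normal_density 0 N x) * g x \<partial>lborel)"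
        using transition_density[OF z J N(1)] by (simp add: g_def)
      also have "\<dots> \<le> (\<integral>\<^sup>+x. ennreal (normal_density 0 N (x - d)) * g x + ennreal (max 0 (normal_density 0 N x - normal_density 0 N (x - d))) \<partial>lborel)"
      proof (rule nn_integral_mono)
        fix x
        have "g x = 0 \<or> g x = 1" by (simp add: g_def indicator_def)
        moreover have "ennreal (normal_density 0 N x) \<le> ennreal (normal_density 0 N (x - d)) + ennreal (max 0 (normal_density 0 N x - normal_density 0 N (x - d)))"
        proof -
          have "ennreal (normal_density 0 N x) \<le> ennreal (normal_density 0 N (x - d) + max 0 (normal_density 0 N x - normal_density 0 N (x - d)))"
            by (rule ennreal_leI) simp
          also have "\<dots> = ennreal (normal_density 0 N (x - d)) + ennreal (max 0 (normal_density 0 N x - normal_density 0 N (x - d)))"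
            by (rule ennreal_plus) simp_all
          finally show ?thesis .
        qed
        ultimately show "ennreal (normal_density 0 N x) * g x
            \<le> ennreal (normal_density 0 N (x - d)) * g x + ennreal (max 0 (normal_density 0 N x - normal_density 0 N (x - d)))"
          by auto
      qed
      also have "\<dots> = (\<integral>\<^sup>+x. ennreal (normal_density 0 N (x - d)) * g x \<partial>lborel) + e n"
        unfolding e_def N_def by (rule nn_integral_add) auto
      finally show ?thesis by (simp add: J'eq)
    qed
    have meas: "(\<lambda>z. emeasure M {\<omega> \<in> space M. Z z (N\<^sup>2) \<omega> \<in> J'}) \<in> borel_measurable \<nu>"
    proof -
      have "(\<lambda>z. \<integral>\<^sup>+\<omega>. indicator J' (rot (phase (N\<^sup>2) \<omega>) z) \<partial>M) \<in> borel_measurable \<nu>"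
      proof -
        have "(\<lambda>(z, \<omega>). indicator J' (rot (phase (N\<^sup>2) \<omega>) z) :: ennreal) \<in> borel_measurable (\<nu> \<Otimes>\<^sub>M M)"
          using measurable_pair_swap[OF rot_indicator_measurable[OF J' phase_measurable[OF N(2)] \<nu>'(1)]] by (simp add: split_beta')
        from borel_measurable_nn_integral[OF this]
        show ?thesis by simp
      qed
      then show ?thesis
        by (subst measurable_cong[where g="\<lambda>z. \<integral>\<^sup>+\<omega>. indicator J' (rot (phase (N\<^sup>2) \<omega>) z) \<partial>M"])
          (simp_all add: \<nu>' transition_eq[OF _ N(2) J'])
    qed
    have "emeasure \<nu> J = (\<integral>\<^sup>+z. emeasure M {\<omega> \<in> space M. Z z (N\<^sup>2) \<omega> \<in> J} \<partial>\<nu>)" by (rule inv[OF N(2) J, symmetric])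
    also have "\<dots> \<le> (\<integral>\<^sup>+z. emeasure M {\<omega> \<in> space M. Z z (N\<^sup>2) \<omega> \<in> J'} + e n \<partial>\<nu>)"
      by (rule nn_integral_mono) (rule kernel, simp add: \<nu>')
    also have "\<dots> = (\<integral>\<^sup>+z. emeasure M {\<omega> \<in> space M. Z z (N\<^sup>2) \<omega> \<in> J'} \<partial>\<nu>) + e n"
      using meas by (subst nn_integral_add) (simp_all add: \<nu>.emeasure_space_1)
    also have "\<dots> = emeasure \<nu> J' + e n" by (simp add: inv[OF N(2) J'])
    finally show ?thesis .
  qed
  moreover have "(\<lambda>n. emeasure \<nu> J' + e n) \<longlonglongrightarrow> emeasure \<nu> J' + 0"
    by (intro tendsto_add tendsto_const e)
  ultimately have "emeasure \<nu> J \<le> emeasure \<nu> J' + 0"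
    by (intro LIMSEQ_le_const) auto
  then show ?thesis by (simp add: J'_def)
qed

text \<open>The one-sided estimate for the inverse rotation, applied to the preimage of
  \<open>J\<close>, supplies the reverse inequality.\<close>

lemma invariant_is_circle_invariant:
  assumes \<nu>: "\<nu> \<in> invariant_measures M K Z"
  shows "\<nu> \<in> circle_invariants"
  unfolding circle_invariants_iff
proof (intro conjI ballI)
  show "\<nu> \<in> borel_probabilities (borel_on K)" using \<nu> by (simp add: invariant_measures_def)
  fix p :: complex and J assume p: "p \<in> circle" and J: "J \<in> sets (borel_on K)"
  have "cis (Arg2pi p) = p" using p complex_norm_eq_1_exp[of p] by (simp add: cis_conv_exp)
  then obtain a where a: "p = cis a" by metis
  define J' where "J' = {z \<in> K. rot p z \<in> J}"
  have J': "J' \<in> sets (borel_on K)" unfolding J'_def by (rule rot_preimage_sets[OF p J])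
  have "{z \<in> K. rot (cis (- a)) z \<in> J'} = J"
  proof -
    have "rot p (rot (cis (- a)) z) = z" "z \<in> K \<Longrightarrow> rot (cis (- a)) z \<in> K" for z
      by (simp_all add: a rot_rot cis_mult K_rot)
    moreover have "J \<subseteq> K" using sets.sets_into_space[OF J] by simp
    ultimately show ?thesis by (auto simp: J'_def)
  qed
  then have "emeasure \<nu> J' \<le> emeasure \<nu> J" using invariant_rot_le[OF \<nu> J', of "- a"] by simp
  moreover have "emeasure \<nu> J \<le> emeasure \<nu> J'" using invariant_rot_le[OF \<nu> J, of a] by (simp add: J'_def a)
  ultimately show "emeasure \<nu> {z \<in> K. rot p z \<in> J} = emeasure \<nu> J" by (simp add: J'_def)
qed

theorem orbit_mixture_bij_invariant:
  "bij_betw (orbit_mixture act B K) (borel_probabilities (orbit_borel act B K)) (invariant_measures M K Z)"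
proof -
  have "invariant_measures M K Z = circle_invariants"
    using circle_invariant_is_invariant invariant_is_circle_invariant by blast
  then show ?thesis using orbit_mixture_bij by simp
qed

end

section \<open>Algebra of antisymmetric matrices and the two state spaces\<close>

section \<open>Antisymmetric matrices\<close>

lemma antisymmetric_components:
  fixes B :: "real^3^3"
  assumes "transpose B = - B"
  shows "B $ 1 $ 1 = 0" "B $ 2 $ 2 = 0" "B $ 3 $ 3 = 0"
    "B $ 2 $ 1 = - B $ 1 $ 2" "B $ 3 $ 1 = - B $ 1 $ 3" "B $ 3 $ 2 = - B $ 2 $ 3"
proof -
  have "B $ i $ j = - B $ j $ i" for i j
    using arg_cong[OF assms, of "\<lambda>M. M $ j $ i"] by (simp add: transpose_def)
  from this[of 1 1] this[of 2 2] this[of 3 3] this[of 2 1] this[of 3 1] this[of 3 2]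
  show "B $ 1 $ 1 = 0" "B $ 2 $ 2 = 0" "B $ 3 $ 3 = 0"
    "B $ 2 $ 1 = - B $ 1 $ 2" "B $ 3 $ 1 = - B $ 1 $ 3" "B $ 3 $ 2 = - B $ 2 $ 3"
    by linarith+
qed

lemma rho_square:
  fixes B :: "real^3^3"
  assumes "transpose B = - B"
  shows "(rho B)\<^sup>2 = (B $ 1 $ 2)\<^sup>2 + (B $ 1 $ 3)\<^sup>2 + (B $ 2 $ 3)\<^sup>2"
  unfolding rho_def power2_norm_eq_inner
  by (simp add: inner_vec_def sum_3 antisymmetric_components[OF assms] power2_eq_square real_sqrt_pow2)

lemma rho_pos:
  fixes B :: "real^3^3"
  assumes "B \<noteq> 0"
  shows "0 < rho B"
  using assms by (simp add: rho_def)

text \<open>Cayley-Hamilton: trace and determinant of an antisymmetric 3x3 matrix vanish, and the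
  remaining coefficient of its characteristic polynomial is \<open>(rho B)\<^sup>2\<close>.\<close>

lemma antisymmetric_cube:
  fixes B :: "real^3^3"
  assumes "transpose B = - B"
  shows "B ** (B ** B) = - ((rho B)\<^sup>2 *\<^sub>R B)"
  unfolding rho_square[OF assms] vec_eq_iff forall_3 matrix_matrix_mult_def
  by (simp add: sum_3 antisymmetric_components[OF assms] power2_eq_square algebra_simps)

text \<open>Antisymmetric 3x3 matrices correspond to axial vectors and commutators to cross
  products; vectors with vanishing cross product are parallel.\<close>

lemma commuting_antisymmetric_proportional:
  fixes A B :: "real^3^3"
  assumes A: "transpose A = - A" and B: "transpose B = - B" and comm: "A ** B - B ** A = 0" and B0: "B \<noteq> 0"
  obtains \<alpha> where "A = \<alpha> *\<^sub>R B"
proof -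
  note cA = antisymmetric_components[OF A] and cB = antisymmetric_components[OF B]
  have "(A ** B - B ** A) $ i $ j = 0" for i j by (simp add: comm)
  from this[of 1 2] this[of 1 3] this[of 2 3]
  have eqs: "A $ 1 $ 3 * B $ 2 $ 3 = A $ 2 $ 3 * B $ 1 $ 3" "A $ 1 $ 2 * B $ 2 $ 3 = A $ 2 $ 3 * B $ 1 $ 2"
    "A $ 1 $ 2 * B $ 1 $ 3 = A $ 1 $ 3 * B $ 1 $ 2"
    by (simp_all add: matrix_matrix_mult_def sum_3 cA cB algebra_simps)
  define n where "n = (B $ 1 $ 2)\<^sup>2 + (B $ 1 $ 3)\<^sup>2 + (B $ 2 $ 3)\<^sup>2"
  have n: "n \<noteq> 0" unfolding n_def rho_square[OF B, symmetric] using rho_pos[OF B0] by simp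
  \<comment> \<open>The scalar product of the axial vectors up to signs, so that s / n is the
    coefficient of the projection of A onto B.\<close>
  define s where "s = A $ 1 $ 2 * B $ 1 $ 2 + A $ 1 $ 3 * B $ 1 $ 3 + A $ 2 $ 3 * B $ 2 $ 3"
  have "n * A $ 1 $ 2 = s * B $ 1 $ 2" "n * A $ 1 $ 3 = s * B $ 1 $ 3" "n * A $ 2 $ 3 = s * B $ 2 $ 3"
    unfolding n_def s_def power2_eq_square using eqs by algebra+
  then have e: "A $ 1 $ 2 = s / n * B $ 1 $ 2" "A $ 1 $ 3 = s / n * B $ 1 $ 3" "A $ 2 $ 3 = s / n * B $ 2 $ 3"
    using n by (simp_all add: field_simps)
  have "A = (s / n) *\<^sub>R B"
    unfolding vec_eq_iff forall_3 by (simp add: cA cB e)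
  then show thesis by (rule that)
qed

lemma transpose_circle_matrix:
  fixes B :: "real^3^3"
  assumes "transpose B = - B"
  shows "transpose (circle_matrix B p) = circle_matrix B (cnj p)"
proof -
  have add: "transpose (M + N) = transpose M + transpose N" and scale: "transpose (c *\<^sub>R M) = c *\<^sub>R transpose M" for M N :: "real^3^3" and c
    by (simp_all add: transpose_def vec_eq_iff)
  have "transpose (B ** B) = B ** B"
    unfolding matrix_transpose_mul assms by (simp add: matrix_matrix_mult_def vec_eq_iff)
  then show ?thesis by (simp add: circle_matrix_def add scale assms)
qed

text \<open>What multiplication of a matrix with a vector and with a matrix have in common, together
  with a closed invariant set lying on a sphere of radius \<open>c\<close>.\<close>

locale matrix_flow =
  fixes act :: "real^3^3 \<Rightarrow> 'b \<Rightarrow> 'b::euclidean_space" and A B :: "real^3^3" and K :: "'b set" and c :: real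
  assumes A_antisym: "transpose A = - A" and B_antisym: "transpose B = - B"
    and comm: "A ** B - B ** A = 0" and B_nonzero: "B \<noteq> 0"
    and act_add: "act (M + N) x = act M x + act N x" and act_scale: "act (d *\<^sub>R M) x = d *\<^sub>R act M x"
    and act_linear: "linear (act M)" and act_mult: "act (M ** N) x = act M (act N x)" and act_one: "act (mat 1) x = x"
    and act_inner: "act M x \<bullet> y = x \<bullet> act (transpose M) y"
    and K_closed: "closed K" and K_norm: "z \<in> K \<Longrightarrow> norm z = c"
    and K_invariant: "p \<in> circle \<Longrightarrow> z \<in> K \<Longrightarrow> act (circle_matrix B p) z \<in> K"
begin

lemma act_minus: "act (- M) x = - act M x"
  using act_scale[of "-1" M x] by simp

sublocale skew_operator "act B" "rho B"
proof (rule skew_operator.intro)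
  show "linear (act B)" by (rule act_linear)
  show "act B x \<bullet> y = - (x \<bullet> act B y)" for x y
    by (simp add: act_inner[of B] B_antisym act_minus)
  show "act B (act B (act B x)) = - ((rho B)\<^sup>2 *\<^sub>R act B x)" for x
    by (simp add: antisymmetric_cube[OF B_antisym] act_minus act_scale flip: act_mult)
  show "0 < rho B" by (rule rho_pos[OF B_nonzero])
qed

lemma act_rot: "act (circle_matrix B p) x = rot p x"
  by (simp add: circle_matrix_def rot_def act_add act_scale act_mult act_one)

sublocale circle_flow "act B" "rho B" act B K
  using K_invariant by unfold_locales (simp_all add: act_rot K_closed)

lemma solution_bij:
  assumes W: "wiener_process M F W"
    and sol: "\<forall>z\<in>K. stratonovich_solution M F W act A B K z (Z z)"
  shows "bij_betw (orbit_mixture act B K) (borel_probabilities (orbit_borel act B K)) (invariant_measures M K Z)"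
proof -
  obtain \<alpha> where \<alpha>: "A = \<alpha> *\<^sub>R B"
    by (rule commuting_antisymmetric_proportional[OF A_antisym B_antisym comm B_nonzero])
  interpret wiener M F W by (rule wiener.intro[OF W])
  have meas: "Z z t \<in> F t \<rightarrow>\<^sub>M borel_on K" if "z \<in> K" "0 \<le> t" for z t
    using sol that by (auto simp: stratonovich_solution_def)
  have eq: "AE \<omega> in M. Z z t \<omega> = rot (cis (rho B * (\<alpha> * t + W t \<omega>))) z" if z: "z \<in> K" and t: "0 \<le> t" for z t
  proof -
    from sol z have s: "stratonovich_solution M F W act A B K z (Z z)" by blast
    obtain I where I: "has_stratonovich_integral M W (\<lambda>t \<omega>. act B (Z z t \<omega>)) I"
      "\<And>t. 0 \<le> t \<Longrightarrow> AE \<omega> in M. Z z t \<omega> = z + integral {0..t} (\<lambda>s. act A (Z z s \<omega>)) + I t \<omega>"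
      using s unfolding stratonovich_solution_def by blast
    obtain J C where JC: "\<And>t. 0 \<le> t \<Longrightarrow> has_ito_integral M W (\<lambda>t \<omega>. act B (Z z t \<omega>)) t (J t)"
      "has_bracket M W (\<lambda>t \<omega>. act B (Z z t \<omega>)) C" "\<And>t. 0 \<le> t \<Longrightarrow> AE \<omega> in M. I t \<omega> = J t \<omega> + (1/2) *\<^sub>R C t \<omega>"
      using I(1) unfolding has_stratonovich_integral_def by blast
    \<comment> \<open>Solutions take values in K for every \<omega> and every nonnegative time,
      which provides the constant norm; proportionality of A and B brings the drift into the
      required form.\<close>
    interpret linear_sde M F W "act B" "rho B" \<alpha> c z "Z z" J C
    proof
      show "Z z t \<in> borel_measurable (F t)" if "0 \<le> t" for t
        using meas[OF z that] by (simp add: measurable_borel_on_iff)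
      show "norm (Z z t \<omega>) = c" if "0 \<le> t" "\<omega> \<in> space M" for t \<omega>
        using measurable_space[OF meas[OF z that(1)], of \<omega>] that by (simp add: K_norm)
      show "norm z = c" by (rule K_norm[OF z])
      show "AE \<omega> in M. continuous_on {0..} (\<lambda>t. Z z t \<omega>)" using s by (simp add: stratonovich_solution_def)
      show "AE \<omega> in M. Z z t \<omega> = z + integral {0..t} (\<lambda>s. \<alpha> *\<^sub>R act B (Z z s \<omega>)) + (J t \<omega> + (1/2) *\<^sub>R C t \<omega>)" if "0 \<le> t" for t
        using I(2)[OF that] JC(3)[OF that] by eventually_elim (simp add: \<alpha> act_scale)
    qed (fact JC)+
    show ?thesis by (rule solution_eq[OF t])
  qed
  interpret flow_diffusion M F W "act B" "rho B" act B K \<alpha> Z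
    by unfold_locales (rule measurable_F_M[OF meas], assumption+, rule eq, assumption+)
  show ?thesis by (rule orbit_mixture_bij_invariant)
qed

end

lemma inner_matrix_mult_left:
  fixes M X Y :: "real^3^3"
  shows "(M ** X) \<bullet> Y = X \<bullet> (transpose M ** Y)"
  by (simp add: inner_vec_def matrix_matrix_mult_def transpose_def sum_3 algebra_simps)

lemma matrix_mult_linear: "linear (\<lambda>X::real^3^3. M ** X)"
  by (rule linearI) (simp_all add: matrix_matrix_mult_def vec_eq_iff sum_3 algebra_simps)

lemma matrix_add_mult: "(M + N) ** X = M ** X + N ** X" for M N X :: "real^3^3"
  by (simp add: matrix_matrix_mult_def vec_eq_iff sum_3 algebra_simps)

lemma scaleR_matrix_mult: "(d *\<^sub>R M) ** N = d *\<^sub>R (M ** N)" for M N :: "real^3^3"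
  by (simp add: matrix_matrix_mult_def vec_eq_iff sum_3 algebra_simps)

text \<open>Left multiplication on the space of matrices is an instance of the skew operator, so the
  composition law of \<open>rot\<close> applies; evaluating it at the identity matrix gives the
  matrix identity.\<close>

lemma circle_matrix_mult:
  fixes B :: "real^3^3"
  assumes B: "transpose B = - B" and B0: "B \<noteq> 0"
  shows "circle_matrix B p ** circle_matrix B q = circle_matrix B (p * q)"
proof -
  interpret skew_operator "\<lambda>X::real^3^3. B ** X" "rho B"
  proof (rule skew_operator.intro)
    show "linear ((**) B :: real^3^3 \<Rightarrow> real^3^3)" by (rule matrix_mult_linear)
    show "(B ** X) \<bullet> Y = - (X \<bullet> (B ** Y))" for X Y :: "real^3^3"
      using scaleR_matrix_mult[of "-1" B Y] by (simp add: inner_matrix_mult_left[of B] B)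
    show "B ** (B ** (B ** X)) = - ((rho B)\<^sup>2 *\<^sub>R (B ** X))" for X :: "real^3^3"
      using antisymmetric_cube[OF B] scaleR_matrix_mult[of "- (rho B)\<^sup>2" B X] by (simp add: matrix_mul_assoc)
    show "0 < rho B" by (rule rho_pos[OF B0])
  qed
  have "circle_matrix B s ** X = rot s X" for s X
    by (simp add: circle_matrix_def rot_def matrix_add_mult scaleR_matrix_mult matrix_mul_assoc)
  then have "circle_matrix B p ** (circle_matrix B q ** mat 1) = circle_matrix B (p * q) ** mat 1"
    by (simp only: rot_rot)
  then show ?thesis by simp
qed

text \<open>Transposition is conjugation of the parameter, which is inversion on the circle; hence
  orthogonality. An orthogonal matrix that is the square of an orthogonal matrix has determinant
  1.\<close>

lemma circle_matrix_rotation: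
  fixes B :: "real^3^3"
  assumes B: "transpose B = - B" and B0: "B \<noteq> 0" and p: "p \<in> circle"
  shows "rotation_matrix (circle_matrix B p)"
proof -
  have one: "circle_matrix B 1 = mat 1" by (simp add: circle_matrix_def)
  have orth: "orthogonal_matrix (circle_matrix B q)" if "q \<in> circle" for q
  proof -
    have "q * cnj q = 1" using that by (simp add: complex_norm_square[symmetric])
    then show ?thesis
      by (simp add: orthogonal_matrix_def transpose_circle_matrix[OF B] circle_matrix_mult[OF B B0] one mult.commute)
  qed
  \<comment> \<open>A square root of \<open>p\<close> on the circle; the determinant at
    \<open>p\<close> is the square of a determinant equal to 1 or -1.\<close>
  define s where "s = csqrt p"
  have s: "s \<in> circle" "s * s = p"
    using p by (simp_all add: s_def norm_csqrt flip: power2_eq_square)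
  have "det (circle_matrix B p) = det (circle_matrix B s) * det (circle_matrix B s)"
    by (simp add: det_mul[symmetric] circle_matrix_mult[OF B B0] s)
  moreover have "det (circle_matrix B s) = 1 \<or> det (circle_matrix B s) = -1"
    by (rule det_orthogonal_matrix[OF orth[OF s(1)]])
  ultimately have "det (circle_matrix B p) = 1" by auto
  then show ?thesis using orth[OF p] by (simp add: rotation_matrix_def)
qed

lemma inner_matrix_vector_mult_left:
  fixes M :: "real^'n^'m"
  shows "(M *v x) \<bullet> y = x \<bullet> (transpose M *v y)"
  by (metis dot_lmul_matrix inner_commute transpose_matrix_vector)

lemma closed_rotation_matrices: "closed {Q::real^3^3. rotation_matrix Q}"
proof -
  have "continuous_on UNIV (\<lambda>Q::real^3^3. transpose Q ** Q)" "continuous_on UNIV (\<lambda>Q::real^3^3. Q ** transpose Q)"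
    unfolding matrix_matrix_mult_def transpose_def by (auto intro!: continuous_intros)
  moreover have "continuous_on UNIV (\<lambda>Q::real^3^3. det Q)"
    unfolding det_3 by (intro continuous_intros)
  ultimately show ?thesis
    unfolding rotation_matrix_def orthogonal_matrix_def
    by (intro closed_Collect_conj closed_Collect_eq continuous_on_const)
qed

lemma matrix_flow_sphere:
  assumes "transpose A = - A" and "transpose B = - B" and "A ** B - B ** A = 0" and "B \<noteq> 0"
  shows "matrix_flow (*v) A B (sphere (0::real^3) 1) 1"
proof (rule matrix_flow.intro)
  fix M N :: "real^3^3" and x y :: "real^3" and d :: real and p :: complex
  show "(M + N) *v x = M *v x + N *v x" by (rule matrix_vector_mult_add_rdistrib)
  show "d *\<^sub>R M *v x = d *\<^sub>R (M *v x)" by (simp add: scaleR_matrix_vector_assoc)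
  show "linear ((*v) M)" by simp
  show "M ** N *v x = M *v (N *v x)" by (simp add: matrix_vector_mul_assoc)
  show "(M *v x) \<bullet> y = x \<bullet> (transpose M *v y)" by (rule inner_matrix_vector_mult_left)
  assume p: "p \<in> circle" and x: "x \<in> sphere 0 1"
  have "orthogonal_matrix (circle_matrix B p)"
    using circle_matrix_rotation[OF assms(2,4) p] by (simp add: rotation_matrix_def)
  then have "(circle_matrix B p *v x) \<bullet> (circle_matrix B p *v x) = x \<bullet> x"
    by (simp add: inner_matrix_vector_mult_left[of "circle_matrix B p"] matrix_vector_mul_assoc orthogonal_matrix_def)
  then show "circle_matrix B p *v x \<in> sphere 0 1" using x by (simp add: norm_eq_sqrt_inner)
qed (use assms in auto)

lemma matrix_flow_rotations:
  assumes "transpose A = - A" and "transpose B = - B" and "A ** B - B ** A = 0" and "B \<noteq> 0"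
  shows "matrix_flow (**) A B {Q::real^3^3. rotation_matrix Q} (norm (mat 1 :: real^3^3))"
proof (rule matrix_flow.intro)
  fix M N X Y :: "real^3^3" and d :: real and p :: complex
  show "(M + N) ** X = M ** X + N ** X" by (rule matrix_add_mult)
  show "d *\<^sub>R M ** X = d *\<^sub>R (M ** X)" by (rule scaleR_matrix_mult)
  show "linear ((**) M :: real^3^3 \<Rightarrow> real^3^3)" by (rule matrix_mult_linear)
  show "M ** N ** X = M ** (N ** X)" by (simp add: matrix_mul_assoc)
  show "(M ** X) \<bullet> Y = X \<bullet> (transpose M ** Y)" by (rule inner_matrix_mult_left)
  show "closed {Q::real^3^3. rotation_matrix Q}" by (rule closed_rotation_matrices)
  {
    assume "X \<in> {Q. rotation_matrix Q}"
    then have "transpose X ** X = mat 1" by (simp add: rotation_matrix_def orthogonal_matrix_def)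
    \<comment> \<open>Orthogonality moves one factor across the inner product, so all rotations
      share the norm of the identity matrix and SO_3 lies on a sphere.\<close>
    then have "X \<bullet> X = mat 1 \<bullet> (mat 1 :: real^3^3)" using inner_matrix_mult_left[of X "mat 1" X] by simp
    then show "norm X = norm (mat 1 :: real^3^3)" by (simp add: norm_eq_sqrt_inner)
  }
  assume p: "p \<in> circle" and X: "X \<in> {Q. rotation_matrix Q}"
  with circle_matrix_rotation[OF assms(2,4) p] show "circle_matrix B p ** X \<in> {Q. rotation_matrix Q}"
    by (simp add: rotation_matrix_def orthogonal_matrix_mul det_mul)
qed (use assms in auto)

theorem theorem3p6:
  fixes A B :: "real^3^3"
    and M :: "'w measure" and F :: "real \<Rightarrow> 'w measure" and W :: "real \<Rightarrow> 'w \<Rightarrow> real"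
  assumes "transpose A = - A" and "transpose B = - B"
    and "A ** B - B ** A = 0" and "B \<noteq> 0"
    and "wiener_process M F W"
  shows "(\<forall>Z. (\<forall>z\<in>sphere (0::real^3) 1.
             stratonovich_solution M F W matrix_vector_mult A B (sphere 0 1) z (Z z)) \<longrightarrow>
           bij_betw (orbit_mixture matrix_vector_mult B (sphere 0 1))
             (borel_probabilities (orbit_borel matrix_vector_mult B (sphere 0 1)))
             (invariant_measures M (sphere 0 1) Z)) \<and>
         (\<forall>Z. (\<forall>z\<in>{Q::real^3^3. rotation_matrix Q}.
             stratonovich_solution M F W matrix_matrix_mult A B {Q. rotation_matrix Q} z (Z z)) \<longrightarrow>
           bij_betw (orbit_mixture matrix_matrix_mult B {Q. rotation_matrix Q})
             (borel_probabilities (orbit_borel matrix_matrix_mult B {Q. rotation_matrix Q}))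
             (invariant_measures M {Q. rotation_matrix Q} Z))"
proof (intro conjI allI impI)
  note flow = assms(1-4)
  show "bij_betw (orbit_mixture matrix_vector_mult B (sphere (0::real^3) 1))
      (borel_probabilities (orbit_borel matrix_vector_mult B (sphere 0 1))) (invariant_measures M (sphere 0 1) Z)"
    if "\<forall>z\<in>sphere 0 1. stratonovich_solution M F W matrix_vector_mult A B (sphere 0 1) z (Z z)" for Z
    by (rule matrix_flow.solution_bij[OF matrix_flow_sphere[OF flow] assms(5) that])
  show "bij_betw (orbit_mixture matrix_matrix_mult B {Q::real^3^3. rotation_matrix Q})
      (borel_probabilities (orbit_borel matrix_matrix_mult B {Q. rotation_matrix Q}))
      (invariant_measures M {Q. rotation_matrix Q} Z)"
    if "\<forall>z\<in>{Q. rotation_matrix Q}. stratonovich_solution M F W matrix_matrix_mult A B {Q. rotation_matrix Q} z (Z z)" for Z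
    by (rule matrix_flow.solution_bij[OF matrix_flow_rotations[OF flow] assms(5) that])
qed

end
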